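(* Let $\mathcal B$ be the Bruhat--Tits building of $\mathrm{PGL}_n(F)$, let $1\le k\le n-1$, and let $m\ge2$. (i) Let $(C_0,\dots,C_m)$ be a geometric geodesic of $k$-facets in $\mathcal B$. For each of the two orientations $(C_0,\dots,C_m)$ and $(C_m,\dots,C_0)$ there is at most one pointing of the facets (choice of a vertex of each facet) in that order which makes the oriented sequence into a combinatorial geodesic. Moreover, for $k\ge2$, exactly one of the two orientations admits such a pointing. For $k=1$, both orientations admit such pointings, and both oriented pointed sequences are combinatorial geodesics. (ii) Let $(\dot C_0,\dots,\dot C_m)$ be a combinatorial geodesic of pointed $k$-facets in $\mathcal B$, and let $C_i$ denote the underlying $k$-facet of $\dot C_i$. Then $(C_0,\dots,C_m)$ is a geometric geodesic of $k$-facets.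
   Context: $n\ge2$; $F$ is a non-Archimedean local field with ring of integers $\mathcal O$, uniformizer $\pi$, residue field $\kappa=\mathcal O/\pi\mathcal O$. The building $\mathcal B$ is the simplicial complex whose vertices are homothety classes $[L]$ of $\mathcal O$-lattices $L\subset F^n$; distinct vertices form a $k$-simplex (called a $k$-facet) iff, after reordering, they have representatives with $L_0\supsetneq L_1\supsetneq\cdots\supsetneq L_k\supsetneq\pi L_0$. Its geometric realization carries the usual CAT(0) metric, in which every apartment is isometric to the Euclidean space $\mathbb R^n/\mathbb R(1,\dots,1)$; $\overline C$ denotes the closed simplex of a facet $C$. **Geometric geodesic.** A sequence $(C_0,\dots,C_m)$ of pairwise distinct $k$-facets is a geometric geodesic if for all $0\le i\le j\le m$ the convex hull of $\overline C_i\cup\overline C_j$ in the CAT(0) realization equals $\overline C_i\cup\overline C_{i+1}\cup\cdots\cup\overline C_j$. **Pointed facets, successors, combinatorial geodesic.** A pointed $k$-facet is a pair $(C,v)$ with $v$ a vertex of the $k$-facet $C$; with $v=[L_0]$ it is uniquely written $[L_0,\dots,L_k]$ with $L_0\supsetneq\cdots\supsetneq L_k\supsetneq\pi L_0$ (up to common homothety). A successor of $[L_0,\dots,L_k]$ ($k\ge1$) is a pointed $k$-facet $[L_1,\dots,L_k,\pi L_0']$ where $L_0'$ is a lattice with $L_0\cap L_0'=L_1$ and $L_0+L_0'=\pi^{-1}L_k$; equivalently, the two underlying facets are opposite in the link (a spherical building) of the common $(k-1)$-facet with vertices $[L_1],\dots,[L_k]$. A sequence $(\dot C_0,\dots,\dot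 C_m)$ of pointed $k$-facets is a combinatorial geodesic if $\dot C_{i+1}$ is a successor of $\dot C_i$ for $0\le i\le m-1$. *)

theory Defs
  imports "HOL-Analysis.Analysis"
begin

section \<open>Convexity in a geodesic metric space\<close>

definition geodesic_path :: "'p set \<Rightarrow> ('p \<Rightarrow> 'p \<Rightarrow> real) \<Rightarrow> real \<Rightarrow> (real \<Rightarrow> 'p) \<Rightarrow> bool" where
  "geodesic_path X d l \<gamma> \<longleftrightarrow>
     0 \<le> l \<and> \<gamma> ` {0..l} \<subseteq> X \<and> (\<forall>s\<in>{0..l}. \<forall>t\<in>{0..l}. d (\<gamma> s) (\<gamma> t) = \<bar>s - t\<bar>)"

definition geodesically_convex :: "'p set \<Rightarrow> ('p \<Rightarrow> 'p \<Rightarrow> real) \<Rightarrow> 'p set \<Rightarrow> bool" where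
  "geodesically_convex X d K \<longleftrightarrow>
     K \<subseteq> X \<and>
     (\<forall>l \<gamma>. geodesic_path X d l \<gamma> \<and> \<gamma> 0 \<in> K \<and> \<gamma> l \<in> K \<longrightarrow> \<gamma> ` {0..l} \<subseteq> K)"

definition geodesic_convex_hull :: "'p set \<Rightarrow> ('p \<Rightarrow> 'p \<Rightarrow> real) \<Rightarrow> 'p set \<Rightarrow> 'p set" where
  "geodesic_convex_hull X d S = \<Inter>{K. geodesically_convex X d K \<and> S \<subseteq> K}"


section \<open>Non-Archimedean local fields\<close>

text \<open>
  A non-Archimedean local field is a field that is complete for a normalized discrete valuation
  and has finite residue field. The integer \<open>val x\<close> is meaningful only for \<open>x \<noteq> 0\<close>; every use
  below treats \<open>0\<close> (of infinite valuation) separately.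
\<close>

definition val_close :: "('a::field \<Rightarrow> int) \<Rightarrow> int \<Rightarrow> 'a \<Rightarrow> 'a \<Rightarrow> bool" where
  "val_close val N x y \<longleftrightarrow> x = y \<or> N \<le> val (x - y)"

definition valuation_ring :: "('a::field \<Rightarrow> int) \<Rightarrow> 'a set" where
  "valuation_ring val = {x. x = 0 \<or> 0 \<le> val x}"

locale nonarch_local_field =
  fixes val :: "'a::field \<Rightarrow> int" and \<pi> :: 'a
  assumes val_mult: "x \<noteq> 0 \<Longrightarrow> y \<noteq> 0 \<Longrightarrow> val (x * y) = val x + val y"
    and val_add: "x \<noteq> 0 \<Longrightarrow> y \<noteq> 0 \<Longrightarrow> x + y \<noteq> 0 \<Longrightarrow> min (val x) (val y) \<le> val (x + y)"
    and uniformizer: "\<pi> \<noteq> 0" "val \<pi> = 1"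
    and complete:
      "(\<And>N. \<exists>M. \<forall>i\<ge>M. \<forall>j\<ge>M. val_close val N (f i) (f j)) \<Longrightarrow>
       \<exists>l. \<forall>N. \<exists>M::nat. \<forall>i\<ge>M. val_close val N (f i) l"
    and finite_residue_field:
      "finite (valuation_ring val //
         {(x, y). x \<in> valuation_ring val \<and> y \<in> valuation_ring val \<and>
                  x - y \<in> (*) \<pi> ` valuation_ring val})"


section \<open>Lattices and the Bruhat--Tits building\<close>

type_synonym ('a, 'n) lattice = "('a, 'n) vec set"
type_synonym ('a, 'n) vertex = "('a, 'n) lattice set"
type_synonym ('a, 'n) facet = "('a, 'n) vertex set"
type_synonym ('a, 'n) point = "('a, 'n) vertex \<Rightarrow> real"

definition indexed_basis :: "('n::finite \<Rightarrow> 'a::field ^ 'n) \<Rightarrow> bool" where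
  "indexed_basis b \<longleftrightarrow> inj b \<and> vec.independent (range b) \<and> vec.span (range b) = UNIV"

definition scale :: "'a::field \<Rightarrow> ('a, 'n::finite) lattice \<Rightarrow> ('a, 'n) lattice" where
  "scale c L = (*s) c ` L"

definition homothety_class :: "('a::field, 'n::finite) lattice \<Rightarrow> ('a, 'n) vertex" where
  "homothety_class L = {scale c L | c. c \<noteq> 0}"

definition closed_simplex :: "('a::field, 'n::finite) facet \<Rightarrow> ('a, 'n) point set" where
  "closed_simplex C =
     {x. (\<forall>v. 0 \<le> x v) \<and> (\<forall>v. v \<notin> C \<longrightarrow> x v = 0) \<and> (\<Sum>v\<in>C. x v) = 1}"

text \<open>
  The Euclidean space \<open>\<real>\<^sup>n / \<real>(1,\<dots>,1)\<close>, with its quotient metric, is realized as the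
  orthogonal complement of \<open>(1,\<dots>,1)\<close> in \<open>\<real>\<^sup>n\<close> by means of the orthogonal projection.
\<close>

definition mod_diagonal :: "real ^ 'n::finite \<Rightarrow> real ^ 'n" where
  "mod_diagonal u = (\<chi> i. u $ i - (\<Sum>j\<in>UNIV. u $ j) / real CARD('n))"

context nonarch_local_field
begin

definition integer_span :: "('n::finite \<Rightarrow> 'a ^ 'n) \<Rightarrow> ('a, 'n) lattice" where
  "integer_span b = {\<Sum>i\<in>UNIV. c i *s b i | c. range c \<subseteq> valuation_ring val}"

definition lattice :: "('a, 'n::finite) lattice \<Rightarrow> bool" where
  "lattice L \<longleftrightarrow> (\<exists>b. indexed_basis b \<and> L = integer_span b)"

text \<open>\<open>[L\<^sub>0, \<dots>, L\<^sub>k]\<close> with \<open>L\<^sub>0 \<supset> \<dots> \<supset> L\<^sub>k \<supset> \<pi> L\<^sub>0\<close>, all inclusions strict.\<close>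

definition lattice_chain :: "('a, 'n::finite) lattice list \<Rightarrow> bool" where
  "lattice_chain Ls \<longleftrightarrow>
     Ls \<noteq> [] \<and> (\<forall>L\<in>set Ls. lattice L) \<and> sorted_wrt (\<supset>) Ls \<and> scale \<pi> (hd Ls) \<subset> last Ls"

definition facet :: "nat \<Rightarrow> ('a, 'n::finite) facet \<Rightarrow> bool" where
  "facet k C \<longleftrightarrow>
     (\<exists>Ls. length Ls = k + 1 \<and> lattice_chain Ls \<and> C = homothety_class ` set Ls)"

definition realization :: "('a, 'n::finite) point set" where
  "realization = \<Union>{closed_simplex C | C. \<exists>k. facet k C}"


subsection \<open>Apartments and the metric\<close>

definition apartment_lattice :: "('n::finite \<Rightarrow> 'a ^ 'n) \<Rightarrow> ('n \<Rightarrow> int) \<Rightarrow> ('a, 'n) lattice" where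
  "apartment_lattice b a = integer_span (\<lambda>i. (\<pi> powi a i) *s b i)"

definition apartment_vertices :: "('n::finite \<Rightarrow> 'a ^ 'n) \<Rightarrow> ('a, 'n) vertex set" where
  "apartment_vertices b = range (\<lambda>a. homothety_class (apartment_lattice b a))"

definition apartment :: "('n::finite \<Rightarrow> 'a ^ 'n) \<Rightarrow> ('a, 'n) point set" where
  "apartment b = {x \<in> realization. \<forall>v. x v \<noteq> 0 \<longrightarrow> v \<in> apartment_vertices b}"

text \<open>
  For a basis \<open>b\<close>, the exponent vector of a vertex of the apartment is unique up to adding a
  multiple of \<open>(1,\<dots>,1)\<close>, so the choice made here does not matter. The chart of the apartment
  is the extension of these coordinates that is affine on every simplex.
\<close>

definition vertex_coords :: "('n::finite \<Rightarrow> 'a ^ 'n) \<Rightarrow> ('a, 'n) vertex \<Rightarrow> real ^ 'n" where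
  "vertex_coords b v =
     mod_diagonal (\<chi> i. real_of_int ((SOME a. v = homothety_class (apartment_lattice b a)) i))"

definition apartment_chart :: "('n::finite \<Rightarrow> 'a ^ 'n) \<Rightarrow> ('a, 'n) point \<Rightarrow> real ^ 'n" where
  "apartment_chart b x = (\<Sum>v | x v \<noteq> 0. x v *\<^sub>R vertex_coords b v)"

text \<open>
  Any two points lie in a common apartment, and their distance is the Euclidean distance measured
  in any such apartment.
\<close>

definition building_dist :: "('a, 'n::finite) point \<Rightarrow> ('a, 'n) point \<Rightarrow> real" where
  "building_dist x y =
     (THE r. \<exists>b. indexed_basis b \<and> x \<in> apartment b \<and> y \<in> apartment b \<and>
                 r = dist (apartment_chart b x) (apartment_chart b y))"


subsection \<open>Geodesics of facets\<close>

definition geometric_geodesic :: "nat \<Rightarrow> ('a, 'n::finite) facet list \<Rightarrow> bool" where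
  "geometric_geodesic k Cs \<longleftrightarrow>
     Cs \<noteq> [] \<and> distinct Cs \<and> (\<forall>C\<in>set Cs. facet k C) \<and>
     (\<forall>i j. i \<le> j \<and> j < length Cs \<longrightarrow>
        geodesic_convex_hull realization building_dist
          (closed_simplex (Cs ! i) \<union> closed_simplex (Cs ! j)) =
        (\<Union>l\<in>{i..j}. closed_simplex (Cs ! l)))"

definition pointed_facet :: "nat \<Rightarrow> ('a, 'n::finite) facet \<times> ('a, 'n) vertex \<Rightarrow> bool" where
  "pointed_facet k P \<longleftrightarrow> facet k (fst P) \<and> snd P \<in> fst P"

definition pointed_facet_of ::
    "('a, 'n::finite) lattice list \<Rightarrow> ('a, 'n) facet \<times> ('a, 'n) vertex" where
  "pointed_facet_of Ls = (homothety_class ` set Ls, homothety_class (hd Ls))"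

definition successor ::
    "nat \<Rightarrow> ('a, 'n::finite) facet \<times> ('a, 'n) vertex \<Rightarrow> ('a, 'n) facet \<times> ('a, 'n) vertex \<Rightarrow> bool" where
  "successor k P P' \<longleftrightarrow>
     1 \<le> k \<and>
     (\<exists>Ls L'. length Ls = k + 1 \<and> lattice_chain Ls \<and> P = pointed_facet_of Ls \<and>
        lattice L' \<and>
        hd Ls \<inter> L' = Ls ! 1 \<and>
        {x + y | x y. x \<in> hd Ls \<and> y \<in> L'} = scale (inverse \<pi>) (last Ls) \<and>
        lattice_chain (tl Ls @ [scale \<pi> L']) \<and>
        P' = pointed_facet_of (tl Ls @ [scale \<pi> L']))"

definition combinatorial_geodesic ::
    "nat \<Rightarrow> (('a, 'n::finite) facet \<times> ('a, 'n) vertex) list \<Rightarrow> bool" where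
  "combinatorial_geodesic k Ps \<longleftrightarrow>
     Ps \<noteq> [] \<and> (\<forall>P\<in>set Ps. pointed_facet k P) \<and>
     (\<forall>i. Suc i < length Ps \<longrightarrow> successor k (Ps ! i) (Ps ! Suc i))"

definition geodesic_pointing ::
    "nat \<Rightarrow> ('a, 'n::finite) facet list \<Rightarrow> ('a, 'n) vertex list \<Rightarrow> bool" where
  "geodesic_pointing k Cs vs \<longleftrightarrow>
     length vs = length Cs \<and> (\<forall>i<length Cs. vs ! i \<in> Cs ! i) \<and>
     combinatorial_geodesic k (zip Cs vs)"

end

end

theory Submission
  imports Defs
begin

text \<open>
  Points of the building are norms on \<open>F\<^sup>n\<close>, and an apartment, charted by \<open>\<real>\<^sup>n\<close> modulo the diagonal,
  consists of the norms split by its basis.  Retractions from infinity onto an apartment do not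
  increase distances, so distances and convex hulls of subsets of an apartment are the Euclidean
  ones.  The \<open>k\<close>-facets of an apartment are the periodic increasing chains
  \<open>a : \<int> \<Rightarrow> \<int>\<^sup>n\<close> with \<open>a (i + k + 1) = a i + (1, \<dots>, 1)\<close>.

  A geometric geodesic lies in one apartment, and convexity of the union of two adjacent facets
  forces one to arise from the other by a mutation \<open>a i \<mapsto> a (i + 1) + a (i - 1) - a i\<close>.  Convexity
  of three and four consecutive facets shows that the index \<open>i\<close> moves by \<open>1\<close>, always in the same
  direction modulo \<open>k + 1\<close>; the mutation of index \<open>i\<close> is a successor step exactly if \<open>[a i]\<close> is the
  marked vertex, so the direction determines the orientation that can be pointed, and for \<open>k = 1\<close> both
  directions agree.  Conversely, a combinatorial geodesic is a sequence of lattices that is split by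
  a common basis, and in the corresponding apartment its facets fill a straight convex tube.
\<close>

section \<open>Coordinates with respect to a basis\<close>

text \<open>The metric is given by a definite description over apartments, and hulls are
  intersections over all geodesically convex subsets of the building; no CAT(0) inequality is
  proved. What replaces it: every ordering of the basis yields one retraction, and a point that all
  these retractions send to the same place lies in the apartment. This forces a geodesic with ends
  in an apartment to be the straight segment. So apartments are convex, and an apartment through the
  first and the last facet contains all the others. Retractions do not expand because two bases that
  split the same norm have the same weights up to a permutation and integers, which follows by
  comparing valuations of determinants. In the combinatorial direction the definition of a successor
  makes multiplication by \<pi> injective on successive quotients, so each middle lattice is the
  intersection of the first lattice with a multiple of one from the last facet. The direction of a
  geodesic shows only in two consecutive mutations, hence \<open>2 \<le> m\<close>.\<close>

definition coord :: "('n::finite \<Rightarrow> 'a::field ^ 'n) \<Rightarrow> 'a ^ 'n \<Rightarrow> 'n \<Rightarrow> 'a" where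
  "coord b u = (SOME c. u = (\<Sum>i\<in>UNIV. c i *s b i))"

text \<open>Independence of the family is all there is to check: coefficients 1 and -1 at two
  indices with equal values show injectivity, and spanning follows by counting dimensions.\<close>

lemma indexed_basisI:
  fixes b :: "'n::finite \<Rightarrow> 'a::field ^ 'n"
  assumes "\<And>c. (\<Sum>i\<in>UNIV. c i *s b i) = 0 \<Longrightarrow> c = (\<lambda>_. 0)"
  shows "indexed_basis b"
proof -
  have inj: "inj b"
  proof (rule injI, rule ccontr)
    fix i j assume eq: "b i = b j" and ne: "i \<noteq> j"
    let ?c = "\<lambda>l. (if l = i then 1 else 0) - (if l = j then 1 else 0) :: 'a"
    have "(\<Sum>l\<in>UNIV. ?c l *s b l) =
        (\<Sum>l\<in>UNIV. (if l = i then b l else 0)) - (\<Sum>l\<in>UNIV. (if l = j then b l else 0))"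
      by (subst sum_subtractf[symmetric], rule sum.cong) (auto simp: vec_eq_iff)
    also have "\<dots> = 0" using eq by simp
    finally have "?c = (\<lambda>_. 0)" by (rule assms)
    then have "?c i = 0" by (rule fun_cong)
    with ne show False by simp
  qed
  have indep: "vec.independent (range b)"
  proof (rule vec.independent_if_scalars_zero)
    fix f x assume s: "(\<Sum>x\<in>range b. f x *s x) = 0" and x: "x \<in> range b"
    have "(\<Sum>i\<in>UNIV. f (b i) *s b i) = 0"
      using s by (subst (asm) sum.reindex[OF inj]) simp
    then have "(\<lambda>i. f (b i)) = (\<lambda>_. 0)" by (rule assms)
    with x show "f x = 0" by (metis imageE)
  qed simp
  have "vec.dim (UNIV :: ('a^'n) set) = CARD('n)"
    by (simp add: card_cart_basis)
  moreover have "card (range b) = CARD('n)" using inj by (rule card_image)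
  ultimately have "UNIV \<subseteq> vec.span (range b)"
    by (intro vec.card_ge_dim_independent[OF _ indep]) auto
  with inj indep show ?thesis by (auto simp: indexed_basis_def)
qed

context
  fixes b :: "'n::finite \<Rightarrow> 'a::field ^ 'n"
  assumes b: "indexed_basis b"
begin

lemma indexed_basis_sum_eq_0_iff: "(\<Sum>i\<in>UNIV. c i *s b i) = 0 \<longleftrightarrow> c = (\<lambda>_. 0)"
proof
  assume s: "(\<Sum>i\<in>UNIV. c i *s b i) = 0"
  from b have inj: "inj b" and ind: "vec.independent (range b)"
    by (auto simp: indexed_basis_def)
  have "(\<Sum>x\<in>range b. c (inv b x) *s x) = 0"
    by (subst sum.reindex[OF inj]) (simp add: s inj)
  then have "\<forall>x\<in>range b. c (inv b x) = 0"
    using ind by (subst (asm) vec.dependent_finite) auto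
  then show "c = (\<lambda>_. 0)" by (auto simp: inj)
qed simp

lemma indexed_basis_sum_inject:
  "(\<Sum>i\<in>UNIV. c i *s b i) = (\<Sum>i\<in>UNIV. d i *s b i) \<longleftrightarrow> c = d"
proof
  assume "(\<Sum>i\<in>UNIV. c i *s b i) = (\<Sum>i\<in>UNIV. d i *s b i)"
  then have "(\<Sum>i\<in>UNIV. (c i - d i) *s b i) = 0"
    by (simp add: vec.scale_left_diff_distrib sum_subtractf)
  then have "(\<lambda>i. c i - d i) = (\<lambda>_. 0)" by (subst (asm) indexed_basis_sum_eq_0_iff)
  then show "c = d" by (auto simp: fun_eq_iff)
qed simp

lemma coord_sum [simp]: "(\<Sum>i\<in>UNIV. coord b u i *s b i) = u"
proof -
  have "u \<in> vec.span (range b)" using b by (auto simp: indexed_basis_def)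
  then obtain g where "u = (\<Sum>x\<in>range b. g x *s x)"
    by (subst (asm) vec.span_finite) auto
  moreover have "inj b" using b by (auto simp: indexed_basis_def)
  ultimately have "u = (\<Sum>i\<in>UNIV. g (b i) *s b i)"
    by (simp add: sum.reindex)
  then have "\<exists>c. u = (\<Sum>i\<in>UNIV. c i *s b i)"
    by (rule exI[of _ "\<lambda>i. g (b i)"])
  then have "u = (\<Sum>i\<in>UNIV. coord b u i *s b i)"
    unfolding coord_def by (rule someI_ex)
  then show ?thesis by (rule sym)
qed

lemma coord_eqI: "(\<Sum>i\<in>UNIV. c i *s b i) = u \<Longrightarrow> coord b u = c"
  using indexed_basis_sum_inject[of "coord b u" c] by simp

lemma coord_of_sum [simp]: "coord b (\<Sum>i\<in>UNIV. c i *s b i) = c"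
  by (rule coord_eqI) simp

lemma coord_add: "coord b (u + w) i = coord b u i + coord b w i"
proof -
  have "coord b (u + w) = (\<lambda>i. coord b u i + coord b w i)"
    by (rule coord_eqI) (simp add: vec.scale_left_distrib sum.distrib)
  then show ?thesis by simp
qed

lemma coord_scale: "coord b (c *s u) i = c * coord b u i"
proof -
  have "coord b (c *s u) = (\<lambda>i. c * coord b u i)"
  proof (rule coord_eqI)
    have "c *s u = c *s (\<Sum>i\<in>UNIV. coord b u i *s b i)" by simp
    also have "\<dots> = (\<Sum>i\<in>UNIV. (c * coord b u i) *s b i)"
      by (subst vec.scale_sum_right) simp
    finally show "(\<Sum>i\<in>UNIV. (c * coord b u i) *s b i) = c *s u" by (rule sym)
  qed
  then show ?thesis by simp
qed

lemma coord_diff: "coord b (u - w) i = coord b u i - coord b w i"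
  using coord_add[of u "(-1) *s w" i] coord_scale[of "-1" w i] by simp

lemma coord_zero [simp]: "coord b 0 i = 0"
  using coord_scale[of 0 0 i] by simp

lemma coord_sum_left: "coord b (\<Sum>j\<in>I. f j) i = (\<Sum>j\<in>I. coord b (f j) i)"
  by (induction I rule: infinite_finite_induct) (auto simp: coord_add)

lemma coord_basis: "coord b (b j) i = (if i = j then 1 else 0)"
proof -
  have "coord b (b j) = (\<lambda>i. if i = j then 1 else 0)"
  proof (rule coord_eqI)
    have "(\<Sum>i\<in>UNIV. (if i = j then 1 else 0) *s b i) = (\<Sum>i\<in>UNIV. if i = j then b i else 0)"
      by (rule sum.cong) auto
    then show "(\<Sum>i\<in>UNIV. (if i = j then 1 else 0) *s b i) = b j" by simp
  qed
  then show ?thesis by simp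
qed

lemma coord_eq_iff: "u = w \<longleftrightarrow> (\<forall>i. coord b u i = coord b w i)"
  by (metis coord_sum ext)

lemma coord_nonzero: "u \<noteq> 0 \<Longrightarrow> \<exists>i. coord b u i \<noteq> 0"
  using coord_eq_iff[of u 0] by auto

end

lemma indexed_basis_nonzero: "indexed_basis b \<Longrightarrow> b i \<noteq> 0"
  using coord_basis[of b i i] coord_zero[of b i] by fastforce

lemma indexed_basis_rescale:
  assumes b: "indexed_basis b" and c: "\<And>i. c i \<noteq> (0::'a::field)"
  shows "indexed_basis (\<lambda>i. c i *s b i)"
proof (rule indexed_basisI)
  fix d assume "(\<Sum>i\<in>UNIV. d i *s (c i *s b i)) = 0"
  then have "(\<Sum>i\<in>UNIV. (d i * c i) *s b i) = 0" by simp
  then have "(\<lambda>i. d i * c i) = (\<lambda>_. 0)" by (simp only: indexed_basis_sum_eq_0_iff[OF b])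
  with c show "d = (\<lambda>_. 0)" by (auto simp: fun_eq_iff)
qed

lemma exchange_indexed_basis:
  assumes e: "indexed_basis e" and x: "coord e x j \<noteq> 0"
  shows "indexed_basis (e(j := x))"
proof (rule indexed_basisI)
  fix c assume s: "(\<Sum>i\<in>UNIV. c i *s (e(j := x)) i) = 0"
  have split: "(\<Sum>i\<in>UNIV. c i *s (e(j := x)) i) = c j *s x + (\<Sum>i\<in>UNIV-{j}. c i *s e i)"
    by (subst sum.remove[of _ j]) auto
  have c: "coord e (\<Sum>i\<in>UNIV-{j}. c i *s e i) l = (if l = j then 0 else c l)" for l
  proof -
    have "coord e (\<Sum>i\<in>UNIV-{j}. c i *s e i) l = (\<Sum>i\<in>UNIV-{j}. if i = l then c i else 0)"
      unfolding coord_sum_left[OF e]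
      by (rule sum.cong) (auto simp: coord_scale[OF e] coord_basis[OF e])
    then show ?thesis by (simp add: sum.delta)
  qed
  have l: "c j * coord e x l + (if l = j then 0 else c l) = 0" for l
    using arg_cong[OF s[unfolded split], of "\<lambda>u. coord e u l"]
    by (simp only: coord_add[OF e] coord_scale[OF e] c coord_zero[OF e])
  from l[of j] x have "c j = 0" by simp
  moreover from this l have "c l = 0" if "l \<noteq> j" for l
    using that by (metis add_0 mult_zero_left)
  ultimately show "c = (\<lambda>_. 0)" by (metis ext)
qed

text \<open>Found by solving the expansion of \<open>x\<close> for \<open>e j\<close> and
  substituting into the expansion of \<open>u\<close>.\<close>

lemma coord_exchange:
  assumes e: "indexed_basis e" and x: "coord e x j \<noteq> 0"
  shows "coord (e(j := x)) u i =
    (if i = j then coord e u j / coord e x j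
     else coord e u i - coord e u j * coord e x i / coord e x j)" (is "_ = ?c i")
proof -
  have "coord (e(j := x)) u = ?c"
  proof (rule coord_eqI[OF exchange_indexed_basis[OF e x]])
    have "(\<Sum>i\<in>UNIV. ?c i *s (e(j := x)) i) = ?c j *s x + (\<Sum>i\<in>UNIV-{j}. ?c i *s e i)"
      by (subst sum.remove[of _ j]) auto
    also have "(\<Sum>i\<in>UNIV-{j}. ?c i *s e i) =
        (\<Sum>i\<in>UNIV. (coord e u i - coord e u j * coord e x i / coord e x j) *s e i)"
      using x by (intro sum.mono_neutral_cong_left) auto
    also have "\<dots> = (\<Sum>i\<in>UNIV. coord e u i *s e i) -
        (coord e u j / coord e x j) *s (\<Sum>i\<in>UNIV. coord e x i *s e i)"
      by (simp add: vec.scale_left_diff_distrib sum_subtractf vec.scale_sum_right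
          del: coord_sum)
    also have "\<dots> = u - (coord e u j / coord e x j) *s x"
      by (simp add: coord_sum[OF e])
    finally show "(\<Sum>i\<in>UNIV. ?c i *s (e(j := x)) i) = u" by simp
  qed
  then show ?thesis by simp
qed

section \<open>Valuations\<close>

context nonarch_local_field
begin

declare uniformizer [simp]

lemma val_one [simp]: "val 1 = 0"
  using val_mult[of 1 1] by simp

lemma val_minus_one [simp]: "val (-1) = 0"
  using val_mult[of "-1" "-1"] by simp

lemma val_minus [simp]: "val (- x) = val x"
  using val_mult[of "-1" x] by (cases "x = 0") auto

lemma val_inverse: "x \<noteq> 0 \<Longrightarrow> val (inverse x) = - val x"
  using val_mult[of x "inverse x"] by simp

lemma val_divide: "x \<noteq> 0 \<Longrightarrow> y \<noteq> 0 \<Longrightarrow> val (x / y) = val x - val y"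
  by (simp add: divide_inverse val_mult val_inverse)

lemma val_powi [simp]: "val (\<pi> powi m) = m"
proof -
  have n: "val (\<pi> ^ n) = int n" for n
    by (induction n) (auto simp: val_mult uniformizer)
  show ?thesis
    by (cases "0 \<le> m")
      (auto simp: power_int_def n val_inverse uniformizer power_inverse simp del: inverse_eq_divide)
qed

lemma val_prod: "finite I \<Longrightarrow> (\<And>i. i \<in> I \<Longrightarrow> f i \<noteq> 0) \<Longrightarrow> val (\<Prod>i\<in>I. f i) = (\<Sum>i\<in>I. val (f i))"
  by (induction I rule: finite_induct) (auto simp: val_mult)

text \<open>The ultrametric inequality with a witness instead of a minimum, since
  \<open>val 0\<close> has no meaning and zero summands must be left out.\<close>

lemma val_sum_ge:
  assumes "finite I" "(\<Sum>i\<in>I. f i) \<noteq> 0"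
  shows "\<exists>i\<in>I. f i \<noteq> 0 \<and> val (f i) \<le> val (\<Sum>i\<in>I. f i)"
  using assms
proof (induction I rule: finite_induct)
  case (insert j I)
  show ?case
  proof (cases "(\<Sum>i\<in>I. f i) = 0 \<or> f j = 0")
    case True
    with insert show ?thesis by auto
  next
    case False
    have "f j + (\<Sum>i\<in>I. f i) \<noteq> 0" using insert by simp
    with False have "min (val (f j)) (val (\<Sum>i\<in>I. f i)) \<le> val (f j + (\<Sum>i\<in>I. f i))"
      by (intro val_add) auto
    with False insert show ?thesis by (fastforce simp: min_def split: if_splits)
  qed
qed simp

lemma val_diff_ge: "x \<noteq> 0 \<Longrightarrow> y \<noteq> 0 \<Longrightarrow> x - y \<noteq> 0 \<Longrightarrow> min (val x) (val y) \<le> val (x - y)"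
  using val_add[of x "-y"] by simp

end

section \<open>Lattices and their norms\<close>

lemma scale_scale: "scale c (scale d L) = scale (c * d) L"
  by (auto simp: scale_def image_image)

lemma scale_one [simp]: "scale 1 L = L"
  by (simp add: scale_def)

lemma mem_scale_iff: "c \<noteq> 0 \<Longrightarrow> u \<in> scale c L \<longleftrightarrow> inverse c *s u \<in> L"
  by (force simp: scale_def image_iff)

lemma scale_subset_iff: "c \<noteq> 0 \<Longrightarrow> scale c L \<subseteq> scale c L' \<longleftrightarrow> L \<subseteq> L'"
proof
  assume c: "c \<noteq> 0" and sub: "scale c L \<subseteq> scale c L'"
  show "L \<subseteq> L'"
  proof
    fix u assume "u \<in> L"
    then have "c *s u \<in> scale c L" by (auto simp: scale_def)
    with sub have "c *s u \<in> scale c L'" by auto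
    with c show "u \<in> L'" by (simp add: mem_scale_iff)
  qed
qed (auto simp: scale_def)

lemma scale_psubset_iff: "c \<noteq> 0 \<Longrightarrow> scale c L \<subset> scale c L' \<longleftrightarrow> L \<subset> L'"
  by (auto simp: psubset_eq scale_subset_iff)
    (metis scale_subset_iff subset_antisym order_refl)+

lemma homothety_class_eq_iff:
  "homothety_class L = homothety_class L' \<longleftrightarrow> (\<exists>c. c \<noteq> 0 \<and> L' = scale c L)"
proof
  assume "homothety_class L = homothety_class L'"
  moreover have "L' \<in> homothety_class L'"
    unfolding homothety_class_def by (auto intro!: exI[of _ 1])
  ultimately have "L' \<in> homothety_class L" by simp
  then show "\<exists>c. c \<noteq> 0 \<and> L' = scale c L"
    by (auto simp: homothety_class_def)
next
  assume "\<exists>c. c \<noteq> 0 \<and> L' = scale c L"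
  then obtain c where c: "c \<noteq> 0" "L' = scale c L" by auto
  then have L: "L = scale (inverse c) L'" by (simp add: scale_scale)
  show "homothety_class L = homothety_class L'"
  proof (intro subset_antisym subsetI)
    fix M assume "M \<in> homothety_class L"
    then obtain d where "d \<noteq> 0" "M = scale d L" by (auto simp: homothety_class_def)
    with c L show "M \<in> homothety_class L'"
      by (auto simp: homothety_class_def scale_scale intro!: exI[of _ "d * inverse c"])
  next
    fix M assume "M \<in> homothety_class L'"
    then obtain d where "d \<noteq> 0" "M = scale d L'" by (auto simp: homothety_class_def)
    with c show "M \<in> homothety_class L"
      by (auto simp: homothety_class_def scale_scale intro!: exI[of _ "d * c"])
  qed
qed

lemma homothety_class_scale: "c \<noteq> 0 \<Longrightarrow> homothety_class (scale c L) = homothety_class L"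
  using homothety_class_eq_iff by metis

lemma mem_homothety_class: "L \<in> homothety_class L"
  unfolding homothety_class_def by (auto intro!: exI[of _ 1])

context nonarch_local_field
begin

lemma mem_apartment_lattice:
  assumes b: "indexed_basis b"
  shows "u \<in> apartment_lattice b a \<longleftrightarrow> (\<forall>i. coord b u i = 0 \<or> a i \<le> val (coord b u i))"
proof
  assume "u \<in> apartment_lattice b a"
  then obtain c where c: "range c \<subseteq> valuation_ring val"
    and u: "u = (\<Sum>i\<in>UNIV. c i *s ((\<pi> powi a i) *s b i))"
    by (auto simp: apartment_lattice_def integer_span_def)
  have "coord b u = (\<lambda>i. c i * \<pi> powi a i)"
    by (rule coord_eqI[OF b]) (simp add: u)
  moreover have "c i = 0 \<or> 0 \<le> val (c i)" for i
    using c by (auto simp: valuation_ring_def)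
  ultimately show "\<forall>i. coord b u i = 0 \<or> a i \<le> val (coord b u i)"
    by (simp add: val_mult) (smt (verit) uniformizer(1) power_int_not_zero val_mult val_powi)
next
  assume *: "\<forall>i. coord b u i = 0 \<or> a i \<le> val (coord b u i)"
  let ?c = "\<lambda>i. coord b u i / \<pi> powi a i"
  have "u = (\<Sum>i\<in>UNIV. ?c i *s ((\<pi> powi a i) *s b i))"
    by (simp add: b)
  moreover have "range ?c \<subseteq> valuation_ring val"
    using * by (auto simp: valuation_ring_def) (metis diff_ge_0_iff_ge power_int_not_zero
        uniformizer(1) val_divide val_powi)
  ultimately show "u \<in> apartment_lattice b a"
    unfolding apartment_lattice_def integer_span_def
    by (intro CollectI exI[of _ ?c] conjI)
qed

lemma lattice_iff: "lattice L \<longleftrightarrow> (\<exists>b. indexed_basis b \<and> L = apartment_lattice b (\<lambda>_. 0))"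
  by (simp add: lattice_def apartment_lattice_def)

lemma lattice_apartment_lattice [intro]:
  "indexed_basis b \<Longrightarrow> lattice (apartment_lattice b a)"
  unfolding lattice_def apartment_lattice_def
  by (intro exI[of _ "\<lambda>i. (\<pi> powi a i) *s b i"] conjI indexed_basis_rescale) auto

lemma scale_apartment_lattice:
  assumes b: "indexed_basis b" and c: "c \<noteq> 0"
  shows "scale c (apartment_lattice b a) = apartment_lattice b (\<lambda>i. a i + val c)"
proof -
  have "u \<in> scale c (apartment_lattice b a) \<longleftrightarrow> u \<in> apartment_lattice b (\<lambda>i. a i + val c)" for u
  proof -
    have "coord b (inverse c *s u) i = 0 \<or> a i \<le> val (coord b (inverse c *s u) i) \<longleftrightarrow>
        coord b u i = 0 \<or> a i + val c \<le> val (coord b u i)" for i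
      using c by (cases "coord b u i = 0") (auto simp: coord_scale[OF b] val_divide val_mult
          val_inverse simp del: inverse_eq_divide)
    then show ?thesis
      by (simp only: mem_scale_iff[OF c] mem_apartment_lattice[OF b])
  qed
  then show ?thesis by blast
qed

lemma lattice_scale: "lattice L \<Longrightarrow> c \<noteq> 0 \<Longrightarrow> lattice (scale c L)"
  by (auto simp: lattice_iff[of L] scale_apartment_lattice)

text \<open>Multiplication by a unit preserves a lattice, so that only the valuation of the scalar
  matters.\<close>

lemma scale_eq_scale_val: "lattice L \<Longrightarrow> c \<noteq> 0 \<Longrightarrow> scale c L = scale (\<pi> powi val c) L"
  by (auto simp: lattice_iff simp del: add_0 simp: scale_apartment_lattice)

lemma apartment_lattice_subset_iff:
  assumes b: "indexed_basis b"
  shows "apartment_lattice b a \<subseteq> apartment_lattice b a' \<longleftrightarrow> (\<forall>i. a' i \<le> a i)"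
proof
  assume sub: "apartment_lattice b a \<subseteq> apartment_lattice b a'"
  show "\<forall>i. a' i \<le> a i"
  proof
    fix i
    have "(\<pi> powi a i) *s b i \<in> apartment_lattice b a"
      by (simp add: mem_apartment_lattice[OF b] coord_scale[OF b] coord_basis[OF b])
    with sub have "(\<pi> powi a i) *s b i \<in> apartment_lattice b a'" by auto
    then have "coord b ((\<pi> powi a i) *s b i) i = 0 \<or> a' i \<le> val (coord b ((\<pi> powi a i) *s b i) i)"
      unfolding mem_apartment_lattice[OF b] by (rule spec)
    then show "a' i \<le> a i"
      by (simp add: coord_scale[OF b] coord_basis[OF b])
  qed
qed (unfold mem_apartment_lattice[OF b] subset_iff, meson order_trans)

lemma apartment_lattice_eq_iff:
  "indexed_basis b \<Longrightarrow> apartment_lattice b a = apartment_lattice b a' \<longleftrightarrow> a = a'"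
  by (simp add: set_eq_subset apartment_lattice_subset_iff fun_eq_iff order_eq_iff all_conj_distrib
      conj_commute)

lemma apartment_lattice_psubset_iff:
  "indexed_basis b \<Longrightarrow> apartment_lattice b a \<subset> apartment_lattice b a' \<longleftrightarrow> a' < a"
  by (auto simp: psubset_eq apartment_lattice_eq_iff apartment_lattice_subset_iff
      less_le le_fun_def)

lemma apartment_lattice_inter:
  assumes b: "indexed_basis b"
  shows "apartment_lattice b a \<inter> apartment_lattice b a' = apartment_lattice b (\<lambda>i. max (a i) (a' i))"
  by (auto simp: mem_apartment_lattice[OF b])

lemma apartment_lattice_plus:
  assumes b: "indexed_basis b"
  shows "{x + y | x y. x \<in> apartment_lattice b a \<and> y \<in> apartment_lattice b a'} =
    apartment_lattice b (\<lambda>i. min (a i) (a' i))"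
proof (intro subset_antisym subsetI)
  fix u assume "u \<in> {x + y | x y. x \<in> apartment_lattice b a \<and> y \<in> apartment_lattice b a'}"
  then obtain x y where u: "u = x + y" and x: "x \<in> apartment_lattice b a"
    and y: "y \<in> apartment_lattice b a'" by auto
  show "u \<in> apartment_lattice b (\<lambda>i. min (a i) (a' i))"
    unfolding mem_apartment_lattice[OF b]
  proof (intro allI)
    fix i
    show "coord b u i = 0 \<or> min (a i) (a' i) \<le> val (coord b u i)"
      using x y val_add[of "coord b x i" "coord b y i"]
      unfolding mem_apartment_lattice[OF b] u coord_add[OF b]
      by (smt (verit) add_0 add_0_right min_def)
  qed
next
  fix u assume u: "u \<in> apartment_lattice b (\<lambda>i. min (a i) (a' i))"
  \<comment> \<open>Coordinates admissible for \<open>a\<close> go to the first summand; any other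
    one is bounded by the minimum, hence by \<open>a'\<close>.\<close>
  let ?P = "\<lambda>i. coord b u i = 0 \<or> a i \<le> val (coord b u i)"
  let ?x = "\<Sum>i\<in>UNIV. (if ?P i then coord b u i else 0) *s b i"
  let ?y = "\<Sum>i\<in>UNIV. (if ?P i then 0 else coord b u i) *s b i"
  have "?x \<in> apartment_lattice b a"
    by (auto simp: mem_apartment_lattice[OF b] coord_of_sum[OF b])
  moreover have "?y \<in> apartment_lattice b a'"
    using u by (auto simp: mem_apartment_lattice[OF b] coord_of_sum[OF b] min_def split: if_splits)
  moreover have "u = ?x + ?y"
    by (subst coord_eq_iff[OF b]) (simp add: coord_add[OF b] coord_of_sum[OF b])
  ultimately show "u \<in> {x + y | x y. x \<in> apartment_lattice b a \<and> y \<in> apartment_lattice b a'}"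
    by blast
qed

abbreviation apartment_vertex :: "('n::finite \<Rightarrow> 'a ^ 'n) \<Rightarrow> ('n \<Rightarrow> int) \<Rightarrow> ('a, 'n) vertex" where
  "apartment_vertex b a \<equiv> homothety_class (apartment_lattice b a)"

lemma apartment_vertex_eq_iff:
  assumes b: "indexed_basis b"
  shows "apartment_vertex b a = apartment_vertex b a' \<longleftrightarrow> (\<exists>c. \<forall>i. a' i = a i + c)"
proof -
  have "(\<exists>c. c \<noteq> 0 \<and> apartment_lattice b a' = scale c (apartment_lattice b a)) \<longleftrightarrow>
      (\<exists>c. c \<noteq> 0 \<and> a' = (\<lambda>i. a i + val c))"
    using b by (auto simp: scale_apartment_lattice apartment_lattice_eq_iff)
  also have "\<dots> \<longleftrightarrow> (\<exists>c. \<forall>i. a' i = a i + c)"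
    by (auto simp: fun_eq_iff) (metis uniformizer(1) power_int_not_zero val_powi)
  finally show ?thesis by (simp add: homothety_class_eq_iff)
qed

lemma mem_apartment_vertices: "v \<in> apartment_vertices b \<longleftrightarrow> (\<exists>a. v = apartment_vertex b a)"
  by (auto simp: apartment_vertices_def)

lemma homothety_class_eq_apartment_vertexD:
  assumes b: "indexed_basis b" and eq: "homothety_class L = apartment_vertex b a"
  shows "\<exists>c. L = apartment_lattice b (\<lambda>i. a i + c)"
proof -
  obtain c where "c \<noteq> 0" "L = scale c (apartment_lattice b a)"
    using eq homothety_class_eq_iff by metis
  then show ?thesis using scale_apartment_lattice[OF b] by auto
qed

lemma lattice_zero: "lattice L \<Longrightarrow> 0 \<in> L"
  by (auto simp: lattice_iff mem_apartment_lattice)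

lemma lattice_add: "lattice L \<Longrightarrow> u \<in> L \<Longrightarrow> w \<in> L \<Longrightarrow> u + w \<in> L"
  by (auto simp: lattice_iff mem_apartment_lattice coord_add)
    (smt (verit) add_0 add_0_right val_add)

lemma lattice_sum: "lattice L \<Longrightarrow> (\<And>i. i \<in> I \<Longrightarrow> f i \<in> L) \<Longrightarrow> (\<Sum>i\<in>I. f i) \<in> L"
  by (induction I rule: infinite_finite_induct) (auto simp: lattice_zero lattice_add)

lemma lattice_mult: "lattice L \<Longrightarrow> u \<in> L \<Longrightarrow> 0 \<le> val c \<Longrightarrow> c *s u \<in> L"
  by (auto simp: lattice_iff mem_apartment_lattice coord_scale val_mult)
    (metis add_nonneg_nonneg val_mult)

lemma lattice_scale_subset: "lattice L \<Longrightarrow> 0 \<le> m \<Longrightarrow> scale (\<pi> powi m) L \<subseteq> L"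
  using lattice_mult[of L _ "\<pi> powi m"] by (auto simp: scale_def)

lemma scale_powi_mono:
  assumes L: "lattice L" and m: "m' \<le> m"
  shows "scale (\<pi> powi m) L \<subseteq> scale (\<pi> powi m') L"
proof -
  have "scale (\<pi> powi m) L = scale (\<pi> powi m') (scale (\<pi> powi (m - m')) L)"
    using uniformizer by (simp add: scale_scale power_int_add[symmetric])
  with L m show ?thesis by (simp add: scale_subset_iff lattice_scale_subset)
qed

section \<open>Additive norms split by a basis (Goldman and Iwahori), and the norms of
  lattices\<close>

definition split_norm :: "('n::finite \<Rightarrow> 'a ^ 'n) \<Rightarrow> ('n \<Rightarrow> real) \<Rightarrow> 'a ^ 'n \<Rightarrow> real" where
  "split_norm b a u = Min ((\<lambda>i. real_of_int (val (coord b u i)) + a i) ` {i. coord b u i \<noteq> 0})"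

text \<open>
  The largest \<open>m\<close> with \<open>u \<in> \<pi>\<^sup>m L\<close>; meaningful only for \<open>u \<noteq> 0\<close>.
\<close>

definition lattice_norm :: "('a, 'n::finite) lattice \<Rightarrow> 'a ^ 'n \<Rightarrow> int" where
  "lattice_norm L u = (THE m. \<forall>m'. m' \<le> m \<longleftrightarrow> u \<in> scale (\<pi> powi m') L)"

lemma le_split_norm_iff:
  assumes "indexed_basis b" "u \<noteq> 0"
  shows "r \<le> split_norm b a u \<longleftrightarrow> (\<forall>i. coord b u i \<noteq> 0 \<longrightarrow> r \<le> real_of_int (val (coord b u i)) + a i)"
  using coord_nonzero[OF assms] unfolding split_norm_def by (subst Min_ge_iff) auto

lemma split_norm_le:
  "indexed_basis b \<Longrightarrow> coord b u i \<noteq> 0 \<Longrightarrow> split_norm b a u \<le> real_of_int (val (coord b u i)) + a i"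
  using le_split_norm_iff[of b u "split_norm b a u" a] coord_zero[of b i] by fastforce

lemma split_norm_attained:
  assumes "indexed_basis b" "u \<noteq> 0"
  obtains i where "coord b u i \<noteq> 0" "split_norm b a u = real_of_int (val (coord b u i)) + a i"
proof -
  let ?S = "(\<lambda>i. real_of_int (val (coord b u i)) + a i) ` {i. coord b u i \<noteq> 0}"
  have "Min ?S \<in> ?S" using coord_nonzero[OF assms] by (intro Min_in) auto
  then show ?thesis using that unfolding split_norm_def by auto
qed

lemma split_norm_basis: "indexed_basis b \<Longrightarrow> split_norm b a (b i) = a i"
  by (rule split_norm_attained[of b "b i" a])
    (auto simp: coord_basis indexed_basis_nonzero split: if_splits)

lemma split_norm_scale:
  assumes b: "indexed_basis b" and u: "u \<noteq> 0" and c: "c \<noteq> 0"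
  shows "split_norm b a (c *s u) = real_of_int (val c) + split_norm b a u"
proof -
  have "r \<le> split_norm b a (c *s u) \<longleftrightarrow> r - val c \<le> split_norm b a u" for r
  proof -
    have "r \<le> split_norm b a (c *s u) \<longleftrightarrow>
        (\<forall>i. coord b u i \<noteq> 0 \<longrightarrow> r - val c \<le> real_of_int (val (coord b u i)) + a i)"
      using u c by (subst le_split_norm_iff[OF b])
        (auto simp: coord_scale[OF b] val_mult algebra_simps)
    then show ?thesis unfolding le_split_norm_iff[OF b u] .
  qed
  from this[of "split_norm b a (c *s u)"] this[of "real_of_int (val c) + split_norm b a u"] show ?thesis by auto
qed

lemma split_norm_add:
  assumes b: "indexed_basis b" and "u \<noteq> 0" "w \<noteq> 0" "u + w \<noteq> 0"
  shows "min (split_norm b a u) (split_norm b a w) \<le> split_norm b a (u + w)"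
  proof (subst le_split_norm_iff[OF b \<open>u + w \<noteq> 0\<close>], intro allI impI)
  fix i assume nz: "coord b (u + w) i \<noteq> 0"
  have u: "coord b u i \<noteq> 0 \<Longrightarrow> split_norm b a u \<le> real_of_int (val (coord b u i)) + a i"
    and w: "coord b w i \<noteq> 0 \<Longrightarrow> split_norm b a w \<le> real_of_int (val (coord b w i)) + a i"
    using split_norm_le[OF b] by auto
  consider "coord b u i = 0" | "coord b w i = 0" | "coord b u i \<noteq> 0" "coord b w i \<noteq> 0" by auto
  then show "min (split_norm b a u) (split_norm b a w) \<le> real_of_int (val (coord b (u + w) i)) + a i"
  proof cases
    case 3
    with nz have "min (val (coord b u i)) (val (coord b w i)) \<le> val (coord b (u + w) i)"
      unfolding coord_add[OF b] by (intro val_add) auto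
    with u w 3 show ?thesis by linarith
  qed (use u w nz in \<open>auto simp: coord_add[OF b]\<close>)
qed

lemma split_norm_shift:
  assumes b: "indexed_basis b" and u: "u \<noteq> 0"
  shows "split_norm b (\<lambda>i. a i + c) u = split_norm b a u + c"
proof -
  have "r \<le> split_norm b (\<lambda>i. a i + c) u \<longleftrightarrow> r - c \<le> split_norm b a u" for r
  proof -
    have "r \<le> split_norm b (\<lambda>i. a i + c) u \<longleftrightarrow>
        (\<forall>i. coord b u i \<noteq> 0 \<longrightarrow> r - c \<le> real_of_int (val (coord b u i)) + a i)"
      using u by (subst le_split_norm_iff[OF b]) (auto simp: algebra_simps)
    then show ?thesis unfolding le_split_norm_iff[OF b u] .
  qed
  from this[of "split_norm b (\<lambda>i. a i + c) u"] this[of "split_norm b a u + c"] show ?thesis by auto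
qed

text \<open>This justifies the definite description: in a basis of \<open>L\<close> the number
  sought is the least valuation of the nonzero coordinates.\<close>

lemma le_lattice_norm_iff:
  assumes L: "lattice L" and u: "u \<noteq> 0"
  shows "m \<le> lattice_norm L u \<longleftrightarrow> u \<in> scale (\<pi> powi m) L"
proof -
  obtain b where b: "indexed_basis b" and Lb: "L = apartment_lattice b (\<lambda>_. 0)"
    using L lattice_iff by auto
  have eq: "u \<in> scale (\<pi> powi m) L \<longleftrightarrow> (\<forall>i. coord b u i \<noteq> 0 \<longrightarrow> m \<le> val (coord b u i))" for m
    by (auto simp: Lb scale_apartment_lattice[OF b] mem_apartment_lattice[OF b])
  let ?S = "(\<lambda>i. val (coord b u i)) ` {i. coord b u i \<noteq> 0}"
  have "m \<le> Min ?S \<longleftrightarrow> u \<in> scale (\<pi> powi m) L" for m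
    using coord_nonzero[OF b u] unfolding eq by (subst Min_ge_iff) auto
  then have ex: "\<forall>m'. m' \<le> Min ?S \<longleftrightarrow> u \<in> scale (\<pi> powi m') L" by blast
  have "lattice_norm L u = Min ?S"
    unfolding lattice_norm_def
  proof (rule the_equality)
    show "\<forall>m'. m' \<le> Min ?S \<longleftrightarrow> u \<in> scale (\<pi> powi m') L" by (rule ex)
  next
    fix m assume "\<forall>m'. m' \<le> m \<longleftrightarrow> u \<in> scale (\<pi> powi m') L"
    with ex have "\<forall>m'. m' \<le> m \<longleftrightarrow> m' \<le> Min ?S" by blast
    then show "m = Min ?S" by (meson order_antisym order_refl)
  qed
  with ex show ?thesis by simp
qed

lemma mem_lattice_iff: "lattice L \<Longrightarrow> u \<noteq> 0 \<Longrightarrow> u \<in> L \<longleftrightarrow> 0 \<le> lattice_norm L u"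
  by (simp add: le_lattice_norm_iff)

text \<open>The sign changes: a large exponent means a small lattice and hence a small norm. For
  this reason positions of points later enter their norms with a minus sign.\<close>

lemma lattice_norm_apartment_lattice:
  assumes b: "indexed_basis b" and u: "u \<noteq> 0"
  shows "real_of_int (lattice_norm (apartment_lattice b a) u) = split_norm b (\<lambda>i. - real_of_int (a i)) u"
proof -
  have *: "m \<le> lattice_norm (apartment_lattice b a) u \<longleftrightarrow>
      real_of_int m \<le> split_norm b (\<lambda>i. - real_of_int (a i)) u" for m
  proof -
    have "m \<le> lattice_norm (apartment_lattice b a) u \<longleftrightarrow>
        (\<forall>i. coord b u i = 0 \<or> a i + m \<le> val (coord b u i))"
      by (simp add: le_lattice_norm_iff[OF lattice_apartment_lattice[OF b] u]
          scale_apartment_lattice[OF b] mem_apartment_lattice[OF b])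
    also have "\<dots> \<longleftrightarrow>
        (\<forall>i. coord b u i \<noteq> 0 \<longrightarrow> real_of_int m \<le> real_of_int (val (coord b u i)) + - real_of_int (a i))"
      by (intro arg_cong[of _ _ All] ext) (smt (verit) of_int_add of_int_le_iff)
    finally show ?thesis unfolding le_split_norm_iff[OF b u] .
  qed
  obtain i where i: "split_norm b (\<lambda>i. - real_of_int (a i)) u = real_of_int (val (coord b u i)) + - real_of_int (a i)"
    by (rule split_norm_attained[OF b u])
  with *[of "val (coord b u i) - a i"] *[of "lattice_norm (apartment_lattice b a) u"]
  have "val (coord b u i) - a i \<le> lattice_norm (apartment_lattice b a) u"
    and "lattice_norm (apartment_lattice b a) u \<le> val (coord b u i) - a i" by simp_all
  with i show ?thesis by simp
qed

lemma lattice_norm_mult: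
  assumes L: "lattice L" and "u \<noteq> 0" "c \<noteq> 0"
  shows "lattice_norm L (c *s u) = val c + lattice_norm L u"
proof -
  obtain b where b: "indexed_basis b" and Lb: "L = apartment_lattice b (\<lambda>_. 0)"
    using L lattice_iff by auto
  have "real_of_int (lattice_norm L (c *s u)) = real_of_int (val c + lattice_norm L u)"
    using assms by (simp add: Lb lattice_norm_apartment_lattice[OF b] split_norm_scale[OF b] del: minus_zero)
  then show ?thesis by simp
qed

lemma lattice_norm_add:
  assumes L: "lattice L" and "u \<noteq> 0" "w \<noteq> 0" "u + w \<noteq> 0"
  shows "min (lattice_norm L u) (lattice_norm L w) \<le> lattice_norm L (u + w)"
proof -
  let ?m = "min (lattice_norm L u) (lattice_norm L w)"
  have "u \<in> scale (\<pi> powi ?m) L" "w \<in> scale (\<pi> powi ?m) L"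
    using assms by (auto simp flip: le_lattice_norm_iff)
  then have "u + w \<in> scale (\<pi> powi ?m) L"
    using L by (intro lattice_add lattice_scale) auto
  with assms show ?thesis by (simp add: le_lattice_norm_iff)
qed

lemma lattice_norm_scale:
  assumes L: "lattice L" and u: "u \<noteq> 0" and c: "c \<noteq> 0"
  shows "lattice_norm (scale c L) u = lattice_norm L u - val c"
proof -
  have "m \<le> lattice_norm (scale c L) u \<longleftrightarrow> m + val c \<le> lattice_norm L u" for m
  proof -
    have "m \<le> lattice_norm (scale c L) u \<longleftrightarrow> u \<in> scale (\<pi> powi m) (scale c L)"
      by (rule le_lattice_norm_iff[OF lattice_scale[OF L c] u])
    also have "scale (\<pi> powi m) (scale c L) = scale (\<pi> powi (m + val c)) L"
      unfolding scale_eq_scale_val[OF L c] scale_scale by (subst power_int_add) auto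
    finally show ?thesis unfolding le_lattice_norm_iff[OF L u] .
  qed
  from this[of "lattice_norm (scale c L) u"] this[of "lattice_norm L u - val c"]
  have "lattice_norm (scale c L) u + val c \<le> lattice_norm L u"
    and "lattice_norm L u - val c \<le> lattice_norm (scale c L) u" by simp_all
  then show ?thesis by linarith
qed

end

section \<open>Two facets lie in a common apartment\<close>

context nonarch_local_field
begin

text \<open>A facet is to be encoded by one integer valued norm. A chain of \<open>p\<close>
  lattices takes \<open>p\<close> steps to pass from a lattice to its multiple by \<pi>, so scalars
  act with the factor \<open>p\<close>.\<close>

definition periodic_norm :: "int \<Rightarrow> ('a ^ 'n::finite \<Rightarrow> int) \<Rightarrow> bool" where
  "periodic_norm p \<alpha> \<longleftrightarrow> 0 < p \<and>
     (\<forall>u c. u \<noteq> 0 \<longrightarrow> c \<noteq> 0 \<longrightarrow> \<alpha> (c *s u) = p * val c + \<alpha> u) \<and>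
     (\<forall>u w. u \<noteq> 0 \<longrightarrow> w \<noteq> 0 \<longrightarrow> u + w \<noteq> 0 \<longrightarrow> min (\<alpha> u) (\<alpha> w) \<le> \<alpha> (u + w))"

text \<open>For a periodic norm the right-hand side is the value of \<alpha> at the component
  \<open>coord b u i *s b i\<close>. If the bound holds for all \<open>i\<close>, the basis is
  orthogonal: \<alpha> of a vector is the minimum over its components.\<close>

definition splits_at :: "int \<Rightarrow> ('a ^ 'n::finite \<Rightarrow> int) \<Rightarrow> ('n \<Rightarrow> 'a ^ 'n) \<Rightarrow> 'n \<Rightarrow> bool" where
  "splits_at p \<alpha> b i \<longleftrightarrow> (\<forall>u. coord b u i \<noteq> 0 \<longrightarrow> \<alpha> u \<le> p * val (coord b u i) + \<alpha> (b i))"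

lemma periodic_norm_mult:
  "periodic_norm p \<alpha> \<Longrightarrow> u \<noteq> 0 \<Longrightarrow> c \<noteq> 0 \<Longrightarrow> \<alpha> (c *s u) = p * val c + \<alpha> u"
  by (simp add: periodic_norm_def)

lemma periodic_norm_sum:
  assumes \<alpha>: "periodic_norm p \<alpha>" and "finite I" "(\<Sum>i\<in>I. f i) \<noteq> 0"
  shows "\<exists>i\<in>I. f i \<noteq> 0 \<and> \<alpha> (f i) \<le> \<alpha> (\<Sum>i\<in>I. f i)"
  using assms(2,3)
proof (induction I rule: finite_induct)
  case (insert j I)
  show ?case
  proof (cases "(\<Sum>i\<in>I. f i) = 0 \<or> f j = 0")
    case True
    with insert show ?thesis by auto
  next
    case False
    have "f j + (\<Sum>i\<in>I. f i) \<noteq> 0" using insert by simp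
    with False have "min (\<alpha> (f j)) (\<alpha> (\<Sum>i\<in>I. f i)) \<le> \<alpha> (f j + (\<Sum>i\<in>I. f i))"
      using \<alpha> by (simp add: periodic_norm_def)
    with False insert show ?thesis by (fastforce simp: min_def split: if_splits)
  qed
qed simp

lemma periodic_norm_coord:
  assumes \<alpha>: "periodic_norm p \<alpha>" and b: "indexed_basis b" and u: "u \<noteq> 0"
  obtains i where "coord b u i \<noteq> 0" "p * val (coord b u i) + \<alpha> (b i) \<le> \<alpha> u"
proof -
  have "(\<Sum>i\<in>UNIV. coord b u i *s b i) \<noteq> 0" using b u by simp
  from periodic_norm_sum[OF \<alpha> _ this] obtain i
    where i: "coord b u i *s b i \<noteq> 0" "\<alpha> (coord b u i *s b i) \<le> \<alpha> u"
    using b by auto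
  then have "coord b u i \<noteq> 0" by auto
  with i that periodic_norm_mult[OF \<alpha> indexed_basis_nonzero[OF b, of i]] show ?thesis by auto
qed

text \<open>
  One step of the simultaneous orthogonalisation: on the span of the remaining basis vectors
  choose \<open>x\<close> maximising the distortion \<open>p \<beta> - q \<alpha>\<close>. Every complement of \<open>x\<close> that is
  orthogonal for \<open>\<alpha>\<close> is then orthogonal for \<open>\<beta>\<close> as well.
\<close>

lemma common_basis_step:
  assumes \<alpha>: "periodic_norm p \<alpha>" and \<beta>: "periodic_norm q \<beta>"
    and e: "indexed_basis e" and sp\<alpha>: "\<And>i. splits_at p \<alpha> e i"
    and sp\<beta>: "\<And>i. i \<in> J \<Longrightarrow> splits_at q \<beta> e i" and J: "J \<noteq> UNIV"
    and K: "\<And>u. u \<noteq> 0 \<Longrightarrow> p * \<beta> u - q * \<alpha> u \<le> K"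
  shows "\<exists>f j. j \<notin> J \<and> indexed_basis f \<and> (\<forall>i. splits_at p \<alpha> f i) \<and>
    (\<forall>i\<in>insert j J. splits_at q \<beta> f i)"
proof -
  from \<alpha> \<beta> have p: "0 < p" and q: "0 < q" by (auto simp: periodic_norm_def)
  let ?H = "{u. u \<noteq> 0 \<and> (\<forall>i\<in>J. coord e u i = 0)}"
  let ?d = "\<lambda>u. p * \<beta> u - q * \<alpha> u"
  from J obtain j0 where "j0 \<notin> J" by auto
  then have "e j0 \<in> ?H" using e by (auto simp: coord_basis indexed_basis_nonzero)
  \<comment> \<open>The distortion is an integer bounded above by \<open>K\<close>, so minimising
    \<open>nat (K - ?d u)\<close> finds a maximum of it.\<close>
  then obtain x where x: "x \<in> ?H" and "\<forall>u. u \<in> ?H \<longrightarrow> nat (K - ?d x) \<le> nat (K - ?d u)"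
    using ex_has_least_nat[of "\<lambda>u. u \<in> ?H" "e j0" "\<lambda>u. nat (K - ?d u)"] by blast
  then have max: "?d u \<le> ?d x" if "u \<in> ?H" for u
    using K[of u] K[of x] that by (auto simp: nat_le_eq_zle)
  from x have x0: "x \<noteq> 0" by auto
  \<comment> \<open>The vector \<open>e j\<close> to be exchanged is one where the \<alpha>-minimum
    over the components of \<open>x\<close> is attained; this keeps the new basis orthogonal for
    \<alpha>. As \<open>x\<close> has no components in \<open>J\<close>, the vectors already treated
    stay.\<close>
  obtain j where xj: "coord e x j \<noteq> 0" and j: "p * val (coord e x j) + \<alpha> (e j) \<le> \<alpha> x"
    using periodic_norm_coord[OF \<alpha> e x0] by blast
  then have jJ: "j \<notin> J" using x by auto
  have \<alpha>x: "\<alpha> x = p * val (coord e x j) + \<alpha> (e j)"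
    using j sp\<alpha>[of j] xj by (auto simp: splits_at_def intro: order_antisym)
  define f where "f = e(j := x)"
  have fj: "f j = x" and fi: "i \<noteq> j \<Longrightarrow> f i = e i" for i by (auto simp: f_def)
  have f: "indexed_basis f" unfolding f_def by (rule exchange_indexed_basis[OF e xj])
  have cf: "coord f u i = (if i = j then coord e u j / coord e x j
     else coord e u i - coord e u j * coord e x i / coord e x j)" for u i
    unfolding f_def by (rule coord_exchange[OF e xj])
  have spj: "splits_at p \<alpha> f j"
    unfolding splits_at_def
  proof (intro allI impI)
    fix u assume "coord f u j \<noteq> 0"
    then have uj: "coord e u j \<noteq> 0" by (simp add: cf)
    with sp\<alpha>[of j] have "\<alpha> u \<le> p * val (coord e u j) + \<alpha> (e j)" by (simp add: splits_at_def)
    then show "\<alpha> u \<le> p * val (coord f u j) + \<alpha> (f j)"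
      using uj xj by (simp add: cf fj val_divide \<alpha>x algebra_simps)
  qed
  have sp: "splits_at p \<alpha> f i" if ij: "i \<noteq> j" for i
    unfolding splits_at_def
  proof (intro allI impI)
    fix u assume nz: "coord f u i \<noteq> 0"
    let ?r = "coord e u j * coord e x i / coord e x j"
    have c: "coord f u i = coord e u i - ?r" using ij by (simp add: cf)
    have 1: "\<alpha> u \<le> p * val (coord e u i) + \<alpha> (e i)" if "coord e u i \<noteq> 0"
      using sp\<alpha>[of i] that by (simp add: splits_at_def)
    have 2: "\<alpha> u \<le> p * val ?r + \<alpha> (e i)" if "?r \<noteq> 0"
    proof -
      from that have n: "coord e u j \<noteq> 0" "coord e x i \<noteq> 0" by auto
      have "\<alpha> u \<le> p * val (coord e u j) + \<alpha> (e j)"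
        using sp\<alpha>[of j] n by (simp add: splits_at_def)
      moreover have "\<alpha> x \<le> p * val (coord e x i) + \<alpha> (e i)"
        using sp\<alpha>[of i] n by (simp add: splits_at_def)
      ultimately show ?thesis using n xj by (simp add: val_divide val_mult \<alpha>x algebra_simps)
    qed
    have "\<alpha> u \<le> p * val (coord f u i) + \<alpha> (e i)"
    proof (cases "coord e u i = 0 \<or> ?r = 0")
      case True
      with 1 2 nz show ?thesis unfolding c by (metis diff_0 diff_zero neg_equal_0_iff_equal val_minus)
    next
      case False
      then have "min (val (coord e u i)) (val ?r) \<le> val (coord f u i)"
        using nz unfolding c by (intro val_diff_ge) auto
      then have "p * val (coord e u i) \<le> p * val (coord f u i) \<or> p * val ?r \<le> p * val (coord f u i)"
        using p by (auto simp: min_le_iff_disj)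
      with 1 2 False show ?thesis by linarith
    qed
    then show "\<alpha> u \<le> p * val (coord f u i) + \<alpha> (f i)" using ij by (simp add: fi)
  qed
  have cJ: "coord f u i = coord e u i" if "i \<in> J" for u i
    using that x jJ by (auto simp: cf)
  have sp\<beta>J: "splits_at q \<beta> f i" if "i \<in> J" for i
  proof -
    from that jJ have "i \<noteq> j" by auto
    with sp\<beta>[OF that] that show ?thesis by (simp add: splits_at_def cJ fi)
  qed
  have sp\<beta>j: "splits_at q \<beta> f j"
    unfolding splits_at_def
  proof (intro allI impI)
    fix u assume nz: "coord f u j \<noteq> 0"
    then have u0: "u \<noteq> 0" using f by auto
    define uJ where "uJ = (\<Sum>i\<in>J. coord f u i *s f i)"
    define w where "w = u - uJ"
    have "uJ = (\<Sum>i\<in>UNIV. (if i \<in> J then coord f u i else 0) *s f i)"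
      unfolding uJ_def by (rule sum.mono_neutral_cong_left) auto
    then have cuJ: "coord f uJ i = (if i \<in> J then coord f u i else 0)" for i
      using coord_of_sum[OF f] by simp
    have cw: "coord f w i = (if i \<in> J then 0 else coord f u i)" for i
      by (simp add: w_def coord_diff[OF f] cuJ)
    from cw[of j] nz jJ have w0: "w \<noteq> 0" using f by auto
    have "coord e w i = 0" if "i \<in> J" for i using cw[of i] cJ[OF that] that by simp
    with w0 have wH: "w \<in> ?H" by auto
    \<comment> \<open>The components in \<open>J\<close> are already orthogonal for \<beta>, so
      neither they nor their sum \<open>uJ\<close> have a smaller value than \<open>u\<close>;
      removing \<open>uJ\<close> costs nothing.\<close>
    have "\<beta> u \<le> \<beta> w"
    proof (cases "uJ = 0")
      case False
      then obtain i where i: "i \<in> J" "coord f u i *s f i \<noteq> 0"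
        and le: "\<beta> (coord f u i *s f i) \<le> \<beta> uJ"
        using periodic_norm_sum[OF \<beta>, of J "\<lambda>i. coord f u i *s f i"] unfolding uJ_def by auto
      from i have ci: "coord f u i \<noteq> 0" by auto
      have "\<beta> u \<le> \<beta> (coord f u i *s f i)"
        using sp\<beta>J[OF i(1)] ci periodic_norm_mult[OF \<beta> indexed_basis_nonzero[OF f, of i] ci]
        by (simp add: splits_at_def)
      with le have le': "\<beta> u \<le> \<beta> uJ" by simp
      have "\<beta> ((-1) *s uJ) = \<beta> uJ"
        using periodic_norm_mult[OF \<beta> False, of "-1"] by simp
      then have "min (\<beta> u) (\<beta> uJ) \<le> \<beta> w"
        using \<beta> u0 False w0 unfolding periodic_norm_def w_def
        by (metis add.inverse_neutral neg_equal_iff_equal diff_conv_add_uminus vec.scale_minus_left vec.scale_one)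
      with le' show ?thesis by simp
    qed (simp add: w_def)
    \<comment> \<open>Maximality of the distortion at \<open>x\<close> turns the \<alpha>-bound for
      \<open>w\<close> along \<open>x\<close> into the \<beta>-bound.\<close>
    moreover have "p * \<beta> w \<le> q * \<alpha> w + (p * \<beta> x - q * \<alpha> x)" using max[OF wH] by simp
    moreover have "\<alpha> w \<le> p * val (coord f u j) + \<alpha> x"
      using spj[unfolded splits_at_def, rule_format, of w] cw[of j] jJ nz by (simp add: fj)
    then have "q * \<alpha> w \<le> q * (p * val (coord f u j) + \<alpha> x)" using q by simp
    moreover from calculation have "p * \<beta> u \<le> p * \<beta> w" using p by simp
    ultimately have "p * \<beta> u \<le> p * (q * val (coord f u j) + \<beta> x)"
      by (simp add: algebra_simps)
    then have "\<beta> u \<le> q * val (coord f u j) + \<beta> x" using p by simp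
    then show "\<beta> u \<le> q * val (coord f u j) + \<beta> (f j)" by (simp add: fj)
  qed
  show ?thesis
    using jJ f sp spj sp\<beta>J sp\<beta>j by (intro exI[of _ f] exI[of _ j]) (metis insert_iff)
qed

text \<open>Induction on the number of basis vectors that split \<beta>. Only the cardinality of
  \<open>J\<close> is kept, because each step itself chooses the index to be added.\<close>

lemma common_basis:
  fixes e :: "'n::finite \<Rightarrow> 'a ^ 'n"
  assumes \<alpha>: "periodic_norm p \<alpha>" and \<beta>: "periodic_norm q \<beta>"
    and e: "indexed_basis e" and sp: "\<And>i. splits_at p \<alpha> e i"
    and K: "\<And>u. u \<noteq> 0 \<Longrightarrow> p * \<beta> u - q * \<alpha> u \<le> K"
  shows "\<exists>f. indexed_basis f \<and> (\<forall>i. splits_at p \<alpha> f i) \<and> (\<forall>i. splits_at q \<beta> f i)"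
proof -
  have "\<exists>f J. card J = n \<and> indexed_basis f \<and> (\<forall>i. splits_at p \<alpha> f i) \<and> (\<forall>i\<in>J. splits_at q \<beta> f i)"
    if "n \<le> CARD('n)" for n
    using that
  proof (induction n)
    case 0
    then show ?case using e sp by (intro exI[of _ e] exI[of _ "{}"]) auto
  next
    case (Suc n)
    then obtain f J where J: "card J = n" and f: "indexed_basis f"
      "\<And>i. splits_at p \<alpha> f i" "\<And>i. i \<in> J \<Longrightarrow> splits_at q \<beta> f i" by auto
    have "J \<noteq> UNIV" using J Suc.prems by auto
    from common_basis_step[OF \<alpha> \<beta> f this K] obtain g j where
      "j \<notin> J" "indexed_basis g" "\<forall>i. splits_at p \<alpha> g i" "\<forall>i\<in>insert j J. splits_at q \<beta> g i"
      by blast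
    then show ?case using J by (intro exI[of _ g] exI[of _ "insert j J"]) auto
  qed
  from this[of "CARD('n)"] obtain f J where "card J = CARD('n)" "indexed_basis f"
    "\<forall>i. splits_at p \<alpha> f i" "\<forall>i\<in>J. splits_at q \<beta> f i" by auto
  moreover from this have "J = UNIV" by (simp add: card_eq_UNIV_imp_eq_UNIV)
  ultimately show ?thesis by auto
qed

text \<open>Expand the \<open>i\<close>-th \<open>b\<close>-coordinate through the basis
  \<open>e\<close>: the finitely many entries of the change of basis give the constant. Such a bound
  is what makes maxima over infinite sets of vectors exist, both in \<open>common_basis\<close> and
  in \<open>slice_max\<close>.\<close>

lemma split_norm_le_coord:
  fixes e b :: "'n::finite \<Rightarrow> 'a ^ 'n"
  assumes e: "indexed_basis e" and b: "indexed_basis b"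
  obtains K where "\<And>u i. coord b u i \<noteq> 0 \<Longrightarrow> split_norm e a u \<le> real_of_int (val (coord b u i)) + K"
proof -
  define S where "S = range (\<lambda>(i, j). a j - real_of_int (val (coord b (e j) i)))"
  have "split_norm e a u \<le> real_of_int (val (coord b u i)) + Max S" if nz: "coord b u i \<noteq> 0" for u i
  proof -
    have eq: "coord b u i = (\<Sum>j\<in>UNIV. coord e u j * coord b (e j) i)"
      using coord_sum_left[OF b, of "\<lambda>j. coord e u j *s e j" UNIV i]
      by (simp add: coord_scale[OF b] coord_sum[OF e])
    then obtain j where j: "coord e u j * coord b (e j) i \<noteq> 0"
      and le: "val (coord e u j * coord b (e j) i) \<le> val (coord b u i)"
      using val_sum_ge[of UNIV "\<lambda>j. coord e u j * coord b (e j) i"] nz by auto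
    have "split_norm e a u \<le> real_of_int (val (coord e u j)) + a j"
      using j by (intro split_norm_le[OF e]) auto
    moreover have "a j - real_of_int (val (coord b (e j) i)) \<le> Max S"
      unfolding S_def by (rule Max_ge) (auto intro!: rev_image_eqI[of "(i, j)"])
    ultimately show ?thesis using le j by (simp add: val_mult)
  qed
  then show ?thesis by (rule that)
qed

lemma lattice_norm_le_lattice_norm:
  fixes L L' :: "('a, 'n::finite) lattice"
  assumes L: "lattice L" and L': "lattice L'"
  obtains K where "\<And>u. u \<noteq> 0 \<Longrightarrow> lattice_norm L' u \<le> lattice_norm L u + K"
proof -
  obtain b where b: "indexed_basis b" and Lb: "L = apartment_lattice b (\<lambda>_. 0)"
    using L lattice_iff by auto
  obtain e where e: "indexed_basis e" and Le: "L' = apartment_lattice e (\<lambda>_. 0)"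
    using L' lattice_iff by auto
  obtain K where K: "\<And>u i. coord b u i \<noteq> 0 \<Longrightarrow>
      split_norm e (\<lambda>_. - real_of_int 0) u \<le> real_of_int (val (coord b u i)) + K"
    using split_norm_le_coord[OF e b] by blast
  have "lattice_norm L' u \<le> lattice_norm L u + \<lceil>K\<rceil>" if u: "u \<noteq> 0" for u
  proof -
    obtain i where i: "coord b u i \<noteq> 0"
      "split_norm b (\<lambda>_. - real_of_int 0) u = real_of_int (val (coord b u i)) + - real_of_int 0"
      by (rule split_norm_attained[OF b u])
    have "real_of_int (lattice_norm L' u) \<le> real_of_int (lattice_norm L u) + K"
      using K[OF i(1)] i(2) unfolding Lb Le lattice_norm_apartment_lattice[OF b u]
        lattice_norm_apartment_lattice[OF e u] by simp
    then show ?thesis by linarith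
  qed
  then show ?thesis by (rule that)
qed

text \<open>Representatives of a periodic lattice chain: it is all their multiples by powers of
  \<pi>, not only the members themselves, that are nested.\<close>

definition comparable_lattices :: "('a, 'n::finite) lattice set \<Rightarrow> bool" where
  "comparable_lattices F \<longleftrightarrow> finite F \<and> F \<noteq> {} \<and> (\<forall>L\<in>F. lattice L) \<and>
     (\<forall>L\<in>F. \<forall>L'\<in>F. \<forall>m m'. scale (\<pi> powi m) L \<subseteq> scale (\<pi> powi m') L' \<or>
        scale (\<pi> powi m') L' \<subseteq> scale (\<pi> powi m) L)"

definition sum_norm :: "('a, 'n::finite) lattice set \<Rightarrow> 'a ^ 'n \<Rightarrow> int" where
  "sum_norm F u = (\<Sum>L\<in>F. lattice_norm L u)"

lemma comparable_latticesD:
  assumes "comparable_lattices F"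
  shows "finite F" "F \<noteq> {}" "L \<in> F \<Longrightarrow> lattice L"
  using assms by (auto simp: comparable_lattices_def)

text \<open>If two lattices ordered \<open>u\<close> and \<open>w\<close> oppositely, multiples of
  them would each contain exactly one of the two vectors, not the same one, and could not be
  nested.\<close>

lemma comparable_lattice_norms:
  assumes F: "comparable_lattices F" and u: "u \<noteq> 0" and w: "w \<noteq> 0"
  shows "(\<forall>L\<in>F. lattice_norm L u \<le> lattice_norm L w) \<or> (\<forall>L\<in>F. lattice_norm L w \<le> lattice_norm L u)"
proof (rule ccontr)
  assume "\<not> ?thesis"
  then obtain L L' where L: "L \<in> F" "lattice_norm L u < lattice_norm L w"
    and L': "L' \<in> F" "lattice_norm L' w < lattice_norm L' u" by (auto simp: not_le)
  let ?m = "lattice_norm L w" and ?m' = "lattice_norm L' u"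
  have lat: "lattice L" "lattice L'" using F L L' by (auto dest: comparable_latticesD)
  have "w \<in> scale (\<pi> powi ?m) L" "u \<notin> scale (\<pi> powi ?m) L"
    "u \<in> scale (\<pi> powi ?m') L'" "w \<notin> scale (\<pi> powi ?m') L'"
    using L L' lat u w by (auto simp flip: le_lattice_norm_iff)
  moreover have "scale (\<pi> powi ?m) L \<subseteq> scale (\<pi> powi ?m') L' \<or>
      scale (\<pi> powi ?m') L' \<subseteq> scale (\<pi> powi ?m) L"
    using F L L' by (simp add: comparable_lattices_def)
  ultimately show False by blast
qed

text \<open>A sum of ultrametric norms need not be ultrametric; here it is, because all lattices of
  a nested family agree on which of two vectors has the smaller value.\<close>

lemma periodic_norm_sum_norm:
  assumes F: "comparable_lattices F"
  shows "periodic_norm (int (card F)) (sum_norm F)"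
  unfolding periodic_norm_def
proof (intro conjI allI impI)
  note F' = comparable_latticesD[OF F]
  show "0 < int (card F)" using F' by (simp add: card_gt_0_iff)
  show "sum_norm F (c *s u) = int (card F) * val c + sum_norm F u" if "u \<noteq> 0" "c \<noteq> 0" for u c
    using that F' by (simp add: sum_norm_def lattice_norm_mult sum.distrib)
  show "min (sum_norm F u) (sum_norm F w) \<le> sum_norm F (u + w)"
    if nz: "u \<noteq> 0" "w \<noteq> 0" "u + w \<noteq> 0" for u w
  proof -
    have *: "min (lattice_norm L u) (lattice_norm L w) \<le> lattice_norm L (u + w)" if "L \<in> F" for L
      using F' that nz by (intro lattice_norm_add)
    have "sum_norm F u \<le> sum_norm F (u + w) \<or> sum_norm F w \<le> sum_norm F (u + w)"
      using comparable_lattice_norms[OF F nz(1,2)] * unfolding sum_norm_def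
      by (smt (verit, best) sum_mono)
    then show ?thesis by linarith
  qed
qed

text \<open>The sum loses no information: a component that leaves one lattice of the family cannot
  gain with respect to another, by comparability; hence its total would drop, against the splitting
  of the sum.\<close>

lemma splits_sum_norm_iff:
  assumes F: "comparable_lattices F" and b: "indexed_basis b"
  shows "(\<forall>i. splits_at (int (card F)) (sum_norm F) b i) \<longleftrightarrow> (\<forall>L\<in>F. \<exists>a. L = apartment_lattice b a)"
proof
  assume sp: "\<forall>i. splits_at (int (card F)) (sum_norm F) b i"
  show "\<forall>L\<in>F. \<exists>a. L = apartment_lattice b a"
  proof
    fix L assume LF: "L \<in> F"
    then have L: "lattice L" by (rule comparable_latticesD[OF F])
    have mem: "c *s b i \<in> L \<longleftrightarrow> c = 0 \<or> - lattice_norm L (b i) \<le> val c" for c i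
    proof (cases "c = 0")
      case False
      then have "c *s b i \<noteq> 0" using indexed_basis_nonzero[OF b, of i] by simp
      then have "c *s b i \<in> L \<longleftrightarrow> 0 \<le> lattice_norm L (c *s b i)" by (rule mem_lattice_iff[OF L])
      then show ?thesis using False by (auto simp: lattice_norm_mult[OF L indexed_basis_nonzero[OF b] False])
    qed (simp add: lattice_zero L)
    have "u \<in> L \<longleftrightarrow> (\<forall>i. coord b u i *s b i \<in> L)" for u
    proof
      assume u: "u \<in> L"
      show "\<forall>i. coord b u i *s b i \<in> L"
      proof (rule allI, rule ccontr)
        fix i let ?w = "coord b u i *s b i"
        assume w: "?w \<notin> L"
        then have w0: "?w \<noteq> 0" using lattice_zero[OF L] by metis
        then have c0: "coord b u i \<noteq> 0" by auto
        then have u0: "u \<noteq> 0" using b by auto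
        have lt: "lattice_norm L ?w < lattice_norm L u"
          using u w u0 w0 L by (simp add: mem_lattice_iff)
        then have "\<forall>L\<in>F. lattice_norm L ?w \<le> lattice_norm L u"
          using comparable_lattice_norms[OF F w0 u0] LF by auto
        with lt LF have "sum_norm F ?w < sum_norm F u"
          unfolding sum_norm_def using comparable_latticesD(1)[OF F] by (intro sum_strict_mono_ex1) auto
        moreover have "sum_norm F u \<le> sum_norm F ?w"
          using sp c0 periodic_norm_mult[OF periodic_norm_sum_norm[OF F] indexed_basis_nonzero[OF b] c0]
          by (simp add: splits_at_def)
        ultimately show False by simp
      qed
    next
      assume "\<forall>i. coord b u i *s b i \<in> L"
      then have "(\<Sum>i\<in>UNIV. coord b u i *s b i) \<in> L" using L by (intro lattice_sum) auto
      then show "u \<in> L" using b by simp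
    qed
    then have "L = apartment_lattice b (\<lambda>i. - lattice_norm L (b i))"
      unfolding mem mem_apartment_lattice[OF b, symmetric] by blast
    then show "\<exists>a. L = apartment_lattice b a"
      by (rule exI[of _ "\<lambda>i. - lattice_norm L (b i)"])
  qed
next
  assume *: "\<forall>L\<in>F. \<exists>a. L = apartment_lattice b a"
  show "\<forall>i. splits_at (int (card F)) (sum_norm F) b i"
    unfolding splits_at_def
  proof (intro allI impI)
    fix i u assume c: "coord b u i \<noteq> 0"
    then have u: "u \<noteq> 0" using b by auto
    have "lattice_norm L u \<le> lattice_norm L (coord b u i *s b i)" if LF: "L \<in> F" for L
    proof -
      from * LF obtain a where a: "L = apartment_lattice b a" by auto
      have nz: "coord b u i *s b i \<noteq> 0" using c indexed_basis_nonzero[OF b] by simp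
      have "real_of_int (lattice_norm L u) \<le> real_of_int (lattice_norm L (coord b u i *s b i))"
        unfolding a lattice_norm_apartment_lattice[OF b u] lattice_norm_apartment_lattice[OF b nz]
        using split_norm_le[OF b c, of "\<lambda>i. - real_of_int (a i)"]
        by (simp add: split_norm_scale[OF b indexed_basis_nonzero[OF b] c] split_norm_basis[OF b])
      then show ?thesis by simp
    qed
    then have "sum_norm F u \<le> sum_norm F (coord b u i *s b i)"
      unfolding sum_norm_def by (intro sum_mono) auto
    then show "sum_norm F u \<le> int (card F) * val (coord b u i) + sum_norm F (b i)"
      using periodic_norm_mult[OF periodic_norm_sum_norm[OF F] indexed_basis_nonzero[OF b] c] by simp
  qed
qed

text \<open>Any two lattices have norms at bounded distance; summing these bounds over all pairs
  bounds the distortion as \<open>common_basis\<close> requires. The factors \<open>card F\<close>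
  and \<open>card G\<close> equalise the two periods.\<close>

lemma common_basis_extend:
  assumes F: "comparable_lattices F" and G: "comparable_lattices G"
    and e: "indexed_basis e" and diag: "\<forall>L\<in>F. \<exists>a. L = apartment_lattice e a"
  shows "\<exists>b. indexed_basis b \<and> (\<forall>L\<in>F \<union> G. \<exists>a. L = apartment_lattice b a)"
proof -
  note F' = comparable_latticesD[OF F] and G' = comparable_latticesD[OF G]
  have "\<exists>K. \<forall>u. u \<noteq> 0 \<longrightarrow> lattice_norm L' u \<le> lattice_norm L u + K" if "L \<in> F" "L' \<in> G" for L L'
    using lattice_norm_le_lattice_norm[OF F'(3) G'(3)] that by metis
  then obtain K where K: "\<And>L L' u. L \<in> F \<Longrightarrow> L' \<in> G \<Longrightarrow> u \<noteq> 0 \<Longrightarrow>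
      lattice_norm L' u \<le> lattice_norm L u + K L L'" by metis
  have bd: "int (card F) * sum_norm G u - int (card G) * sum_norm F u \<le> (\<Sum>L\<in>F. \<Sum>L'\<in>G. K L L')"
    if "u \<noteq> 0" for u
  proof -
    have "int (card F) * sum_norm G u - int (card G) * sum_norm F u =
        (\<Sum>L\<in>F. \<Sum>L'\<in>G. lattice_norm L' u - lattice_norm L u)"
      by (simp add: sum_norm_def sum_subtractf sum_distrib_left)
    also have "\<dots> \<le> (\<Sum>L\<in>F. \<Sum>L'\<in>G. K L L')"
    proof (intro sum_mono)
      fix L L' assume "L \<in> F" "L' \<in> G"
      with K[OF this that] show "lattice_norm L' u - lattice_norm L u \<le> K L L'" by simp
    qed
    finally show ?thesis .
  qed
  have "\<And>i. splits_at (int (card F)) (sum_norm F) e i"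
    using splits_sum_norm_iff[OF F e] diag by blast
  from common_basis[OF periodic_norm_sum_norm[OF F] periodic_norm_sum_norm[OF G] e this bd]
  obtain b where "indexed_basis b" "\<forall>i. splits_at (int (card F)) (sum_norm F) b i"
    "\<forall>i. splits_at (int (card G)) (sum_norm G) b i" by blast
  then show ?thesis
    using splits_sum_norm_iff[OF F] splits_sum_norm_iff[OF G] by blast
qed

text \<open>The extension serves twice: from a basis of a single lattice of \<open>F\<close> to all
  of \<open>F\<close>, then to \<open>G\<close>.\<close>

lemma comparable_lattices_common_basis:
  assumes F: "comparable_lattices F" and G: "comparable_lattices G"
  shows "\<exists>b. indexed_basis b \<and> (\<forall>L\<in>F \<union> G. \<exists>a. L = apartment_lattice b a)"
proof -
  obtain L where LF: "L \<in> F" using comparable_latticesD(2)[OF F] by auto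
  then have L: "lattice L" by (rule comparable_latticesD[OF F])
  then obtain b0 where b0: "indexed_basis b0" "L = apartment_lattice b0 (\<lambda>_. 0)"
    by (auto simp: lattice_iff)
  have "comparable_lattices {L}"
    using L scale_powi_mono[OF L] by (auto simp: comparable_lattices_def) (metis linear subsetD)
  from common_basis_extend[OF this F b0(1)] b0(2) obtain e
    where "indexed_basis e" "\<forall>L\<in>F. \<exists>a. L = apartment_lattice e a" by auto
  from common_basis_extend[OF F G this] show ?thesis .
qed

section \<open>Lattice chains and facets\<close>

lemma lattice_chain_bounds:
  assumes "lattice_chain Ls" "L \<in> set Ls" "L' \<in> set Ls"
  shows "scale \<pi> L \<subset> L'"
proof -
  from assms have ne: "Ls \<noteq> []" and sw: "sorted_wrt (\<supset>) Ls" and hl: "scale \<pi> (hd Ls) \<subset> last Ls"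
    by (auto simp: lattice_chain_def)
  have "L \<subseteq> hd Ls" using sw assms(2) ne by (cases Ls) auto
  moreover have "last Ls \<subseteq> L'"
    using sw assms(3) ne by (cases Ls rule: rev_cases) (auto simp: sorted_wrt_append)
  moreover have "scale \<pi> L \<subseteq> scale \<pi> (hd Ls)" using calculation(1) by (simp add: scale_subset_iff)
  ultimately show ?thesis using hl by blast
qed

lemma lattice_chain_linear:
  assumes "lattice_chain Ls" "L \<in> set Ls" "L' \<in> set Ls"
  shows "L \<subseteq> L' \<or> L' \<subseteq> L"
proof -
  from assms obtain i j where ij: "i < length Ls" "j < length Ls" "L = Ls ! i" "L' = Ls ! j"
    by (auto simp: in_set_conv_nth)
  moreover have "sorted_wrt (\<supset>) Ls" using assms by (simp add: lattice_chain_def)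
  ultimately show ?thesis
    by (cases i j rule: linorder_cases) (auto dest: sorted_wrt_nth_less)
qed

text \<open>When the exponents of \<pi> differ, one factor \<pi> outweighs the whole chain, as
  \<open>scale \<pi> L\<close> lies in every member.\<close>

lemma comparable_lattice_chain:
  assumes "lattice_chain Ls"
  shows "comparable_lattices (set Ls)"
  unfolding comparable_lattices_def
proof (intro conjI ballI allI)
  have lat: "lattice L" if "L \<in> set Ls" for L using assms that by (auto simp: lattice_chain_def)
  show "set Ls \<noteq> {}" using assms by (auto simp: lattice_chain_def)
  show "lattice L" if "L \<in> set Ls" for L by (rule lat[OF that])
  have main: "scale (\<pi> powi m) L \<subseteq> scale (\<pi> powi m') L' \<or> scale (\<pi> powi m') L' \<subseteq> scale (\<pi> powi m) L"
    if L: "L \<in> set Ls" and L': "L' \<in> set Ls" and sub: "L' \<subseteq> L" for m m' L L'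
  proof (cases "m \<le> m'")
    case True
    have "scale (\<pi> powi m') L' \<subseteq> scale (\<pi> powi m') L" using sub by (simp add: scale_subset_iff)
    also have "\<dots> \<subseteq> scale (\<pi> powi m) L" using True lat[OF L] by (intro scale_powi_mono)
    finally show ?thesis ..
  next
    case False
    then have "scale (\<pi> powi m) L \<subseteq> scale (\<pi> powi (m' + 1)) L" using lat[OF L] by (intro scale_powi_mono) auto
    also have "\<dots> = scale (\<pi> powi m') (scale \<pi> L)" by (simp add: scale_scale power_int_add)
    also have "\<dots> \<subseteq> scale (\<pi> powi m') L'"
      using lattice_chain_bounds[OF assms L L'] by (simp add: scale_subset_iff)
    finally show ?thesis ..
  qed
  show "scale (\<pi> powi m) L \<subseteq> scale (\<pi> powi m') L' \<or> scale (\<pi> powi m') L' \<subseteq> scale (\<pi> powi m) L"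
    if "L \<in> set Ls" "L' \<in> set Ls" for m m' L L'
    using lattice_chain_linear[OF assms that] main that by blast
qed simp

lemma facets_in_common_apartment:
  assumes "facet k C" "facet k' C'"
  shows "\<exists>b. indexed_basis b \<and> C \<union> C' \<subseteq> apartment_vertices b"
proof -
  from assms obtain Ls Ls' where "lattice_chain Ls" "C = homothety_class ` set Ls"
    "lattice_chain Ls'" "C' = homothety_class ` set Ls'" by (auto simp: facet_def)
  moreover from this obtain b where "indexed_basis b"
    "\<forall>L\<in>set Ls \<union> set Ls'. \<exists>a. L = apartment_lattice b a"
    using comparable_lattices_common_basis comparable_lattice_chain by metis
  moreover have "homothety_class L \<in> apartment_vertices b" if "L \<in> set Ls \<union> set Ls'" for L
  proof -
    from that calculation obtain a where "L = apartment_lattice b a" by blast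
    then show ?thesis by (simp add: apartment_vertices_def)
  qed
  ultimately show ?thesis by (intro exI[of _ b]) auto
qed

end

section \<open>Retractions from infinity\<close>

text \<open>A subset of finitely many cosets of the integers meets a bounded interval in a finite
  set. The values of a split norm are of this kind, the weights \<open>a j\<close> giving the
  cosets.\<close>

lemma finite_coset_max:
  fixes S :: "real set" and a :: "'n::finite \<Rightarrow> real"
  assumes ne: "S \<noteq> {}" and cos: "\<And>s. s \<in> S \<Longrightarrow> \<exists>j m. s = of_int m + a j"
    and bd: "\<And>s. s \<in> S \<Longrightarrow> s \<le> K"
  shows "\<exists>s\<in>S. \<forall>t\<in>S. t \<le> s"
proof -
  obtain s0 where s0: "s0 \<in> S" using ne by auto
  have "S \<inter> {s0..K} \<subseteq> (\<Union>j. (\<lambda>m. of_int m + a j) ` {\<lfloor>s0 - a j\<rfloor>..\<lceil>K - a j\<rceil>})"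
  proof
    fix s assume s: "s \<in> S \<inter> {s0..K}"
    then obtain j m where sm: "s = of_int m + a j" using cos by blast
    with s have "m \<in> {\<lfloor>s0 - a j\<rfloor>..\<lceil>K - a j\<rceil>}"
      by (auto simp: floor_le_iff le_ceiling_iff)
    with sm show "s \<in> (\<Union>j. (\<lambda>m. of_int m + a j) ` {\<lfloor>s0 - a j\<rfloor>..\<lceil>K - a j\<rceil>})" by blast
  qed
  then have fin: "finite (S \<inter> {s0..K})" by (rule finite_subset) auto
  have mem: "Max (S \<inter> {s0..K}) \<in> S \<inter> {s0..K}" using fin s0 bd by (intro Max_in) auto
  have "t \<le> Max (S \<inter> {s0..K})" if t: "t \<in> S" for t
  proof (cases "s0 \<le> t")
    case True
    then show ?thesis using fin t bd by (intro Max_ge) auto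
  next
    case False
    with mem show ?thesis by auto
  qed
  with mem show ?thesis by blast
qed

lemma norm_permute_vec:
  fixes v :: "real ^ 'n::finite"
  assumes "\<sigma> permutes UNIV"
  shows "norm (\<chi> i. v $ \<sigma> i) = norm v"
  unfolding norm_vec_def L2_set_def
  using sum.permute[OF assms, of "\<lambda>i. (norm (v $ i))\<^sup>2"] by (simp add: comp_def)

lemma mod_diagonal_add: "mod_diagonal (u + w) = mod_diagonal u + mod_diagonal w"
  by (simp add: mod_diagonal_def vec_eq_iff sum.distrib add_divide_distrib)

lemma mod_diagonal_scaleR: "mod_diagonal (c *\<^sub>R u) = c *\<^sub>R mod_diagonal u"
  by (simp add: mod_diagonal_def vec_eq_iff sum_distrib_left[symmetric] algebra_simps)

lemma linear_mod_diagonal: "linear mod_diagonal"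
  by (rule linearI) (auto simp: mod_diagonal_add mod_diagonal_scaleR)

lemma mod_diagonal_diff: "mod_diagonal (u - w) = mod_diagonal u - mod_diagonal w"
  by (rule linear_diff[OF linear_mod_diagonal])

lemma mod_diagonal_minus: "mod_diagonal (- u) = - mod_diagonal u"
  by (rule linear_neg[OF linear_mod_diagonal])

lemma mod_diagonal_vec [simp]: "mod_diagonal (vec c :: real ^ 'n::finite) = 0"
  by (simp add: mod_diagonal_def vec_eq_iff)

lemma mod_diagonal_eq_iff: "mod_diagonal u = mod_diagonal w \<longleftrightarrow> (\<exists>c. u = w + vec c)"
proof
  assume eq: "mod_diagonal u = mod_diagonal w"
  let ?m = "\<lambda>u :: real^'a. (\<Sum>j\<in>UNIV. u $ j) / real CARD('a)"
  have "u = w + vec (?m u - ?m w)"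
    using eq by (auto simp: mod_diagonal_def vec_eq_iff algebra_simps)
  then show "\<exists>c. u = w + vec c" ..
qed (auto simp: mod_diagonal_add)

lemma mod_diagonal_component_diff: "mod_diagonal u $ i - mod_diagonal u $ j = u $ i - u $ j"
  by (simp add: mod_diagonal_def)

lemma norm_mod_diagonal_le: "norm (mod_diagonal u) \<le> norm u"
proof -
  let ?m = "(\<Sum>j\<in>UNIV. u $ j) / real CARD('a)"
  have "(\<Sum>i\<in>UNIV. mod_diagonal u $ i) = 0"
    by (simp add: mod_diagonal_def sum_subtractf)
  then have "inner (mod_diagonal u) (vec ?m) = 0"
    by (simp add: inner_vec_def sum_distrib_right[symmetric] sum_divide_distrib[symmetric])
  then have "orthogonal (mod_diagonal u) (vec ?m)" by (simp add: orthogonal_def)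
  then have "(norm (mod_diagonal u + vec ?m))\<^sup>2 = (norm (mod_diagonal u))\<^sup>2 + (norm (vec ?m :: real^'a))\<^sup>2"
    by (rule norm_add_Pythagorean)
  moreover have "mod_diagonal u + vec ?m = u" by (simp add: mod_diagonal_def vec_eq_iff)
  ultimately have "(norm (mod_diagonal u))\<^sup>2 \<le> (norm u)\<^sup>2" by simp
  then show ?thesis by (simp add: power2_le_iff_abs_le)
qed

context nonarch_local_field
begin

text \<open>
  The function \<open>r\<close> orders the basis \<open>b\<close>, hence determines a full flag. The \<open>i\<close>-th slice is the
  coset of \<open>b i\<close> modulo the span of the smaller basis vectors, and \<open>retraction b r \<alpha> i\<close> is the
  quotient norm of that coset.
\<close>

definition slice :: "('n::finite \<Rightarrow> 'a ^ 'n) \<Rightarrow> ('n \<Rightarrow> nat) \<Rightarrow> 'n \<Rightarrow> ('a ^ 'n) set" where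
  "slice b r i = {u. coord b u i = 1 \<and> (\<forall>j. r i < r j \<longrightarrow> coord b u j = 0)}"

definition retraction ::
    "('n::finite \<Rightarrow> 'a ^ 'n) \<Rightarrow> ('n \<Rightarrow> nat) \<Rightarrow> ('a ^ 'n \<Rightarrow> real) \<Rightarrow> 'n \<Rightarrow> real" where
  "retraction b r \<alpha> i = Sup (\<alpha> ` slice b r i)"

lemma basis_mem_slice: "indexed_basis b \<Longrightarrow> b i \<in> slice b r i"
  by (auto simp: slice_def coord_basis)

lemma slice_nonzero: "indexed_basis b \<Longrightarrow> u \<in> slice b r i \<Longrightarrow> u \<noteq> 0"
  by (auto simp: slice_def)

lemma retraction_eqI:
  "w \<in> slice b r i \<Longrightarrow> (\<And>u. u \<in> slice b r i \<Longrightarrow> \<alpha> u \<le> \<alpha> w) \<Longrightarrow> retraction b r \<alpha> i = \<alpha> w"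
  unfolding retraction_def by (rule cSup_eq_maximum) auto

lemma retraction_split_norm_self:
  assumes b: "indexed_basis b"
  shows "retraction b r (split_norm b a) i = a i"
proof -
  have "split_norm b a u \<le> split_norm b a (b i)" if "u \<in> slice b r i" for u
    using that split_norm_le[OF b, of u i a] by (simp add: split_norm_basis[OF b] slice_def)
  from retraction_eqI[where \<alpha> = "split_norm b a", OF basis_mem_slice[OF b] this] show ?thesis
    by (simp add: split_norm_basis[OF b])
qed

context
  fixes b e :: "'n::finite \<Rightarrow> 'a ^ 'n" and r :: "'n \<Rightarrow> nat"
  assumes b: "indexed_basis b" and e: "indexed_basis e" and r: "inj r"
begin

text \<open>On a slice the \<open>i\<close>-th coordinate equals 1, which bounds the norm, and the
  values lie in finitely many cosets of the integers; so the supremum in \<open>retraction\<close>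
  is attained.\<close>

lemma slice_max:
  obtains w where "w \<in> slice b r i" "\<And>u. u \<in> slice b r i \<Longrightarrow> split_norm e a u \<le> split_norm e a w"
proof -
  obtain K where K: "\<And>u i. coord b u i \<noteq> 0 \<Longrightarrow> split_norm e a u \<le> real_of_int (val (coord b u i)) + K"
    using split_norm_le_coord[OF e b] by blast
  have "\<exists>s\<in>split_norm e a ` slice b r i. \<forall>t\<in>split_norm e a ` slice b r i. t \<le> s"
  proof (rule finite_coset_max)
    show "split_norm e a ` slice b r i \<noteq> {}" using basis_mem_slice[OF b] by blast
    fix s assume "s \<in> split_norm e a ` slice b r i"
    then obtain u where u: "u \<in> slice b r i" "s = split_norm e a u" by auto
    show "\<exists>j m. s = of_int m + a j"
      using split_norm_attained[OF e slice_nonzero[OF b u(1)], of a] u(2) by metis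
    show "s \<le> K" using K[of u i] u by (auto simp: slice_def)
  qed
  then show ?thesis using that by auto
qed

lemma retraction_split_norm_shift:
  assumes \<alpha>: "\<And>u. u \<noteq> 0 \<Longrightarrow> \<alpha> u = split_norm e a u + c"
  shows "retraction b r \<alpha> i = retraction b r (split_norm e a) i + c"
proof -
  obtain w where w: "w \<in> slice b r i" "\<And>u. u \<in> slice b r i \<Longrightarrow> split_norm e a u \<le> split_norm e a w"
    using slice_max by blast
  have "retraction b r \<alpha> i = \<alpha> w"
    using w \<alpha> slice_nonzero[OF b] by (intro retraction_eqI) auto
  then show ?thesis using retraction_eqI[where \<alpha> = "split_norm e a", OF w] \<alpha>[OF slice_nonzero[OF b w(1)]] by simp
qed

text \<open>Non-Archimedean Gram-Schmidt: best approximations chosen in the slices are unitriangular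
  over \<open>b\<close> for the order \<open>r\<close>, and they split the norm. A retraction thus
  records the weights in a splitting basis adapted to the flag.\<close>

lemma gram_schmidt:
  obtains f :: "'n \<Rightarrow> 'a ^ 'n" where "indexed_basis f" "\<And>i. split_norm e a (f i) = retraction b r (split_norm e a) i"
    "\<And>u i. coord f u i \<noteq> 0 \<Longrightarrow>
      split_norm e a u \<le> real_of_int (val (coord f u i)) + retraction b r (split_norm e a) i"
proof -
  let ?\<alpha> = "split_norm e a"
  have "\<exists>w. w \<in> slice b r i \<and> (\<forall>u\<in>slice b r i. ?\<alpha> u \<le> ?\<alpha> w)" for i
    by (rule slice_max[of i a]) blast
  then obtain f where fs: "\<And>i. f i \<in> slice b r i" and fmax: "\<And>i u. u \<in> slice b r i \<Longrightarrow> ?\<alpha> u \<le> ?\<alpha> (f i)"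
    by metis
  have ret: "?\<alpha> (f i) = retraction b r ?\<alpha> i" for i
    using retraction_eqI[where \<alpha> = "split_norm e a", OF fs fmax] by simp
  \<comment> \<open>Unitriangularity: in a combination of the \<open>f j\<close>, the coordinate at
    the highest index occurring comes from \<open>f\<close> of that index alone.\<close>
  have top: "coord b (\<Sum>j\<in>UNIV. c j *s f j) l = (if l = i then c i else 0)"
    if i: "\<And>j. c j \<noteq> 0 \<Longrightarrow> r j \<le> r i" and l: "r i \<le> r l" for c i l
  proof -
    have "coord b (\<Sum>j\<in>UNIV. c j *s f j) l = (\<Sum>j\<in>UNIV. c j * coord b (f j) l)"
      by (simp add: coord_sum_left[OF b] coord_scale[OF b])
    also have "\<dots> = (\<Sum>j\<in>UNIV. if j = l then c l else 0)"
    proof (rule sum.cong)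
      fix j
      consider "c j = 0" | "j = l" | "c j \<noteq> 0" "j \<noteq> l" "r j < r l"
        using i[of j] l r by (metis injD le_less_trans le_neq_implies_less)
      then show "c j * coord b (f j) l = (if j = l then c l else 0)"
        using fs[of j] by cases (auto simp: slice_def)
    qed simp
    also have "\<dots> = c l" by simp
    also have "\<dots> = (if l = i then c i else 0)"
      using i[of l] l r by (auto dest!: injD[OF r] order_antisym)
    finally show ?thesis .
  qed
  have f: "indexed_basis f"
  proof (rule indexed_basisI, rule ccontr)
    fix c assume s: "(\<Sum>i\<in>UNIV. c i *s f i) = 0" and "c \<noteq> (\<lambda>_. 0)"
    then obtain i0 where "c i0 \<noteq> 0" by auto
    then obtain i where i: "c i \<noteq> 0" "\<And>j. c j \<noteq> 0 \<Longrightarrow> r j \<le> r i"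
      using arg_max_nat_lemma[of "\<lambda>i. c i \<noteq> 0" i0 r "Suc (Max (range r))"] by (auto simp: less_Suc_eq_le)
    have "c i = 0" using top[of c i i] i s b by simp
    with i show False by simp
  qed
  \<comment> \<open>Strip off the term of highest index. The rescaled vector lies in a slice, so
    this term has at least the norm of \<open>u\<close>; the remainder has fewer nonzero coordinates
    and no smaller norm.\<close>
  have split: "?\<alpha> u \<le> real_of_int (val (coord f u i)) + ?\<alpha> (f i)" if "coord f u i \<noteq> 0" for u i
    using that
  proof (induction "card {i. coord f u i \<noteq> 0}" arbitrary: u rule: less_induct)
    case less
    obtain l where l: "coord f u l \<noteq> 0" "\<And>j. coord f u j \<noteq> 0 \<Longrightarrow> r j \<le> r l"
      using arg_max_nat_lemma[of "\<lambda>i. coord f u i \<noteq> 0" i r "Suc (Max (range r))"] less.prems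
      by (auto simp: less_Suc_eq_le)
    let ?c = "coord f u l"
    have u0: "u \<noteq> 0" using l(1) f by auto
    have "coord b u j = (if j = l then ?c else 0)" if "r l \<le> r j" for j
      using top[of "coord f u" l j] l(2) that f by simp
    then have "inverse ?c *s u \<in> slice b r l"
      using l(1) by (auto simp: slice_def coord_scale[OF b])
    from fmax[OF this] have ul: "?\<alpha> u \<le> real_of_int (val ?c) + ?\<alpha> (f l)"
      using l(1) u0 by (simp add: split_norm_scale[OF e u0] val_inverse del: inverse_eq_divide)
    show ?case
    proof (cases "i = l")
      case False
      define u' where "u' = u - ?c *s f l"
      have cu': "coord f u' j = (if j = l then 0 else coord f u j)" for j
        by (simp add: u'_def coord_diff[OF f] coord_scale[OF f] coord_basis[OF f])
      have nz: "coord f u' i \<noteq> 0" using less.prems False by (simp add: cu')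
      then have u'0: "u' \<noteq> 0" using f by auto
      have fl0: "(- ?c) *s f l \<noteq> 0" using l(1) indexed_basis_nonzero[OF f, of l] by simp
      have u': "u' = u + (- ?c) *s f l" by (simp add: u'_def)
      have "min (?\<alpha> u) (?\<alpha> ((- ?c) *s f l)) \<le> ?\<alpha> u'"
        unfolding u' by (rule split_norm_add[OF e u0 fl0]) (use u' u'0 in simp)
      moreover have "?\<alpha> ((- ?c) *s f l) = real_of_int (val ?c) + ?\<alpha> (f l)"
        using split_norm_scale[OF e indexed_basis_nonzero[OF f, of l], of "- ?c" a] l(1) by simp
      ultimately have "?\<alpha> u \<le> ?\<alpha> u'" using ul by simp
      also have "?\<alpha> u' \<le> real_of_int (val (coord f u' i)) + ?\<alpha> (f i)"
      proof (rule less.hyps[OF _ nz])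
        show "card {i. coord f u' i \<noteq> 0} < card {i. coord f u i \<noteq> 0}"
          using l(1) by (intro psubset_card_mono) (auto simp: cu')
      qed
      finally show ?thesis using False by (simp add: cu')
    qed (use ul in simp)
  qed
  show ?thesis using that[OF f ret] split by (simp add: ret)
qed

text \<open>The ultrametric inequality selects a nonzero term of the Leibniz expansion whose
  valuation does not exceed that of the determinant; its factors obey the entrywise bounds.\<close>

lemma val_det_ge:
  fixes P :: "'a ^ 'n ^ 'n" and \<rho> a :: "'n \<Rightarrow> real"
  assumes det: "det P \<noteq> 0"
    and ge: "\<And>i j. P $ i $ j \<noteq> 0 \<Longrightarrow> \<rho> i - a j \<le> real_of_int (val (P $ i $ j))"
  obtains \<sigma> where "\<sigma> permutes UNIV" "\<And>i. P $ i $ \<sigma> i \<noteq> 0"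
    "(\<Sum>i\<in>UNIV. \<rho> i) - (\<Sum>i\<in>UNIV. a i) \<le> (\<Sum>i\<in>UNIV. real_of_int (val (P $ i $ \<sigma> i)))"
    "(\<Sum>i\<in>UNIV. real_of_int (val (P $ i $ \<sigma> i))) \<le> real_of_int (val (det P))"
proof -
  let ?t = "\<lambda>p. of_int (sign p) * (\<Prod>i\<in>UNIV. P $ i $ p i)"
  obtain \<sigma> where \<sigma>: "\<sigma> permutes UNIV" and nz: "?t \<sigma> \<noteq> 0" and le: "val (?t \<sigma>) \<le> val (det P)"
    using val_sum_ge[of "{p. p permutes UNIV}" ?t] det unfolding det_def by auto
  from nz have nz': "P $ i $ \<sigma> i \<noteq> 0" for i by auto
  have "val (of_int (sign \<sigma>)) = 0" by (cases \<sigma> rule: sign_cases) auto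
  then have "val (?t \<sigma>) = (\<Sum>i\<in>UNIV. val (P $ i $ \<sigma> i))"
    using nz nz' by (simp add: val_mult val_prod)
  with le have 1: "(\<Sum>i\<in>UNIV. real_of_int (val (P $ i $ \<sigma> i))) \<le> real_of_int (val (det P))"
    by (simp flip: of_int_sum)
  have "(\<Sum>i\<in>UNIV. \<rho> i) - (\<Sum>i\<in>UNIV. a i) = (\<Sum>i\<in>UNIV. \<rho> i - a (\<sigma> i))"
    using sum.permute[OF \<sigma>, of a] by (simp add: sum_subtractf comp_def)
  also have "\<dots> \<le> (\<Sum>i\<in>UNIV. real_of_int (val (P $ i $ \<sigma> i)))"
    by (intro sum_mono ge nz')
  finally show ?thesis using 1 \<sigma> nz' that by blast
qed

text \<open>The change of basis matrices \<open>P\<close> and \<open>Q\<close> between two bases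
  splitting the same norm have opposite determinant valuations. The bounds for \<open>P\<close> and
  for \<open>Q\<close> therefore squeeze the sums together, and every entry of the selected term of
  \<open>P\<close> attains its bound.\<close>

lemma retraction_permutation:
  obtains \<sigma> c where "\<sigma> permutes UNIV"
    "\<And>i. retraction b r (split_norm e a) i = real_of_int (c i) + a (\<sigma> i)"
proof -
  let ?\<rho> = "retraction b r (split_norm e a)"
  obtain f where f: "indexed_basis f" and f\<rho>: "\<And>i. split_norm e a (f i) = ?\<rho> i"
    and sp: "\<And>u i. coord f u i \<noteq> 0 \<Longrightarrow> split_norm e a u \<le> real_of_int (val (coord f u i)) + ?\<rho> i"
    using gram_schmidt by blast
  define P :: "'a^'n^'n" where "P = (\<chi> i j. coord e (f i) j)"
  define Q :: "'a^'n^'n" where "Q = (\<chi> i j. coord f (e i) j)"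
  have "P ** Q = mat 1"
  proof -
    have "(\<Sum>k\<in>UNIV. coord e (f i) k * coord f (e k) j) = (if j = i then 1 else 0)" for i j
    proof -
      have "(\<Sum>k\<in>UNIV. coord e (f i) k * coord f (e k) j) =
          coord f (\<Sum>k\<in>UNIV. coord e (f i) k *s e k) j"
        by (simp only: coord_sum_left[OF f] coord_scale[OF f])
      then show ?thesis by (simp add: coord_sum[OF e] coord_basis[OF f])
    qed
    then show ?thesis by (auto simp: P_def Q_def matrix_matrix_mult_def mat_def vec_eq_iff)
  qed
  then have "det P * det Q = 1" using det_mul[of P Q] by simp
  then have det: "det P \<noteq> 0" "det Q \<noteq> 0" and "val (det P * det Q) = 0" by auto
  then have v: "val (det P) = - val (det Q)" by (simp add: val_mult)
  have Pge: "?\<rho> i - a j \<le> real_of_int (val (P $ i $ j))" if "P $ i $ j \<noteq> 0" for i j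
    using split_norm_le[OF e, of "f i" j a] that by (simp add: P_def f\<rho>)
  have Qge: "a i - ?\<rho> j \<le> real_of_int (val (Q $ i $ j))" if "Q $ i $ j \<noteq> 0" for i j
    using sp[of "e i" j] that by (simp add: Q_def split_norm_basis[OF e])
  obtain \<sigma> where \<sigma>: "\<sigma> permutes UNIV" and nz: "\<And>i. P $ i $ \<sigma> i \<noteq> 0"
    and le: "(\<Sum>i\<in>UNIV. real_of_int (val (P $ i $ \<sigma> i))) \<le> real_of_int (val (det P))"
    using val_det_ge[OF det(1) Pge] by blast
  obtain \<tau> where "(\<Sum>i\<in>UNIV. a i) - (\<Sum>i\<in>UNIV. ?\<rho> i) \<le> (\<Sum>i\<in>UNIV. real_of_int (val (Q $ i $ \<tau> i)))"
    "(\<Sum>i\<in>UNIV. real_of_int (val (Q $ i $ \<tau> i))) \<le> real_of_int (val (det Q))"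
    using val_det_ge[OF det(2) Qge] by blast
  with le v have sumle: "(\<Sum>i\<in>UNIV. real_of_int (val (P $ i $ \<sigma> i))) \<le> (\<Sum>i\<in>UNIV. ?\<rho> i) - (\<Sum>i\<in>UNIV. a i)"
    by simp
  have eq: "(\<Sum>i\<in>UNIV. ?\<rho> i) - (\<Sum>i\<in>UNIV. a i) = (\<Sum>i\<in>UNIV. ?\<rho> i - a (\<sigma> i))"
    using sum.permute[OF \<sigma>, of a] by (simp add: sum_subtractf comp_def)
  have "real_of_int (val (P $ i $ \<sigma> i)) = ?\<rho> i - a (\<sigma> i)" for i
  proof -
    have "(\<Sum>i\<in>UNIV. real_of_int (val (P $ i $ \<sigma> i)) - (?\<rho> i - a (\<sigma> i))) \<le> 0"
      using sumle eq by (simp add: sum_subtractf)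
    moreover have nn: "0 \<le> real_of_int (val (P $ i $ \<sigma> i)) - (?\<rho> i - a (\<sigma> i))" for i
      using Pge[OF nz, of i] by simp
    ultimately have "(\<Sum>i\<in>UNIV. real_of_int (val (P $ i $ \<sigma> i)) - (?\<rho> i - a (\<sigma> i))) = 0"
      by (intro order_antisym sum_nonneg) auto
    then show ?thesis using nn by (subst (asm) sum_nonneg_eq_0_iff) auto
  qed
  then have "?\<rho> i = real_of_int (val (P $ i $ \<sigma> i)) + a (\<sigma> i)" for i by simp
  with \<sigma> that[of \<sigma> "\<lambda>i. val (P $ i $ \<sigma> i)"] show ?thesis by blast
qed

section \<open>Retractions do not expand Euclidean distances\<close>

definition apartment_retraction :: "real ^ 'n \<Rightarrow> real ^ 'n" where
  "apartment_retraction p = (\<chi> i. retraction b r (split_norm e (\<lambda>j. p $ j)) i)"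

lemma split_norm_mono_dist:
  assumes u: "u \<noteq> 0"
  shows "split_norm e (\<lambda>j. p $ j) u \<le> split_norm e (\<lambda>j. q $ j) u + dist p q"
proof -
  obtain i where i: "coord e u i \<noteq> 0" "split_norm e (\<lambda>j. q $ j) u = real_of_int (val (coord e u i)) + q $ i"
    by (rule split_norm_attained[OF e u])
  have "split_norm e (\<lambda>j. p $ j) u \<le> real_of_int (val (coord e u i)) + p $ i"
    by (rule split_norm_le[OF e i(1)])
  moreover have "p $ i - q $ i \<le> dist p q"
    using component_le_norm_cart[of "p - q" i] by (simp add: dist_norm)
  ultimately show ?thesis using i by simp
qed

text \<open>The maximiser for \<open>p\<close> competes in the supremum for \<open>q\<close>. This
  crude bound only serves continuity; the sharp Euclidean one needs the permutation form.\<close>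

lemma apartment_retraction_component_le:
  "apartment_retraction p $ i \<le> apartment_retraction q $ i + dist p q"
proof -
  obtain w where w: "w \<in> slice b r i"
    "\<And>u. u \<in> slice b r i \<Longrightarrow> split_norm e (\<lambda>j. p $ j) u \<le> split_norm e (\<lambda>j. p $ j) w"
    using slice_max by blast
  obtain w' where w': "w' \<in> slice b r i"
    "\<And>u. u \<in> slice b r i \<Longrightarrow> split_norm e (\<lambda>j. q $ j) u \<le> split_norm e (\<lambda>j. q $ j) w'"
    using slice_max by blast
  have "apartment_retraction p $ i = split_norm e (\<lambda>j. p $ j) w"
    unfolding apartment_retraction_def using retraction_eqI[where \<alpha> = "split_norm e (\<lambda>j. p $ j)", OF w] by simp
  also have "\<dots> \<le> split_norm e (\<lambda>j. q $ j) w + dist p q"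
    by (rule split_norm_mono_dist[OF slice_nonzero[OF b w(1)]])
  also have "\<dots> \<le> split_norm e (\<lambda>j. q $ j) w' + dist p q" using w'(2)[OF w(1)] by simp
  also have "split_norm e (\<lambda>j. q $ j) w' = apartment_retraction q $ i"
    unfolding apartment_retraction_def using retraction_eqI[where \<alpha> = "split_norm e (\<lambda>j. q $ j)", OF w'] by simp
  finally show ?thesis .
qed

lemma continuous_apartment_retraction: "continuous_on UNIV apartment_retraction"
proof -
  have "continuous_on UNIV (\<lambda>p. apartment_retraction p $ i)" for i
  proof (rule continuous_on_iff[THEN iffD2], intro ballI allI impI)
    fix p :: "real^'n" and \<epsilon> :: real assume "0 < \<epsilon>"
    moreover have "dist (apartment_retraction q $ i) (apartment_retraction p $ i) \<le> dist q p" for q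
      using apartment_retraction_component_le[of p i q] apartment_retraction_component_le[of q i p]
      by (simp add: dist_real_def dist_commute abs_le_iff)
    ultimately show "\<exists>d>0. \<forall>q\<in>UNIV. dist q p < d \<longrightarrow>
        dist (apartment_retraction q $ i) (apartment_retraction p $ i) < \<epsilon>"
      by (intro exI[of _ \<epsilon>]) (auto intro: le_less_trans)
  qed
  then have "continuous_on UNIV (\<lambda>p. \<chi> i. apartment_retraction p $ i)"
    by (rule continuous_on_vec_lambda)
  then show ?thesis by simp
qed

text \<open>
  Along a segment the retraction is one of finitely many affine maps of the same speed at every
  point, namely a permutation of the coordinates followed by an integral translation.
\<close>

lemma dist_apartment_retraction_le:
  "dist (apartment_retraction p) (apartment_retraction q) \<le> dist p q"
proof -
  let ?l = "\<lambda>t. p + t *\<^sub>R (q - p)"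
  let ?g = "\<lambda>t. apartment_retraction (?l t)"
  have cont: "continuous_on {0..1} ?g"
    by (rule continuous_on_compose2[OF continuous_apartment_retraction])
      (auto intro!: continuous_intros)
  then have "bounded (?g ` {0..1})" by (intro compact_imp_bounded compact_continuous_image) auto
  then obtain B1 where B1: "\<And>t. t \<in> {0..1} \<Longrightarrow> norm (?g t) \<le> B1"
    unfolding bounded_iff by blast
  have "bounded (?l ` {0..1})"
    by (intro compact_imp_bounded compact_continuous_image continuous_intros) auto
  then obtain B2 where B2: "\<And>t. t \<in> {0..1} \<Longrightarrow> norm (?l t) \<le> B2"
    unfolding bounded_iff by blast
  \<comment> \<open>Both the segment and its image are bounded, which bounds the integral
    translations; hence only the finitely many affine maps indexed by \<open>I\<close>
    occur.\<close>
  define N where "N = \<lceil>B1 + B2\<rceil>"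
  define I where "I = {\<sigma>. \<sigma> permutes (UNIV :: 'n set)} \<times> ((UNIV :: 'n set) \<rightarrow>\<^sub>E {-N..N})"
  define h where "h = (\<lambda>(\<sigma>, c) t. (\<chi> i. real_of_int (c i) + ?l t $ \<sigma> i) :: real^'n)"
  define U where "U s = {t \<in> {0..1}. ?g t = h s t}" for s
  have "finite I" unfolding I_def by (intro finite_cartesian_product finite_PiE) (auto simp: finite_permutations)
  moreover have closed: "closed (U s)" if "s \<in> I" for s
  proof -
    have "continuous_on {0..1} (h s)"
      unfolding h_def by (cases s) (auto intro!: continuous_intros)
    then have "closed {t \<in> {0..1}. ?g t - h s t = 0}"
      by (intro continuous_closed_preimage_constant continuous_intros cont) auto
    then show ?thesis by (simp add: U_def)
  qed
  moreover have "(dist p q)-lipschitz_on (U s) ?g" if "s \<in> I" for s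
  proof (rule lipschitz_onI)
    fix t t' assume t: "t \<in> U s" and t': "t' \<in> U s"
    obtain \<sigma> c where s: "s = (\<sigma>, c)" by (cases s)
    then have \<sigma>: "\<sigma> permutes UNIV" using that by (simp add: I_def)
    have "h s t - h s t' = (t - t') *\<^sub>R (\<chi> i. (q - p) $ \<sigma> i)"
      by (simp add: h_def s vec_eq_iff algebra_simps)
    then have "norm (h s t - h s t') = \<bar>t - t'\<bar> * norm (q - p)"
      by (simp only: norm_scaleR norm_permute_vec[OF \<sigma>] real_norm_def)
    with t t' show "dist (?g t) (?g t') \<le> dist p q * dist t t'"
      by (simp add: U_def dist_norm norm_minus_commute mult.commute)
  qed simp
  moreover have "{0..1} \<subseteq> (\<Union>s\<in>I. U s)"
  proof
    fix t :: real assume t: "t \<in> {0..1}"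
    obtain \<sigma> c where \<sigma>: "\<sigma> permutes UNIV"
      and c0: "\<And>i. retraction b r (split_norm e (\<lambda>j. ?l t $ j)) i = real_of_int (c i) + ?l t $ \<sigma> i"
      using retraction_permutation by blast
    have c: "?g t $ i = real_of_int (c i) + ?l t $ \<sigma> i" for i
      using c0[of i] by (simp only: apartment_retraction_def vec_lambda_beta)
    have "?g t = h (\<sigma>, c) t"
      unfolding h_def using c by (simp only: vec_eq_iff vec_lambda_beta prod.case) simp
    moreover have "c i \<in> {-N..N}" for i
    proof -
      have "real_of_int (c i) = ?g t $ i - ?l t $ \<sigma> i"
        using c[of i] by linarith
      moreover have "\<bar>?g t $ i\<bar> \<le> B1" "\<bar>?l t $ \<sigma> i\<bar> \<le> B2"
        using component_le_norm_cart B1[OF t] B2[OF t] by (meson order_trans)+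
      ultimately have "\<bar>real_of_int (c i)\<bar> \<le> B1 + B2" by linarith
      then show ?thesis unfolding N_def by (auto simp: abs_le_iff) linarith+
    qed
    ultimately show "t \<in> (\<Union>s\<in>I. U s)"
      using \<sigma> t by (intro UN_I[of "(\<sigma>, c)"]) (auto simp: I_def U_def)
  qed
  \<comment> \<open>A Lipschitz bound shared by finitely many closed pieces that cover an interval
    holds on the whole interval.\<close>
  ultimately have "(dist p q)-lipschitz_on {0..1} ?g"
    by (intro lipschitz_on_closed_Union[of I _ U]) auto
  from lipschitz_onD[OF this, of 0 1] show ?thesis by (simp add: dist_real_def)
qed

lemma apartment_retraction_shift: "apartment_retraction (p + vec c) = apartment_retraction p + vec c"
proof -
  have "retraction b r (split_norm e (\<lambda>j. (p + vec c) $ j)) i = retraction b r (split_norm e (\<lambda>j. p $ j)) i + c" for i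
    using e by (intro retraction_split_norm_shift) (simp add: split_norm_shift)
  then show ?thesis by (simp add: apartment_retraction_def vec_eq_iff)
qed

lemma norm_mod_diagonal_retraction_le:
  "norm (mod_diagonal (apartment_retraction p - apartment_retraction q)) \<le> norm (mod_diagonal (p - q))"
proof -
  \<comment> \<open>The mean of \<open>p - q\<close>: shifting \<open>q\<close> along the diagonal
    by it makes the difference orthogonal to the diagonal, where the quotient norm is the Euclidean
    norm.\<close>
  define c where "c = (\<Sum>j\<in>UNIV. (p - q) $ j) / real CARD('n)"
  have eq: "p - (q + vec c) = mod_diagonal (p - q)"
    by (simp add: mod_diagonal_def c_def vec_eq_iff)
  have "mod_diagonal (apartment_retraction p - apartment_retraction q) =
      mod_diagonal (apartment_retraction p - apartment_retraction (q + vec c))"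
    by (simp add: apartment_retraction_shift mod_diagonal_diff mod_diagonal_add)
  also have "norm \<dots> \<le> norm (apartment_retraction p - apartment_retraction (q + vec c))"
    by (rule norm_mod_diagonal_le)
  also have "\<dots> \<le> norm (mod_diagonal (p - q))"
    using dist_apartment_retraction_le[of p "q + vec c"] by (simp only: dist_norm eq)
  finally show ?thesis .
qed

end

end

section \<open>Points of the building as norms\<close>

context nonarch_local_field
begin

text \<open>A homothety of valuation at least 1 would push a lattice below the whole chain; any
  other one does not shrink it.\<close>

lemma homothety_class_inj_on_chain:
  assumes ch: "lattice_chain Ls"
  shows "inj_on homothety_class (set Ls)"
proof -
  have False if L: "L \<in> set Ls" and L': "L' \<in> set Ls" and eq: "homothety_class L = homothety_class L'"
    and sub: "L' \<subset> L" for L L'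
  proof -
    have lat: "lattice L" using L ch by (simp add: lattice_chain_def)
    obtain c where c: "c \<noteq> 0" "L' = scale c L" using homothety_class_eq_iff[THEN iffD1, OF eq] by blast
    have L'c: "L' = scale (\<pi> powi val c) L" using c(2) scale_eq_scale_val[OF lat c(1)] by simp
    show False
    proof (cases "1 \<le> val c")
      case True
      then have "scale (\<pi> powi val c) L \<subseteq> scale (\<pi> powi 1) L" by (intro scale_powi_mono[OF lat])
      with lattice_chain_bounds[OF ch L L'] L'c show False by simp
    next
      case False
      then have "scale (\<pi> powi 0) L \<subseteq> scale (\<pi> powi val c) L" by (intro scale_powi_mono[OF lat]) simp
      with sub L'c show False by simp
    qed
  qed
  then show ?thesis using lattice_chain_linear[OF ch] by (intro inj_onI) (metis psubset_eq)
qed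

lemma facet_finite: "facet k C \<Longrightarrow> finite C"
  by (auto simp: facet_def)

lemma lattice_chain_distinct: "lattice_chain Ls \<Longrightarrow> distinct Ls"
  unfolding lattice_chain_def distinct_conv_nth
  by (metis nat_neq_iff psubset_eq sorted_wrt_nth_less)

lemma facet_card: "facet k C \<Longrightarrow> card C = k + 1"
  unfolding facet_def
  by (metis card_image distinct_card homothety_class_inj_on_chain lattice_chain_distinct)

text \<open>Representatives from the chain are nested and differ by at most one factor \<pi>, so
  after normalisation the differences of exponents all lie in {0, 1} or all in {-1, 0}.\<close>

lemma facet_oscillation:
  assumes C: "facet k C" and b: "indexed_basis b"
    and v: "apartment_vertex b a \<in> C" and w: "apartment_vertex b a' \<in> C"
  shows "(a i - a' i) - (a j - a' j) \<le> 1"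
proof -
  obtain Ls where ch: "lattice_chain Ls" and CLs: "C = homothety_class ` set Ls"
    using C by (auto simp: facet_def)
  obtain L where L: "L \<in> set Ls" "homothety_class L = apartment_vertex b a" using v CLs by auto
  obtain L' where L': "L' \<in> set Ls" "homothety_class L' = apartment_vertex b a'" using w CLs by auto
  obtain c where c: "L = apartment_lattice b (\<lambda>i. a i + c)"
    using homothety_class_eq_apartment_vertexD[OF b L(2)] by auto
  obtain c' where c': "L' = apartment_lattice b (\<lambda>i. a' i + c')"
    using homothety_class_eq_apartment_vertexD[OF b L'(2)] by auto
  have "scale \<pi> L \<subseteq> L'" "scale \<pi> L' \<subseteq> L" "L \<subseteq> L' \<or> L' \<subseteq> L"
    using lattice_chain_bounds[OF ch L(1) L'(1)] lattice_chain_bounds[OF ch L'(1) L(1)]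
      lattice_chain_linear[OF ch L(1) L'(1)] by auto
  then have 1: "\<And>i. a' i + c' \<le> a i + c + 1" and 2: "\<And>i. a i + c \<le> a' i + c' + 1"
    and 3: "(\<forall>i. a' i + c' \<le> a i + c) \<or> (\<forall>i. a i + c \<le> a' i + c')"
    unfolding c c' by (auto simp: scale_apartment_lattice[OF b] apartment_lattice_subset_iff[OF b])
  show ?thesis using 1[of i] 1[of j] 2[of i] 2[of j] 3 by (smt (verit))
qed

definition exponent :: "('n::finite \<Rightarrow> 'a ^ 'n) \<Rightarrow> ('a, 'n) vertex \<Rightarrow> 'n \<Rightarrow> int" where
  "exponent b v = (SOME a. v = apartment_vertex b a)"

text \<open>A lift of the chart to the space before the quotient. As the weights of a point sum to
  1, other choices of exponents move it along the diagonal only.\<close>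

definition position :: "('n::finite \<Rightarrow> 'a ^ 'n) \<Rightarrow> ('a, 'n) point \<Rightarrow> real ^ 'n" where
  "position b x = (\<Sum>v | x v \<noteq> 0. x v *\<^sub>R (\<chi> i. real_of_int (exponent b v i)))"

lemma exponent: "v \<in> apartment_vertices b \<Longrightarrow> apartment_vertex b (exponent b v) = v"
  unfolding exponent_def mem_apartment_vertices
  using someI_ex[of "\<lambda>a. v = apartment_vertex b a"] by simp

lemma exponent_apartment_vertex:
  assumes "indexed_basis b"
  obtains c where "\<And>i. exponent b (apartment_vertex b a) i = a i + c"
proof -
  have "apartment_vertex b a = apartment_vertex b (exponent b (apartment_vertex b a))"
    using exponent[of "apartment_vertex b a" b] by (simp add: apartment_vertices_def)
  with apartment_vertex_eq_iff[OF assms] that show ?thesis by blast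
qed

lemma vertex_coords_eq: "vertex_coords b v = mod_diagonal (\<chi> i. real_of_int (exponent b v i))"
  by (simp add: vertex_coords_def exponent_def)

lemma vertex_coords_apartment_vertex:
  assumes "indexed_basis b"
  shows "vertex_coords b (apartment_vertex b a) = mod_diagonal (\<chi> i. real_of_int (a i))"
proof -
  obtain c where c: "\<And>i. exponent b (apartment_vertex b a) i = a i + c"
    using exponent_apartment_vertex[OF assms] by blast
  show ?thesis
    unfolding vertex_coords_eq mod_diagonal_eq_iff
    by (rule exI[of _ "real_of_int c"]) (simp add: c vec_eq_iff)
qed

lemma apartment_chart_eq: "apartment_chart b x = mod_diagonal (position b x)"
  by (simp add: apartment_chart_def position_def vertex_coords_eq
      linear_sum[OF linear_mod_diagonal] mod_diagonal_scaleR)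

lemma closed_simplexD:
  assumes "x \<in> closed_simplex C" "facet k C"
  shows "{v. x v \<noteq> 0} \<subseteq> C" "finite {v. x v \<noteq> 0}" "0 \<le> x v" "(\<Sum>v | x v \<noteq> 0. x v) = 1"
proof -
  show *: "{v. x v \<noteq> 0} \<subseteq> C" using assms(1) by (auto simp: closed_simplex_def)
  then show "finite {v. x v \<noteq> 0}" using facet_finite[OF assms(2)] by (rule finite_subset)
  show "0 \<le> x v" using assms(1) by (auto simp: closed_simplex_def)
  have "(\<Sum>v | x v \<noteq> 0. x v) = (\<Sum>v\<in>C. x v)"
    using * facet_finite[OF assms(2)] by (intro sum.mono_neutral_left) auto
  then show "(\<Sum>v | x v \<noteq> 0. x v) = 1" using assms(1) by (simp add: closed_simplex_def)
qed

lemma apartmentE: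
  assumes "x \<in> apartment b"
  obtains k C where "facet k C" "x \<in> closed_simplex C"
    "\<And>v. x v \<noteq> 0 \<Longrightarrow> v \<in> apartment_vertices b"
  using assms by (auto simp: apartment_def realization_def)

text \<open>Another representative \<open>L\<close> of a vertex would change this mean of norms by a
  constant, so only its class modulo constants has a meaning, just as a position is meaningful
  modulo the diagonal.\<close>

definition point_norm :: "('a, 'n::finite) point \<Rightarrow> 'a ^ 'n \<Rightarrow> real" where
  "point_norm x u = (\<Sum>v | x v \<noteq> 0. x v * real_of_int (lattice_norm (SOME L. L \<in> v) u))"

lemma split_norm_eqI:
  assumes b: "indexed_basis b" and i: "coord b u i \<noteq> 0"
    and min: "\<And>j. coord b u j \<noteq> 0 \<Longrightarrow>
      real_of_int (val (coord b u i)) + a i \<le> real_of_int (val (coord b u j)) + a j"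
  shows "split_norm b a u = real_of_int (val (coord b u i)) + a i"
proof (rule order_antisym)
  show "split_norm b a u \<le> real_of_int (val (coord b u i)) + a i" by (rule split_norm_le[OF b i])
  have "u \<noteq> 0" using i b by auto
  then show "real_of_int (val (coord b u i)) + a i \<le> split_norm b a u"
    using min by (simp add: le_split_norm_iff[OF b])
qed

lemma lattice_norm_vertex_rep:
  assumes b: "indexed_basis b" and v: "v \<in> apartment_vertices b"
  obtains c where "\<And>u. u \<noteq> 0 \<Longrightarrow> real_of_int (lattice_norm (SOME L. L \<in> v) u) =
    split_norm b (\<lambda>i. - real_of_int (exponent b v i)) u + c"
proof -
  have "apartment_lattice b (exponent b v) \<in> v"
    using mem_homothety_class[of "apartment_lattice b (exponent b v)"] exponent[OF v] by simp
  then have "(SOME L. L \<in> v) \<in> v" by (rule someI)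
  then have "(SOME L. L \<in> v) \<in> apartment_vertex b (exponent b v)" by (simp only: exponent[OF v])
  then obtain c where c: "c \<noteq> 0" "(SOME L. L \<in> v) = scale c (apartment_lattice b (exponent b v))"
    unfolding homothety_class_def by auto
  have "real_of_int (lattice_norm (SOME L. L \<in> v) u) =
      split_norm b (\<lambda>i. - real_of_int (exponent b v i)) u + - real_of_int (val c)" if u: "u \<noteq> 0" for u
    unfolding c(2) lattice_norm_scale[OF lattice_apartment_lattice[OF b] u c(1)]
    by (simp add: lattice_norm_apartment_lattice[OF b u])
  then show ?thesis by (rule that)
qed

text \<open>
  On the vertices of one facet the minima defining the lattice norms of a given vector are all
  attained at a common coordinate, so a weighted sum of these norms is again a split norm.
\<close>

lemma point_norm_apartment:
  assumes b: "indexed_basis b" and x: "x \<in> apartment b"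
  obtains c where "\<And>u. u \<noteq> 0 \<Longrightarrow> point_norm x u = split_norm b (\<lambda>i. - position b x $ i) u + c"
proof -
  obtain k C where C: "facet k C" and xC: "x \<in> closed_simplex C"
    and xb: "\<And>v. x v \<noteq> 0 \<Longrightarrow> v \<in> apartment_vertices b"
    using apartmentE[OF x] by metis
  define S where "S = {v. x v \<noteq> 0}"
  have SC: "S \<subseteq> C" and fin: "finite S" and pos: "\<And>v. 0 \<le> x v" and sum1: "(\<Sum>v\<in>S. x v) = 1"
    using closed_simplexD[OF xC C] by (simp_all add: S_def)
  let ?e = "exponent b"
  have "\<exists>c. \<forall>u. u \<noteq> 0 \<longrightarrow> real_of_int (lattice_norm (SOME L. L \<in> v) u) =
      split_norm b (\<lambda>i. - real_of_int (?e v i)) u + c" if "v \<in> S" for v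
  proof -
    from that have "v \<in> apartment_vertices b" using xb by (simp add: S_def)
    then show ?thesis by (rule lattice_norm_vertex_rep[OF b]) blast
  qed
  then obtain c where c: "\<And>v u. v \<in> S \<Longrightarrow> u \<noteq> 0 \<Longrightarrow> real_of_int (lattice_norm (SOME L. L \<in> v) u) =
      split_norm b (\<lambda>i. - real_of_int (?e v i)) u + c v"
    by metis
  have pos_i: "position b x $ i = (\<Sum>v\<in>S. x v * real_of_int (?e v i))" for i
    by (simp add: position_def S_def sum_component)
  have "point_norm x u = split_norm b (\<lambda>i. - position b x $ i) u + (\<Sum>v\<in>S. x v * c v)"
    if u: "u \<noteq> 0" for u
  proof -
    define D where "D v i = val (coord b u i) - ?e v i" for v i
    define I where "I = {i. coord b u i \<noteq> 0}"
    have Ine: "I \<noteq> {}" using coord_nonzero[OF b u] by (auto simp: I_def)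
    \<comment> \<open>An index minimising the sum over the vertices minimises each summand: by
      \<open>facet_oscillation\<close>, an index that is better for one vertex is at least as good
      for all the others, and would have a smaller sum.\<close>
    define G where "G i = (\<Sum>v\<in>S. D v i)" for i
    have "Min (G ` I) \<in> G ` I" using Ine by (intro Min_in) auto
    then obtain i where i: "i \<in> I" "G i = Min (G ` I)" by auto
    have Gmin: "G i \<le> G j" if "j \<in> I" for j
      unfolding i(2) using that by (intro Min_le) auto
    have Dmin: "D v i \<le> D v j" if v: "v \<in> S" and j: "j \<in> I" for v j
    proof (rule ccontr)
      assume less: "\<not> D v i \<le> D v j"
      have "D w j \<le> D w i" if w: "w \<in> S" for w
      proof -
        have "(?e w j - ?e v j) - (?e w i - ?e v i) \<le> 1"
             "(?e w i - ?e v i) - (?e w j - ?e v j) \<le> 1"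
          using facet_oscillation[OF C b, of "?e w" "?e v"] v w SC xb exponent[of _ b]
          unfolding S_def by (metis (mono_tags, lifting) mem_Collect_eq subsetD)+
        with less show ?thesis by (simp add: D_def)
      qed
      then have "G j < G i"
        unfolding G_def using less v fin by (intro sum_strict_mono_ex1) (auto simp: not_le)
      with Gmin[OF j] show False by simp
    qed
    have ci: "coord b u i \<noteq> 0" using i by (simp add: I_def)
    have sn: "split_norm b (\<lambda>i. - real_of_int (?e v i)) u = real_of_int (D v i)" if "v \<in> S" for v
    proof -
      have "split_norm b (\<lambda>i. - real_of_int (?e v i)) u =
          real_of_int (val (coord b u i)) + - real_of_int (?e v i)"
      proof (rule split_norm_eqI[OF b ci, of "\<lambda>i. - real_of_int (?e v i)"])
        fix j assume "coord b u j \<noteq> 0"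
        then have "D v i \<le> D v j" using Dmin[OF that, of j] by (simp add: I_def)
        then show "real_of_int (val (coord b u i)) + - real_of_int (?e v i) \<le>
            real_of_int (val (coord b u j)) + - real_of_int (?e v j)"
          unfolding D_def by linarith
      qed
      then show ?thesis by (simp add: D_def)
    qed
    have sumD: "(\<Sum>v\<in>S. x v * real_of_int (D v j)) = real_of_int (val (coord b u j)) + - position b x $ j" for j
      unfolding D_def pos_i using sum1
      by (simp add: right_diff_distrib sum_subtractf sum_distrib_right[symmetric])
    have "split_norm b (\<lambda>i. - position b x $ i) u = real_of_int (val (coord b u i)) + - position b x $ i"
    proof (rule split_norm_eqI[OF b ci, of "\<lambda>i. - position b x $ i"])
      fix j assume "coord b u j \<noteq> 0"
      then have "(\<Sum>v\<in>S. x v * real_of_int (D v i)) \<le> (\<Sum>v\<in>S. x v * real_of_int (D v j))"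
        using Dmin pos by (intro sum_mono mult_left_mono) (auto simp: I_def)
      then show "real_of_int (val (coord b u i)) + - position b x $ i \<le>
          real_of_int (val (coord b u j)) + - position b x $ j"
        unfolding sumD .
    qed
    moreover have "point_norm x u = (\<Sum>v\<in>S. x v * (real_of_int (D v i) + c v))"
      unfolding point_norm_def S_def[symmetric] by (rule sum.cong) (auto simp: c u sn)
    ultimately show ?thesis using sumD[of i] by (simp add: distrib_left sum.distrib)
  qed
  then show ?thesis by (rule that)
qed

text \<open>The retraction centred at the chamber at infinity of the flag ordered by
  \<open>r\<close>, in chart coordinates. It is computed from the norm of the point alone, so no
  apartment through \<open>x\<close> has to be chosen. The minus sign turns weights of norms back
  into exponents.\<close>

definition horoball_retraction ::
    "('n::finite \<Rightarrow> 'a ^ 'n) \<Rightarrow> ('n \<Rightarrow> nat) \<Rightarrow> ('a, 'n) point \<Rightarrow> real ^ 'n" where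
  "horoball_retraction b r x = mod_diagonal (\<chi> i. - retraction b r (point_norm x) i)"

lemma retraction_point_norm:
  assumes b: "indexed_basis b" and e: "indexed_basis e" and r: "inj r" and x: "x \<in> apartment e"
  shows "horoball_retraction b r x = - mod_diagonal (apartment_retraction b e r (- position e x))"
proof -
  obtain c where c: "\<And>u. u \<noteq> 0 \<Longrightarrow> point_norm x u = split_norm e (\<lambda>i. - position e x $ i) u + c"
    using point_norm_apartment[OF e x] by blast
  have "retraction b r (point_norm x) i = apartment_retraction b e r (- position e x) $ i + c" for i
    using retraction_split_norm_shift[OF b e r c, of i] by (simp add: apartment_retraction_def[OF b e r])
  then have "(\<chi> i. - retraction b r (point_norm x) i) =
      - (apartment_retraction b e r (- position e x)) + vec (- c)"
    by (simp add: vec_eq_iff)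
  then show ?thesis
    by (simp add: horoball_retraction_def mod_diagonal_diff)
qed

lemma dist_horoball_retraction_le:
  assumes b: "indexed_basis b" and e: "indexed_basis e" and r: "inj r"
    and x: "x \<in> apartment e" and z: "z \<in> apartment e"
  shows "dist (horoball_retraction b r x) (horoball_retraction b r z) \<le>
    dist (apartment_chart e x) (apartment_chart e z)"
proof -
  have "dist (horoball_retraction b r x) (horoball_retraction b r z) =
      norm (mod_diagonal (apartment_retraction b e r (- position e x) -
        apartment_retraction b e r (- position e z)))"
    unfolding retraction_point_norm[OF b e r x] retraction_point_norm[OF b e r z]
    by (simp add: dist_minus dist_norm mod_diagonal_diff norm_minus_commute)
  also have "\<dots> \<le> norm (mod_diagonal (- position e x - - position e z))"
    by (rule norm_mod_diagonal_retraction_le[OF b e r])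
  also have "\<dots> = dist (apartment_chart e x) (apartment_chart e z)"
    by (simp add: apartment_chart_eq dist_norm mod_diagonal_diff
        mod_diagonal_minus norm_minus_commute)
  finally show ?thesis .
qed

lemma horoball_retraction_apartment:
  assumes b: "indexed_basis b" and r: "inj r" and x: "x \<in> apartment b"
  shows "horoball_retraction b r x = apartment_chart b x"
proof -
  have "apartment_retraction b b r p = p" for p
    by (simp add: apartment_retraction_def[OF b b r] retraction_split_norm_self[OF b] vec_eq_iff)
  then show ?thesis
    by (simp add: retraction_point_norm[OF b b r x] apartment_chart_eq mod_diagonal_minus)
qed

lemma ex_inj_nat: "\<exists>r :: 'n::finite \<Rightarrow> nat. inj r"
  using finite_imp_inj_to_nat_seg[of "UNIV :: 'n set"] by auto

text \<open>If two apartments contain both points, retract onto each of them: the retraction fixes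
  the chart of its target and does not expand the distance measured in the other, so the two
  distances bound each other.\<close>

lemma building_dist_eq:
  fixes b :: "'n::finite \<Rightarrow> 'a ^ 'n"
  assumes b: "indexed_basis b" and x: "x \<in> apartment b" and y: "y \<in> apartment b"
  shows "building_dist x y = dist (apartment_chart b x) (apartment_chart b y)"
  unfolding building_dist_def
proof (rule the_equality)
  fix d assume "\<exists>e. indexed_basis e \<and> x \<in> apartment e \<and> y \<in> apartment e \<and>
    d = dist (apartment_chart e x) (apartment_chart e y)"
  then obtain e where e: "indexed_basis e" and xe: "x \<in> apartment e" and ye: "y \<in> apartment e"
    and d: "d = dist (apartment_chart e x) (apartment_chart e y)" by auto
  obtain r :: "'n \<Rightarrow> nat" where r: "inj r" using ex_inj_nat by auto
  have "dist (apartment_chart b x) (apartment_chart b y) \<le> d"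
    using dist_horoball_retraction_le[OF b e r xe ye]
    by (simp only: horoball_retraction_apartment[OF b r x] horoball_retraction_apartment[OF b r y] d)
  moreover have "d \<le> dist (apartment_chart b x) (apartment_chart b y)"
    using dist_horoball_retraction_le[OF e b r x y]
    by (simp only: horoball_retraction_apartment[OF e r xe] horoball_retraction_apartment[OF e r ye] d)
  ultimately show "d = dist (apartment_chart b x) (apartment_chart b y)" by simp
qed (use assms in blast)

lemma common_apartment:
  assumes "x \<in> realization" "y \<in> realization"
  obtains b where "indexed_basis b" "x \<in> apartment b" "y \<in> apartment b"
proof -
  obtain k C k' C' where C: "facet k C" "x \<in> closed_simplex C" "facet k' C'" "y \<in> closed_simplex C'"
    using assms by (auto simp: realization_def)
  obtain b where "indexed_basis b" "C \<union> C' \<subseteq> apartment_vertices b"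
    using facets_in_common_apartment[OF C(1,3)] by auto
  moreover from this have "x \<in> apartment b" "y \<in> apartment b"
    using assms closed_simplexD(1)[OF C(2,1)] closed_simplexD(1)[OF C(4,3)]
    by (auto simp: apartment_def)
  ultimately show ?thesis using that by blast
qed

lemma building_dist_horoball_retraction:
  assumes b: "indexed_basis b" and r: "inj r" and x: "x \<in> realization" and z: "z \<in> realization"
  shows "dist (horoball_retraction b r x) (horoball_retraction b r z) \<le> building_dist x z"
proof -
  obtain e where e: "indexed_basis e" and xz: "x \<in> apartment e" "z \<in> apartment e"
    using common_apartment[OF x z] by blast
  with dist_horoball_retraction_le[OF b e r xz] show ?thesis by (simp add: building_dist_eq)
qed

end

section \<open>Barycentric coordinates in an apartment\<close>

text \<open>Indexing by all integers makes the cyclic symmetry of a facet visible: no vertex comes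
  first, and a vertex is an index modulo \<open>p\<close>.\<close>

definition alcove_chain :: "int \<Rightarrow> (int \<Rightarrow> 'n \<Rightarrow> int) \<Rightarrow> bool" where
  "alcove_chain p a \<longleftrightarrow> 0 < p \<and> (\<forall>j. a j < a (j + 1)) \<and> (\<forall>j i. a (j + p) i = a j i + 1)"

context
  fixes p :: int and a :: "int \<Rightarrow> 'n \<Rightarrow> int"
  assumes a: "alcove_chain p a"
begin

lemma alcove_chain_strict: "j < l \<Longrightarrow> a j < a l"
proof (induction l rule: int_gr_induct)
  case base
  then show ?case using a by (simp add: alcove_chain_def)
next
  case (step l)
  then show ?case using a by (auto simp: alcove_chain_def intro: less_trans)
qed

lemma alcove_chain_le: "j \<le> l \<Longrightarrow> a j i \<le> a l i"
  using alcove_chain_strict[of j l] by (cases "j = l") (auto simp: le_fun_def less_le)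

lemma alcove_chain_period: "a (j + p * m) i = a j i + m"
proof (induction m rule: int_induct[where k = 0])
  case (step1 m)
  have "a (j + p * (m + 1)) i = a ((j + p * m) + p) i" by (simp add: algebra_simps)
  then show ?case using a step1 by (simp add: alcove_chain_def)
next
  case (step2 m)
  have "a (j + p * m) i = a ((j + p * (m - 1)) + p) i" by (simp add: algebra_simps)
  then show ?case using a step2 by (simp add: alcove_chain_def)
qed simp

lemma alcove_chain_pos: "0 < p"
  using a by (simp add: alcove_chain_def)

lemma alcove_chain_window:
  assumes "j \<le> s" "s \<le> j + p"
  shows "a j i \<le> a s i" "a s i \<le> a j i + 1"
  using alcove_chain_le[OF assms(1), of i] alcove_chain_le[OF assms(2), of i]
    alcove_chain_period[of j 1 i] by simp_all

lemma alcove_chain_shift_eq_iff: "(\<exists>c. \<forall>i. a t i = a s i + c) \<longleftrightarrow> p dvd t - s"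
proof
  assume "\<exists>c. \<forall>i. a t i = a s i + c"
  then obtain c where "\<forall>i. a t i = a s i + c" by auto
  then have "a t = a (s + p * c)" by (auto simp: alcove_chain_period)
  then have "t = s + p * c"
    using alcove_chain_strict[of t "s + p * c"] alcove_chain_strict[of "s + p * c" t]
    by (metis less_irrefl linorder_neqE)
  then show "p dvd t - s" by simp
next
  assume "p dvd t - s"
  then obtain m where "t - s = p * m" by auto
  then have "t = s + p * m" by simp
  then show "\<exists>c. \<forall>i. a t i = a s i + c" by (auto simp: alcove_chain_period)
qed

lemma alcove_chain_rep:
  obtains t where "j \<le> t" "t < j + p" "p dvd t - s"
proof -
  have "(j + (s - j) mod p) - s = p * (- ((s - j) div p))"
    using mult_div_mod_eq[of p "s - j"] by linarith
  then have "p dvd (j + (s - j) mod p) - s" by (rule dvdI)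
  then show ?thesis using that[of "j + (s - j) mod p"] alcove_chain_pos by simp
qed

lemma alcove_chain_step_up: "\<exists>z. a (j + 1) z = a j z + 1"
proof -
  have "a j < a (j + 1)" by (rule alcove_chain_strict) simp
  then obtain z where "a j z < a (j + 1) z"
    by (auto simp: less_fun_def le_fun_def not_le)
  moreover have "a (j + 1) z \<le> a j z + 1"
    using alcove_chain_window(2)[of j "j + 1" z] alcove_chain_pos by auto
  ultimately show ?thesis by (intro exI[of _ z]) simp
qed

end

definition oscillation :: "('n::finite \<Rightarrow> real) \<Rightarrow> real" where
  "oscillation f = Max (range (\<lambda>(y, z). f y - f z))"

lemma oscillation_shift: "oscillation (\<lambda>i. f i + c) = oscillation f"
  by (simp add: oscillation_def)

lemma oscillation_ge: "f y - f z \<le> oscillation f"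
  unfolding oscillation_def by (rule Max_ge) (auto intro!: rev_image_eqI[of "(y, z)"])

lemma oscillation_le: "(\<And>y z. f y - f z \<le> r) \<Longrightarrow> oscillation f \<le> r"
  unfolding oscillation_def by (subst Max_le_iff) auto

context nonarch_local_field
begin

abbreviation chain_facet :: "('n::finite \<Rightarrow> 'a ^ 'n) \<Rightarrow> (int \<Rightarrow> 'n \<Rightarrow> int) \<Rightarrow> ('a, 'n) facet" where
  "chain_facet b a \<equiv> range (\<lambda>j. apartment_vertex b (a j))"

lemma chain_vertex_eq_iff:
  assumes b: "indexed_basis b" and a: "alcove_chain p a"
  shows "apartment_vertex b (a s) = apartment_vertex b (a t) \<longleftrightarrow> p dvd t - s"
  unfolding apartment_vertex_eq_iff[OF b] by (rule alcove_chain_shift_eq_iff[OF a])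

lemma chain_facetE:
  assumes b: "indexed_basis b" and a: "alcove_chain p a" and v: "v \<in> chain_facet b a"
  obtains s where "j \<le> s" "s < j + p" "v = apartment_vertex b (a s)"
proof -
  obtain t where t: "v = apartment_vertex b (a t)" using v by auto
  obtain s where "j \<le> s" "s < j + p" "p dvd s - t" by (rule alcove_chain_rep[OF a])
  then show ?thesis using that t chain_vertex_eq_iff[OF b a] by auto
qed

lemma facet_subset:
  assumes C: "facet k C" and S: "S \<subseteq> C" "S \<noteq> {}"
  shows "\<exists>l. facet l S"
proof -
  obtain Ls where ch: "lattice_chain Ls" and CLs: "C = homothety_class ` set Ls"
    using C by (auto simp: facet_def)
  define Ms where "Ms = filter (\<lambda>L. homothety_class L \<in> S) Ls"
  have SMs: "S = homothety_class ` set Ms" using S CLs by (auto simp: Ms_def)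
  then have ne: "Ms \<noteq> []" using S by auto
  have sub: "set Ms \<subseteq> set Ls" by (auto simp: Ms_def)
  have "lattice_chain Ms"
    unfolding lattice_chain_def
  proof (intro conjI)
    show "sorted_wrt (\<supset>) Ms"
      using ch unfolding Ms_def lattice_chain_def by (auto intro: sorted_wrt_filter)
    show "scale \<pi> (hd Ms) \<subset> last Ms"
      by (rule lattice_chain_bounds[OF ch subsetD[OF sub hd_in_set[OF ne]] subsetD[OF sub last_in_set[OF ne]]])
    show "\<forall>L\<in>set Ms. lattice L" using sub ch by (auto simp: lattice_chain_def)
  qed (rule ne)
  then have "facet (length Ms - 1) S"
    unfolding facet_def using SMs ne by (intro exI[of _ Ms]) simp
  then show ?thesis by (rule exI)
qed

lemma facet_imp_chain_facet:
  assumes b: "indexed_basis b" and C: "facet k C" and sub: "C \<subseteq> apartment_vertices b"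
  obtains a where "alcove_chain (int k + 1) a" "C = chain_facet b a"
proof -
  obtain Ls where len: "length Ls = k + 1" and ch: "lattice_chain Ls"
    and CLs: "C = homothety_class ` set Ls"
    using C by (auto simp: facet_def)
  have "\<exists>e. Ls ! j = apartment_lattice b e" if "j < k + 1" for j
  proof -
    have "homothety_class (Ls ! j) \<in> apartment_vertices b" using sub CLs that len by auto
    then obtain e where "homothety_class (Ls ! j) = apartment_vertex b e"
      by (auto simp: apartment_vertices_def)
    from homothety_class_eq_apartment_vertexD[OF b this] show ?thesis by auto
  qed
  then obtain e where e: "\<And>j. j < k + 1 \<Longrightarrow> Ls ! j = apartment_lattice b (e j)" by metis
  define p where "p = int k + 1"
  have p: "0 < p" by (simp add: p_def)
  \<comment> \<open>Each full turn of the index multiplies the lattices by \<pi>. The strict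
    inclusion of \<open>scale \<pi>\<close> of the first lattice in the last one,
    \<open>wrap\<close> below, closes the cycle.\<close>
  define a where "a j i = e (nat (j mod p)) i + j div p" for j i
  have less: "e j < e (Suc j)" if "Suc j < k + 1" for j
  proof -
    have "sorted_wrt (\<supset>) Ls" using ch by (simp add: lattice_chain_def)
    then have "Ls ! Suc j \<subset> Ls ! j"
      using that len sorted_wrt_nth_less[of "(\<supset>)" Ls j "Suc j"] by simp
    then show ?thesis using that e by (simp add: apartment_lattice_psubset_iff[OF b])
  qed
  have wrap: "e k < (\<lambda>i. e 0 i + 1)"
  proof -
    have "scale \<pi> (Ls ! 0) \<subset> Ls ! k"
      using lattice_chain_bounds[OF ch, of "Ls ! 0" "Ls ! k"] len by auto
    then show ?thesis
      using e[of 0] e[of k] by (simp add: scale_apartment_lattice[OF b] apartment_lattice_psubset_iff[OF b])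
  qed
  have add: "f < g \<Longrightarrow> (\<lambda>i. f i + c) < (\<lambda>i. g i + c)" for f g :: "'b \<Rightarrow> int" and c :: int
    by (auto simp: less_fun_def le_fun_def)
  have "a j < a (j + 1)" for j
  proof (cases "j mod p + 1 < p")
    case True
    have jm: "0 \<le> j mod p" using p by simp
    have "j + 1 = j div p * p + (j mod p + 1)" by simp
    then have "(j + 1) div p = j div p \<and> (j + 1) mod p = j mod p + 1"
      using True jm by (metis int_div_pos_eq int_mod_pos_eq add_nonneg_nonneg mult.commute zero_le_one)
    then have 1: "(j + 1) div p = j div p" "(j + 1) mod p = j mod p + 1" by auto
    have "nat (j mod p + 1) = Suc (nat (j mod p))" using jm by simp
    moreover have "j mod p < int k" using True unfolding p_def by linarith
    then have "Suc (nat (j mod p)) < k + 1" using jm by (simp add: nat_less_iff)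
    ultimately show ?thesis
      using add[OF less, of "nat (j mod p)" "j div p"] unfolding a_def 1 by simp
  next
    case False
    then have jm: "j mod p = p - 1" using pos_mod_bound[OF p, of j] by simp
    have "j + 1 = (j div p + 1) * p" using div_mult_mod_eq[of j p] jm by (simp add: algebra_simps)
    then have 1: "(j + 1) div p = j div p + 1" "(j + 1) mod p = 0" using p by auto
    have pk: "nat (p - 1) = k" by (simp add: p_def)
    show ?thesis
      using add[OF wrap, of "j div p"] pk unfolding a_def 1 jm by (simp add: algebra_simps)
  qed
  moreover have "a (j + p) i = a j i + 1" for j i
    using p by (simp add: a_def)
  ultimately have "alcove_chain p a" using p by (simp add: alcove_chain_def)
  moreover have "C = chain_facet b a"
  proof -
    have V: "apartment_vertex b (a j) = homothety_class (Ls ! nat (j mod p))" for j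
    proof -
      have "nat (j mod p) < k + 1" using pos_mod_bound[OF p, of j] by (simp add: p_def)
      then have "Ls ! nat (j mod p) = apartment_lattice b (e (nat (j mod p)))" by (rule e)
      then show ?thesis
        by (simp only: apartment_vertex_eq_iff[OF b]) (rule exI[of _ "- (j div p)"], simp add: a_def)
    qed
    have "homothety_class L \<in> chain_facet b a" if "L \<in> set Ls" for L
    proof -
      obtain j where "j < length Ls" "L = Ls ! j" using \<open>L \<in> set Ls\<close> by (metis in_set_conv_nth)
      then have "homothety_class L = apartment_vertex b (a (int j))"
        using len by (simp add: V p_def)
      then show ?thesis by (rule range_eqI)
    qed
    moreover have "apartment_vertex b (a j) \<in> C" for j
    proof -
      have "nat (j mod p) < length Ls" using pos_mod_bound[OF p, of j] len by (simp add: p_def)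
      then show ?thesis unfolding V CLs by simp
    qed
    ultimately show ?thesis using CLs by auto
  qed
  ultimately show ?thesis using that unfolding p_def by blast
qed

lemma lattice_chain_alcove_chain:
  assumes b: "indexed_basis b" and a: "alcove_chain (int k + 1) a"
  shows "lattice_chain (map (\<lambda>j. apartment_lattice b (a (i + int j))) [0..<k + 1])"
    and "homothety_class ` set (map (\<lambda>j. apartment_lattice b (a (i + int j))) [0..<k + 1]) = chain_facet b a"
proof -
  let ?Ls = "map (\<lambda>j. apartment_lattice b (a (i + int j))) [0..<k + 1]"
  have "scale \<pi> (apartment_lattice b (a i)) = apartment_lattice b (a (i + (int k + 1)))"
    using alcove_chain_period[OF a, of i 1] by (simp add: scale_apartment_lattice[OF b]) metis
  then have "scale \<pi> (apartment_lattice b (a i)) \<subset> apartment_lattice b (a (i + int k))"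
    using alcove_chain_strict[OF a, of "i + int k" "i + (int k + 1)"]
    by (simp add: apartment_lattice_psubset_iff[OF b])
  moreover have "hd ?Ls = apartment_lattice b (a i)" by (simp add: hd_map del: upt_Suc)
  moreover have "last ?Ls = apartment_lattice b (a (i + int k))" by simp
  ultimately have "scale \<pi> (hd ?Ls) \<subset> last ?Ls" by simp
  moreover have "sorted_wrt (\<supset>) ?Ls"
    using alcove_chain_strict[OF a]
    by (auto simp: sorted_wrt_iff_nth_less apartment_lattice_psubset_iff[OF b] simp del: upt_Suc)
  ultimately show "lattice_chain ?Ls"
    using b by (auto simp: lattice_chain_def lattice_apartment_lattice)
  show "homothety_class ` set ?Ls = chain_facet b a"
  proof (intro subset_antisym subsetI)
    fix v assume "v \<in> chain_facet b a"
    then obtain s where s: "i \<le> s" "s < i + (int k + 1)" "v = apartment_vertex b (a s)"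
      by (rule chain_facetE[OF b a])
    then have n: "i + int (nat (s - i)) = s" "nat (s - i) \<in> {0..<k + 1}" by auto
    have "apartment_lattice b (a s) \<in> set ?Ls"
      using imageI[OF n(2), of "\<lambda>j. apartment_lattice b (a (i + int j))"] n(1)
      by (simp del: upt_Suc)
    then show "v \<in> homothety_class ` set ?Ls" unfolding s(3) by (rule imageI)
  qed (auto simp del: upt_Suc)
qed

lemma facet_chain_facet:
  assumes "indexed_basis b" "alcove_chain (int k + 1) a"
  shows "facet k (chain_facet b a)"
  unfolding facet_def
  using lattice_chain_alcove_chain[OF assms, of 0]
  by (intro exI[of _ "map (\<lambda>j. apartment_lattice b (a (0 + int j))) [0..<k + 1]"])
    (simp del: upt_Suc)

lemma position_diff:
  assumes b: "indexed_basis b" and C: "facet k C" and x: "x \<in> closed_simplex C"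
  shows "position b x $ y - position b x $ z =
    (\<Sum>v\<in>C. x v * real_of_int (exponent b v y - exponent b v z))"
proof -
  have "position b x $ y = (\<Sum>v\<in>C. x v * real_of_int (exponent b v y))" for y
    unfolding position_def
    using closed_simplexD(1)[OF x C] facet_finite[OF C]
    by (simp add: sum_component) (rule sum.mono_neutral_left, auto)
  then show ?thesis by (simp add: sum_subtractf right_diff_distrib)
qed

lemma exponent_diff:
  "indexed_basis b \<Longrightarrow>
    exponent b (apartment_vertex b a) y - exponent b (apartment_vertex b a) z = a y - a z"
  by (rule exponent_apartment_vertex[of b a]) simp_all

context
  fixes b :: "'n::finite \<Rightarrow> 'a ^ 'n" and a :: "int \<Rightarrow> 'n \<Rightarrow> int" and k :: nat and x :: "('a, 'n) point"
  assumes b: "indexed_basis b" and a: "alcove_chain (int k + 1) a"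
    and x: "x \<in> closed_simplex (chain_facet b a)"
begin

lemma position_diff_chain:
  assumes ge: "\<And>s. j \<le> s \<Longrightarrow> s < j + (int k + 1) \<Longrightarrow>
    g s = real_of_int (a s y - a s z) \<and> (s \<noteq> j \<longrightarrow> g s = c)"
  shows "position b x $ y - position b x $ z = c + (g j - c) * x (apartment_vertex b (a j))"
proof -
  note C = facet_chain_facet[OF b a]
  let ?vj = "apartment_vertex b (a j)"
  have "position b x $ y - position b x $ z =
      (\<Sum>v\<in>chain_facet b a. x v * real_of_int (exponent b v y - exponent b v z))"
    by (rule position_diff[OF b C x])
  also have "\<dots> = (\<Sum>v\<in>chain_facet b a. c * x v + (if v = ?vj then (g j - c) * x v else 0))"
  proof (rule sum.cong)
    fix v assume "v \<in> chain_facet b a"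
    then obtain s where s: "j \<le> s" "s < j + (int k + 1)" "v = apartment_vertex b (a s)"
      by (rule chain_facetE[OF b a])
    have gs: "real_of_int (exponent b v y - exponent b v z) = g s"
      using ge[OF s(1,2)] by (simp only: s(3) exponent_diff[OF b])
    show "x v * real_of_int (exponent b v y - exponent b v z) =
        c * x v + (if v = ?vj then (g j - c) * x v else 0)"
    proof (cases "s = j")
      case False
      have "v \<noteq> ?vj"
      proof
        assume "v = ?vj"
        then have "int k + 1 dvd s - j" using s(3) chain_vertex_eq_iff[OF b a] by metis
        with s False show False by (auto dest: zdvd_imp_le)
      qed
      with ge[OF s(1,2)] False show ?thesis unfolding gs by simp
    qed (use gs s(3) in \<open>simp add: algebra_simps\<close>)
  qed simp
  also have "\<dots> = c * (\<Sum>v\<in>chain_facet b a. x v) + (g j - c) * x ?vj"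
    using facet_finite[OF C] by (simp add: sum.distrib sum_distrib_left)
  also have "(\<Sum>v\<in>chain_facet b a. x v) = 1" using x by (simp add: closed_simplex_def)
  finally show ?thesis by simp
qed

text \<open>At \<open>y\<close> the chain jumps just before \<open>j\<close>, at \<open>z\<close>
  just after it. The difference of these two exponents is therefore one less at all other vertices
  than at the \<open>j\<close>-th one, and the position isolates its weight.\<close>

lemma weight_eq:
  assumes y: "a j y = a (j - 1) y + 1" and z: "a (j + 1) z = a j z + 1"
  shows "x (apartment_vertex b (a j)) =
    1 + (position b x $ y - position b x $ z) - real_of_int (a j y - a j z)"
proof -
  have "position b x $ y - position b x $ z = real_of_int (a j y - a j z) - 1 +
    (real_of_int (a j y - a j z) - (real_of_int (a j y - a j z) - 1)) * x (apartment_vertex b (a j))"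
  proof (rule position_diff_chain[where g = "\<lambda>s. real_of_int (a s y - a s z)"], intro conjI impI)
    fix s assume s: "j \<le> s" "s < j + (int k + 1)" "s \<noteq> j"
    have "a s y = a j y"
      using y s alcove_chain_window[OF a, of j s y] alcove_chain_window(2)[OF a, of "j - 1" s y] by auto
    moreover have "a s z = a j z + 1"
      using z s alcove_chain_window(2)[OF a, of j s z] alcove_chain_le[OF a, of "j + 1" s z] by auto
    ultimately show "real_of_int (a s y - a s z) = real_of_int (a j y - a j z) - 1" by simp
  qed simp
  then show ?thesis by simp
qed

lemma position_oscillation_le:
  "(position b x $ y - real_of_int (a j y)) - (position b x $ z - real_of_int (a j z)) \<le>
    1 - x (apartment_vertex b (a j))"
proof -
  note C = facet_chain_facet[OF b a]
  let ?vj = "apartment_vertex b (a j)" and ?d = "real_of_int (a j y - a j z)"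
  have "position b x $ y - position b x $ z =
      (\<Sum>v\<in>chain_facet b a. x v * real_of_int (exponent b v y - exponent b v z))"
    by (rule position_diff[OF b C x])
  also have "\<dots> \<le> (\<Sum>v\<in>chain_facet b a. (?d + 1) * x v - (if v = ?vj then x v else 0))"
  proof (rule sum_mono)
    fix v assume "v \<in> chain_facet b a"
    then obtain s where s: "j \<le> s" "s < j + (int k + 1)" "v = apartment_vertex b (a s)"
      by (rule chain_facetE[OF b a])
    have e: "exponent b v y - exponent b v z = a s y - a s z" by (simp only: s(3) exponent_diff[OF b])
    have pos: "0 \<le> x v" using closed_simplexD(3)[OF x C] .
    show "x v * real_of_int (exponent b v y - exponent b v z) \<le>
        (?d + 1) * x v - (if v = ?vj then x v else 0)"
    proof (cases "v = ?vj")
      case True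
      then have e': "exponent b v y - exponent b v z = a j y - a j z" by (simp only: exponent_diff[OF b])
      show ?thesis unfolding e' using True by (simp add: algebra_simps)
    next
      case False
      have "a s y - a s z \<le> a j y - a j z + 1"
        using alcove_chain_window[OF a, of j s y] alcove_chain_window[OF a, of j s z] s by auto
      then have "real_of_int (a s y - a s z) \<le> ?d + 1" by linarith
      then show ?thesis using pos False unfolding e by (simp add: mult_right_mono mult.commute[of "x v"])
    qed
  qed
  also have "\<dots> = (?d + 1) * (\<Sum>v\<in>chain_facet b a. x v) - x ?vj"
    using facet_finite[OF C] by (simp add: sum_subtractf sum_distrib_left)
  also have "(\<Sum>v\<in>chain_facet b a. x v) = 1" using x by (simp add: closed_simplex_def)
  finally show ?thesis by simp
qed

text \<open>Take the last member \<open>a j\<close> that is pointwise below \<alpha>. Since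
  \<open>a (j + 1)\<close> is no longer below, some \<open>y\<close> has
  \<open>\<alpha> y = a j y\<close> and a jump after \<open>j\<close>; since \<alpha> differs from
  \<open>a j\<close>, some \<open>z\<close> has \<open>a j z + 1 \<le> \<alpha> z\<close>.\<close>

lemma position_oscillation_ge:
  assumes nv: "apartment_vertex b \<alpha> \<notin> chain_facet b a"
  shows "\<exists>y z. 1 \<le> (position b x $ y - real_of_int (\<alpha> y)) - (position b x $ z - real_of_int (\<alpha> z))"
proof -
  note C = facet_chain_facet[OF b a]
  let ?p = "int k + 1"
  \<comment> \<open>These extremes confine the candidates for \<open>j\<close> to a finite interval,
    in which a last one exists.\<close>
  define m where "m = Min (range (\<lambda>i. \<alpha> i - a 0 i))"
  define m' where "m' = Max (range (\<lambda>i. \<alpha> i - a 0 i))"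
  let ?P = "\<lambda>j. \<forall>i. a j i \<le> \<alpha> i"
  have "m \<le> \<alpha> i - a 0 i" for i unfolding m_def by (rule Min_le) auto
  then have Pm: "?P (?p * m)"
    using alcove_chain_period[OF a, of 0 m] by (simp add: add.commute le_diff_eq)
  have bound: "j \<le> ?p * (m' + 1)" if "?P j" for j
  proof (rule ccontr)
    assume "\<not> j \<le> ?p * (m' + 1)"
    then have "a (?p * (m' + 1)) i \<le> a j i" for i by (intro alcove_chain_le[OF a]) simp
    then have "a 0 i + (m' + 1) \<le> \<alpha> i" for i
      using alcove_chain_period[OF a, of 0 "m' + 1" i] that by (metis add_0 order_trans)
    from this[of undefined] have "m' < \<alpha> undefined - a 0 undefined" by simp
    moreover have "\<alpha> undefined - a 0 undefined \<le> m'" unfolding m'_def by (rule Max_ge) auto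
    ultimately show False by simp
  qed
  define J where "J = {j \<in> {?p * m..?p * (m' + 1)}. ?P j}"
  define j where "j = Max J"
  have fin: "finite J"
    unfolding J_def by (rule finite_subset[of _ "{?p * m..?p * (m' + 1)}"]) auto
  have "?p * m \<in> J" unfolding J_def using Pm bound[OF Pm] by simp
  then have jJ: "j \<in> J" unfolding j_def using fin by (intro Max_in) auto
  then have Pj: "?P j" and mj: "?p * m \<le> j" by (simp_all add: J_def)
  have "\<not> ?P (j + 1)"
  proof
    assume P1: "?P (j + 1)"
    then have "j + 1 \<in> J" unfolding J_def using bound[OF P1] mj by simp
    then have "j + 1 \<le> j" unfolding j_def using fin by (intro Max_ge)
    then show False by simp
  qed
  then obtain y where "\<alpha> y < a (j + 1) y" by (auto simp: not_le)
  moreover have "a j y \<le> \<alpha> y" using Pj by simp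
  moreover have "a (j + 1) y \<le> a j y + 1" by (rule alcove_chain_window(2)[OF a]) auto
  ultimately have y: "\<alpha> y = a j y" "a (j + 1) y = a j y + 1" by linarith+
  have "\<alpha> \<noteq> a j" using nv by auto
  then obtain z where "\<alpha> z \<noteq> a j z" by auto
  moreover have "a j z \<le> \<alpha> z" using Pj by simp
  ultimately have z: "a j z + 1 \<le> \<alpha> z" by linarith
  have "real_of_int (a j y - a j z) \<le> position b x $ y - position b x $ z"
  proof -
    have "real_of_int (a j y - a j z) = real_of_int (a j y - a j z) * (\<Sum>v\<in>chain_facet b a. x v)"
      using x by (simp add: closed_simplex_def)
    also have "\<dots> = (\<Sum>v\<in>chain_facet b a. x v * real_of_int (a j y - a j z))"
      by (simp add: sum_distrib_left mult.commute)
    also have "\<dots> \<le> (\<Sum>v\<in>chain_facet b a. x v * real_of_int (exponent b v y - exponent b v z))"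
    proof (rule sum_mono, rule mult_left_mono)
      fix v assume "v \<in> chain_facet b a"
      then obtain s where s: "j \<le> s" "s < j + (int k + 1)" "v = apartment_vertex b (a s)"
        by (rule chain_facetE[OF b a])
      have "a j y - a j z \<le> a s y - a s z"
      proof (cases "s = j")
        case False
        with s have "j + 1 \<le> s" by simp
        with y alcove_chain_le[OF a this, of y] alcove_chain_window(2)[OF a, of j s z] s show ?thesis by auto
      qed simp
      then show "real_of_int (a j y - a j z) \<le> real_of_int (exponent b v y - exponent b v z)"
        by (simp only: s(3) exponent_diff[OF b] of_int_le_iff)
    qed (rule closed_simplexD(3)[OF x C])
    finally show ?thesis by (simp only: position_diff[OF b C x])
  qed
  with y z have "1 \<le> (position b x $ y - real_of_int (\<alpha> y)) - (position b x $ z - real_of_int (\<alpha> z))"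
    by linarith
  then show ?thesis by blast
qed

end

text \<open>One formula for all vertices, whatever simplex carries the point: the weights are
  determined by the position modulo the diagonal, which makes charts injective.\<close>

lemma weight_eq_oscillation:
  assumes b: "indexed_basis b" and x: "x \<in> apartment b"
  shows "x (apartment_vertex b \<alpha>) = max 0 (1 - oscillation (\<lambda>i. position b x $ i - real_of_int (\<alpha> i)))"
proof -
  obtain k C where C: "facet k C" "x \<in> closed_simplex C" "\<And>v. x v \<noteq> 0 \<Longrightarrow> v \<in> apartment_vertices b"
    using apartmentE[OF x] by metis
  let ?S = "{v. x v \<noteq> 0}"
  have "?S \<noteq> {}" using closed_simplexD(4)[OF C(2,1)] by (metis sum.empty zero_neq_one)
  then obtain l where l: "facet l ?S" using facet_subset[OF C(1) closed_simplexD(1)[OF C(2,1)]] by auto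
  have "?S \<subseteq> apartment_vertices b" using C(3) by auto
  from facet_imp_chain_facet[OF b l this] obtain a where a: "alcove_chain (int l + 1) a"
    and S: "?S = chain_facet b a" by blast
  have xS: "x \<in> closed_simplex (chain_facet b a)"
    using closed_simplexD(3,4)[OF C(2,1)] unfolding S[symmetric] by (auto simp: closed_simplex_def)
  let ?f = "\<lambda>i. position b x $ i - real_of_int (\<alpha> i)"
  show ?thesis
  proof (cases "apartment_vertex b \<alpha> \<in> chain_facet b a")
    case True
    then obtain j where j: "apartment_vertex b \<alpha> = apartment_vertex b (a j)" by auto
    then obtain c where c: "\<And>i. a j i = \<alpha> i + c" using apartment_vertex_eq_iff[OF b] by metis
    have "?f y - ?f z \<le> 1 - x (apartment_vertex b \<alpha>)" for y z
      using position_oscillation_le[OF b a xS, of y j z] unfolding j c by simp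
    then have 1: "oscillation ?f \<le> 1 - x (apartment_vertex b \<alpha>)" by (rule oscillation_le)
    obtain y where y: "a j y = a (j - 1) y + 1" using alcove_chain_step_up[OF a, of "j - 1"] by auto
    obtain z where z: "a (j + 1) z = a j z + 1" using alcove_chain_step_up[OF a, of j] by auto
    have "1 - x (apartment_vertex b \<alpha>) = ?f z - ?f y"
      using weight_eq[OF b a xS y z] c[of y] c[of z] unfolding j by simp
    with oscillation_ge[of ?f z y] 1 have "oscillation ?f = 1 - x (apartment_vertex b \<alpha>)" by simp
    then show ?thesis using closed_simplexD(3)[OF C(2,1), of "apartment_vertex b \<alpha>"] by simp
  next
    case False
    then have "x (apartment_vertex b \<alpha>) = 0" using S by auto
    moreover obtain y z where "1 \<le> ?f y - ?f z" using position_oscillation_ge[OF b a xS False] by auto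
    with oscillation_ge[of ?f y z] have "1 \<le> oscillation ?f" by linarith
    ultimately show ?thesis by simp
  qed
qed

lemma apartment_chart_inject:
  assumes b: "indexed_basis b" and x: "x \<in> apartment b" and y: "y \<in> apartment b"
    and eq: "apartment_chart b x = apartment_chart b y"
  shows "x = y"
proof
  fix v
  obtain c where c: "position b x = position b y + vec c"
    using eq unfolding apartment_chart_eq mod_diagonal_eq_iff by auto
  show "x v = y v"
  proof (cases "v \<in> apartment_vertices b")
    case True
    then obtain \<alpha> where v: "v = apartment_vertex b \<alpha>" by (auto simp: apartment_vertices_def)
    have "(\<lambda>i. (position b y + vec c) $ i - real_of_int (\<alpha> i)) =
        (\<lambda>i. (position b y $ i - real_of_int (\<alpha> i)) + c)"
      by (simp add: fun_eq_iff)
    then show ?thesis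
      unfolding v weight_eq_oscillation[OF b x] weight_eq_oscillation[OF b y] c
      by (simp only: oscillation_shift)
  next
    case False
    then have "x v = 0" "y v = 0" using x y unfolding apartment_def by blast+
    then show ?thesis by simp
  qed
qed

end

section \<open>Geodesics and convexity\<close>

text \<open>The two bounds add up to the distance of \<open>x\<close> and \<open>y\<close>, so the
  triangle inequality is an equality, and strict convexity of the Euclidean norm leaves a single
  point.\<close>

lemma convex_combination_dist_eq:
  fixes x y z :: "'a::real_inner"
  assumes "dist x z \<le> s * d" "dist z y \<le> (1 - s) * d" "dist x y = d" "0 \<le> s" "s \<le> 1"
  shows "z = (1 - s) *\<^sub>R x + s *\<^sub>R y"
proof -
  have "dist x y \<le> dist x z + dist z y" by (rule dist_triangle)
  with assms(1,2,3) have dz: "dist x z = s * d" "dist z y = (1 - s) * d"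
    by (auto simp: algebra_simps)
  then have "dist x y = dist x z + dist z y" using assms(3) by (simp add: algebra_simps)
  then have "norm (x - z) *\<^sub>R (z - y) = norm (z - y) *\<^sub>R (x - z)"
    by (simp only: dist_triangle_eq)
  then have eq: "d *\<^sub>R (s *\<^sub>R (z - y)) = d *\<^sub>R ((1 - s) *\<^sub>R (x - z))"
    using dz by (simp add: dist_norm mult.commute)
  show ?thesis
  proof (cases "d = 0")
    case True
    then show ?thesis using dz assms(3) by (simp add: algebra_simps)
  next
    case False
    with eq have "s *\<^sub>R (z - y) = (1 - s) *\<^sub>R (x - z)"
      unfolding scaleR_cancel_left by blast
    then show ?thesis by (simp add: algebra_simps)
  qed
qed

lemma strict_sorted_enumeration:
  fixes T :: "real set"
  assumes fin: "finite T" and T: "0 \<in> T" "1 \<in> T" "T \<subseteq> {0..1}"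
  obtains t :: "nat \<Rightarrow> real" and k where "t 0 = 0" "t (Suc k) = 1" "strict_mono_on {..Suc k} t" "t ` {..Suc k} = T"
proof -
  define ts where "ts = sorted_list_of_set T"
  have set: "set ts = T" and srt: "sorted ts" and dis: "distinct ts"
    using fin by (auto simp: ts_def)
  have less: "ts ! i < ts ! j" if "i < j" "j < length ts" for i j
    using srt dis that by (metis less_le nat_less_le nth_eq_iff_index_eq order_less_trans sorted_nth_mono)
  obtain i where i: "i < length ts" "ts ! i = 0" using T(1) set by (metis in_set_conv_nth)
  obtain j where j: "j < length ts" "ts ! j = 1" using T(2) set by (metis in_set_conv_nth)
  have range: "0 \<le> ts ! l \<and> ts ! l \<le> 1" if "l < length ts" for l
    using T(3) set that nth_mem[OF that] by auto
  have i0: "i = 0" using less[of 0 i] range[of 0] i by force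
  have jl: "j = length ts - 1" using less[of j "length ts - 1"] range[of "length ts - 1"] j by force
  have "j \<noteq> 0"
  proof
    assume "j = 0"
    with i i0 j show False by simp
  qed
  then obtain k where k: "j = Suc k" using not0_implies_Suc by blast
  then have len: "length ts = Suc (Suc k)" using jl j by simp
  show ?thesis
  proof (rule that[of "(!) ts" k])
    show "strict_mono_on {..Suc k} ((!) ts)"
      using less len by (auto intro!: strict_mono_onI)
    show "(!) ts ` {..Suc k} = T"
      unfolding set[symmetric] using len by (auto simp: set_conv_nth image_iff less_Suc_eq_le) 
  qed (use i i0 j k in auto)
qed

context nonarch_local_field
begin

section \<open>Charts of simplices and of whole apartments\<close>

lemma apartment_chart_sum:
  assumes x: "x \<in> closed_simplex C" and C: "finite C"
  shows "apartment_chart b x = (\<Sum>v\<in>C. x v *\<^sub>R vertex_coords b v)"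
  unfolding apartment_chart_def
  using x C by (intro sum.mono_neutral_left) (auto simp: closed_simplex_def)

lemma apartment_chart_closed_simplex:
  assumes C: "facet k C"
  shows "apartment_chart b ` closed_simplex C = convex hull (vertex_coords b ` C)"
proof (rule subset_antisym)
  note fin = facet_finite[OF C]
  show "apartment_chart b ` closed_simplex C \<subseteq> convex hull (vertex_coords b ` C)"
  proof
    fix q assume "q \<in> apartment_chart b ` closed_simplex C"
    then obtain x where x: "x \<in> closed_simplex C" "q = apartment_chart b x" by auto
    show "q \<in> convex hull (vertex_coords b ` C)"
      unfolding x(2) apartment_chart_sum[OF x(1) fin]
      using x(1) fin by (intro convex_sum) (auto simp: closed_simplex_def intro: hull_inc)
  qed
  show "convex hull (vertex_coords b ` C) \<subseteq> apartment_chart b ` closed_simplex C"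
  proof (rule hull_minimal)
    show "vertex_coords b ` C \<subseteq> apartment_chart b ` closed_simplex C"
    proof
      fix q assume "q \<in> vertex_coords b ` C"
      then obtain w where w: "w \<in> C" "q = vertex_coords b w" by auto
      let ?x = "\<lambda>v. if v = w then 1 else 0 :: real"
      have x: "?x \<in> closed_simplex C" using w fin by (auto simp: closed_simplex_def)
      have "apartment_chart b ?x = (\<Sum>v\<in>C. if v = w then vertex_coords b v else 0)"
        unfolding apartment_chart_sum[OF x fin] by (rule sum.cong) auto
      then have "q = apartment_chart b ?x" using w fin by simp
      then show "q \<in> apartment_chart b ` closed_simplex C" using x by (rule image_eqI)
    qed
    show "convex (apartment_chart b ` closed_simplex C)"
    proof (rule convexI)
      fix q q' :: "real^'b" and u w :: real
      assume "q \<in> apartment_chart b ` closed_simplex C" "q' \<in> apartment_chart b ` closed_simplex C"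
        and uw: "0 \<le> u" "0 \<le> w" "u + w = 1"
      then obtain x y where x: "x \<in> closed_simplex C" "q = apartment_chart b x"
        and y: "y \<in> closed_simplex C" "q' = apartment_chart b y" by auto
      let ?z = "\<lambda>v. u * x v + w * y v"
      have z: "?z \<in> closed_simplex C"
        using x(1) y(1) uw by (auto simp: closed_simplex_def sum.distrib sum_distrib_left[symmetric])
      have "u *\<^sub>R q + w *\<^sub>R q' = apartment_chart b ?z"
        unfolding x(2) y(2) apartment_chart_sum[OF x(1) fin] apartment_chart_sum[OF y(1) fin]
          apartment_chart_sum[OF z fin]
        by (simp add: scaleR_sum_right scaleR_add_left sum.distrib)
      then show "u *\<^sub>R q + w *\<^sub>R q' \<in> apartment_chart b ` closed_simplex C"
        using z by (rule image_eqI)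
    qed
  qed
qed

text \<open>
  A point of the chart is written as an integral vector plus its fractional part, and the latter
  is decomposed into its superlevel sets.
\<close>

lemma apartment_chart_surj:
  fixes b :: "'n::finite \<Rightarrow> 'a ^ 'n"
  assumes b: "indexed_basis b"
  shows "\<exists>x\<in>apartment b. apartment_chart b x = mod_diagonal q"
proof -
  define i0 :: 'n where "i0 = undefined"
  \<comment> \<open>Normalised to vanish at \<open>i0\<close>: the fractional part there is 0, which
    makes the last inclusion of the chain strict at \<open>i0\<close>.\<close>
  define q' where "q' = q - vec (q $ i0)"
  define fl where "fl i = \<lfloor>q' $ i\<rfloor>" for i
  define h where "h i = q' $ i - real_of_int (fl i)" for i
  have h: "0 \<le> h i" "h i < 1" for i unfolding h_def fl_def by linarith+
  have h0: "h i0 = 0" by (simp add: h_def fl_def q'_def)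
  have zero: "0 \<in> insert 1 (range h)" using h0 by (metis insertI2 rangeI)
  have "0 \<le> h i \<and> h i \<le> 1" for i using h[of i] by simp
  then have sub: "insert 1 (range h) \<subseteq> {0..1}" by auto
  obtain t :: "nat \<Rightarrow> real" and k where t0: "t 0 = 0" and t1: "t (Suc k) = 1"
    and mono: "strict_mono_on {..Suc k} t" and im: "t ` {..Suc k} = insert 1 (range h)"
    using strict_sorted_enumeration[OF _ zero _ sub] by auto
  have tless: "t l < t l' \<longleftrightarrow> l < l'" if "l \<le> Suc k" "l' \<le> Suc k" for l l'
    using strict_mono_on_less[OF mono] that by auto
  define e where "e l i = fl i + (if t l \<le> h i then 1 else 0)" for l i
  have e_less: "e l' < e l" if "l < l'" "l' \<le> Suc k" "0 < l" for l l'
  proof -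
    have tl: "t l < t l'" using that by (simp add: tless)
    have "t l \<in> insert 1 (range h)" using that unfolding im[symmetric] by auto
    moreover have "t l < 1" using tless[of l "Suc k"] t1 that by simp
    ultimately obtain i where i: "t l = h i" by auto
    have "e l' \<le> e l" using tl by (auto simp: e_def le_fun_def)
    moreover have "e l' i < e l i" using tl i by (simp add: e_def)
    ultimately show ?thesis by (auto simp: less_fun_def le_fun_def not_le)
  qed
  \<comment> \<open>Low levels give large exponents, hence small lattices; the list is reversed to
    descend.\<close>
  define Ls where "Ls = map (\<lambda>l. apartment_lattice b (e l)) (rev [1..<Suc (Suc k)])"
  have "sorted_wrt (\<lambda>x y. y \<supset> x) (map (\<lambda>l. apartment_lattice b (e l)) [1..<Suc (Suc k)])"
    using e_less by (auto simp: sorted_wrt_iff_nth_less apartment_lattice_psubset_iff[OF b] simp del: upt_Suc)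
  then have srt: "sorted_wrt (\<supset>) Ls"
    unfolding Ls_def rev_map[symmetric] sorted_wrt_rev .
  have "lattice_chain Ls"
    unfolding lattice_chain_def
  proof (intro conjI srt)
    have hd: "hd Ls = apartment_lattice b (e (Suc k))" by (simp add: Ls_def)
    have last: "last Ls = apartment_lattice b (e 1)" by (simp add: Ls_def last_map last_rev hd_map del: upt_Suc) 
    have "e 1 < (\<lambda>i. e (Suc k) i + 1)"
    proof -
      have "h i < t (Suc k)" for i using h t1 by simp
      then have "e 1 \<le> (\<lambda>i. e (Suc k) i + 1)" by (auto simp: e_def le_fun_def not_le)
      moreover have "e 1 i0 < e (Suc k) i0 + 1"
        using h0 tless[of 0 1] t0 by (simp add: e_def)
      ultimately show ?thesis by (auto simp: less_fun_def le_fun_def not_le)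
    qed
    then show "scale \<pi> (hd Ls) \<subset> last Ls"
      unfolding hd last by (simp add: scale_apartment_lattice[OF b] apartment_lattice_psubset_iff[OF b])
  qed (auto simp: Ls_def b lattice_apartment_lattice)
  moreover have "length Ls = k + 1" by (simp add: Ls_def)
  ultimately have C: "facet k (homothety_class ` set Ls)" by (auto simp: facet_def)
  define C where "C = homothety_class ` set Ls"
  define V where "V l = apartment_vertex b (e l)" for l
  have CV: "C = V ` {1..Suc k}" by (auto simp: C_def Ls_def V_def simp del: upt_Suc)
  \<comment> \<open>Layer cake weights: the fractional part is the sum of the indicator functions of
    its superlevel sets with weights \<open>t l - t (l - 1)\<close>.\<close>
  define x where "x v = (\<Sum>l\<in>{1..Suc k}. if v = V l then t l - t (l - 1) else 0)" for v
  have finC: "finite C" by (simp add: CV)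
  have sumC: "(\<Sum>v\<in>C. \<Sum>l\<in>{1..Suc k}. if v = V l then g l v else 0) = (\<Sum>l\<in>{1..Suc k}. g l (V l))"
    for g :: "nat \<Rightarrow> ('a, 'n) vertex \<Rightarrow> 'c::comm_monoid_add"
  proof -
    have "(\<Sum>v\<in>C. \<Sum>l\<in>{1..Suc k}. if v = V l then g l v else 0) =
        (\<Sum>l\<in>{1..Suc k}. \<Sum>v\<in>C. if v = V l then g l v else 0)"
      by (rule sum.swap)
    also have "\<dots> = (\<Sum>l\<in>{1..Suc k}. g l (V l))"
      using finC by (intro sum.cong) (auto simp: CV)
    finally show ?thesis .
  qed
  have tel: "(\<Sum>l\<in>{1..m}. t l - t (l - 1)) = t m" for m
    by (induction m) (auto simp: t0)
  have xC: "x \<in> closed_simplex C"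
    unfolding closed_simplex_def
  proof (intro CollectI conjI allI impI)
    fix v show "0 \<le> x v"
      unfolding x_def by (rule sum_nonneg) (auto intro!: less_imp_le simp: tless)
  next
    fix v assume "v \<notin> C" then show "x v = 0" unfolding x_def CV by (intro sum.neutral) auto
  next
    show "sum x C = 1" unfolding x_def sumC[of "\<lambda>l v. t l - t (l - 1)"] tel by (rule t1)
  qed
  have "apartment_chart b x = (\<Sum>v\<in>C. x v *\<^sub>R vertex_coords b v)"
    by (rule apartment_chart_sum[OF xC finC])
  also have "\<dots> = (\<Sum>v\<in>C. \<Sum>l\<in>{1..Suc k}. if v = V l then (t l - t (l - 1)) *\<^sub>R vertex_coords b v else 0)"
    unfolding x_def scaleR_sum_left by (intro sum.cong) auto
  also have "\<dots> = (\<Sum>l\<in>{1..Suc k}. (t l - t (l - 1)) *\<^sub>R vertex_coords b (V l))"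
    by (rule sumC)
  also have "\<dots> = mod_diagonal (\<Sum>l\<in>{1..Suc k}. (t l - t (l - 1)) *\<^sub>R (\<chi> i. real_of_int (e l i)))"
    by (simp add: V_def vertex_coords_apartment_vertex[OF b] linear_sum[OF linear_mod_diagonal] mod_diagonal_scaleR del: sum.cl_ivl_Suc)
  also have "(\<Sum>l\<in>{1..Suc k}. (t l - t (l - 1)) *\<^sub>R (\<chi> i. real_of_int (e l i))) = q'"
    unfolding vec_eq_iff
  proof
    fix i
    have "h i \<in> t ` {..Suc k}" unfolding im by simp
    then obtain m where m: "h i = t m" "m \<le> Suc k" by auto
    have le: "t l \<le> h i \<longleftrightarrow> l \<le> m" if "l \<le> Suc k" for l
      using tless[of m l] m that by (auto simp: not_less[symmetric])
    have "(\<Sum>l\<in>{1..Suc k}. (t l - t (l - 1)) *\<^sub>R (\<chi> i. real_of_int (e l i))) $ i =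
        (\<Sum>l\<in>{1..Suc k}. (t l - t (l - 1)) * real_of_int (fl i) + (if l \<le> m then t l - t (l - 1) else 0))"
      unfolding sum_component by (intro sum.cong) (auto simp: e_def le algebra_simps)
    also have "\<dots> = (\<Sum>l\<in>{1..Suc k}. t l - t (l - 1)) * real_of_int (fl i) +
        (\<Sum>l\<in>{1..Suc k}. if l \<le> m then t l - t (l - 1) else 0)"
      by (simp only: sum.distrib sum_distrib_right)
    also have "(\<Sum>l\<in>{1..Suc k}. if l \<le> m then t l - t (l - 1) else 0) = (\<Sum>l\<in>{1..m}. t l - t (l - 1))"
      using m(2) by (intro sum.mono_neutral_cong_right) auto
    also have "(\<Sum>l\<in>{1..Suc k}. t l - t (l - 1)) = 1" unfolding tel by (rule t1)
    finally show "(\<Sum>l\<in>{1..Suc k}. (t l - t (l - 1)) *\<^sub>R (\<chi> i. real_of_int (e l i))) $ i = q' $ i"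
      unfolding tel m(1)[symmetric] by (simp add: h_def)
  qed
  also have "mod_diagonal q' = mod_diagonal q" by (simp add: q'_def mod_diagonal_diff)
  finally have chart: "apartment_chart b x = mod_diagonal q" .
  have Ck: "facet k C" unfolding C_def by (rule C)
  then have "closed_simplex C \<in> {closed_simplex C | C. \<exists>k. facet k C}" by blast
  then have "x \<in> realization" unfolding realization_def using xC by (rule UnionI)
  moreover have "v \<in> apartment_vertices b" if "x v \<noteq> 0" for v
  proof -
    have "v \<in> C" using closed_simplexD(1)[OF xC Ck] that by auto
    then show ?thesis by (auto simp: CV V_def apartment_vertices_def)
  qed
  ultimately have "x \<in> apartment b" by (simp add: apartment_def)
  with chart show ?thesis by (rule bexI)
qed

lemma closed_simplex_subset_apartment:
  assumes "facet k C" "C \<subseteq> apartment_vertices b"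
  shows "closed_simplex C \<subseteq> apartment b"
  using assms closed_simplexD(1) unfolding apartment_def realization_def by blast

lemma apartment_subset_realization: "apartment b \<subseteq> realization"
  by (auto simp: apartment_def)

lemma range_apartment_chart:
  assumes b: "indexed_basis b"
  shows "apartment_chart b ` apartment b = range mod_diagonal"
proof (intro subset_antisym subsetI)
  fix q :: "real ^ 'b" assume "q \<in> range mod_diagonal"
  then obtain p where p: "q = mod_diagonal p" by auto
  obtain x where "x \<in> apartment b" "apartment_chart b x = mod_diagonal p"
    using apartment_chart_surj[OF b, of p] by auto
  with p show "q \<in> apartment_chart b ` apartment b" by (intro image_eqI[of _ _ x]) simp_all
qed (auto simp: apartment_chart_eq)

lemma mod_diagonal_convex_comb:
  "(1 - s) *\<^sub>R mod_diagonal u + s *\<^sub>R mod_diagonal w = mod_diagonal ((1 - s) *\<^sub>R u + s *\<^sub>R w)"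
  by (simp add: mod_diagonal_add mod_diagonal_scaleR)

lemma convex_apartment_chart:
  assumes b: "indexed_basis b"
  shows "convex (apartment_chart b ` apartment b)"
  unfolding range_apartment_chart[OF b]
  by (rule convex_linear_image[OF linear_mod_diagonal convex_UNIV])

text \<open>
  If all retractions onto the apartment of \<open>b\<close> send \<open>z\<close> to \<open>z'\<close>, then the norm of \<open>z\<close> has the
  right value on each \<open>b i\<close> (retract with \<open>i\<close> smallest) and on each coset of \<open>b i\<close> modulo the
  other basis vectors (retract with \<open>i\<close> largest), so it is split by \<open>b\<close> and \<open>z = z'\<close>.
\<close>

lemma eq_if_horoball_retractions_eq:
  fixes b :: "'n::finite \<Rightarrow> 'a ^ 'n"
  assumes n: "2 \<le> CARD('n)" and b: "indexed_basis b"
    and z: "z \<in> realization" and z': "z' \<in> apartment b"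
    and ret: "\<And>r :: 'n \<Rightarrow> nat. inj r \<Longrightarrow> horoball_retraction b r z = apartment_chart b z'"
  shows "z = z'"
proof -
  obtain e where e: "indexed_basis e" and ze: "z \<in> apartment e" and z'e: "z' \<in> apartment e"
    using common_apartment[OF z] z' apartment_subset_realization by blast
  let ?\<alpha> = "point_norm z" and ?p = "position b z'"
  obtain c1 where c1: "\<And>u. u \<noteq> 0 \<Longrightarrow> ?\<alpha> u = split_norm e (\<lambda>i. - position e z $ i) u + c1"
    using point_norm_apartment[OF e ze] by blast
  have max: "\<exists>w. w \<in> slice b r i \<and> (\<forall>u\<in>slice b r i. ?\<alpha> u \<le> ?\<alpha> w) \<and> retraction b r ?\<alpha> i = ?\<alpha> w"
    if r: "inj r" for r i
  proof -
    obtain w where w: "w \<in> slice b r i" "\<And>u. u \<in> slice b r i \<Longrightarrow>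
        split_norm e (\<lambda>i. - position e z $ i) u \<le> split_norm e (\<lambda>i. - position e z $ i) w"
      using slice_max[OF b e r, of i "\<lambda>i. - position e z $ i"] by blast
    have le: "?\<alpha> u \<le> ?\<alpha> w" if "u \<in> slice b r i" for u
      using w(2)[OF that] c1[OF slice_nonzero[OF b that]] c1[OF slice_nonzero[OF b w(1)]] by simp
    have "retraction b r ?\<alpha> i = ?\<alpha> w" by (rule retraction_eqI[where \<alpha> = "?\<alpha>", OF w(1) le])
    with w(1) le show ?thesis by (intro exI[of _ w]) simp
  qed
  have "\<exists>c. \<forall>i. retraction b r ?\<alpha> i = c - ?p $ i" if r: "inj r" for r
  proof -
    obtain c where "(\<chi> i. - retraction b r ?\<alpha> i) = ?p + vec c"
      using ret[OF r] unfolding horoball_retraction_def apartment_chart_eq mod_diagonal_eq_iff by auto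
    then have "- retraction b r ?\<alpha> i = ?p $ i + c" for i by (simp add: vec_eq_iff)
    then have "retraction b r ?\<alpha> i = - c - ?p $ i" for i by (smt (verit))
    then show ?thesis by blast
  qed
  then obtain c where c: "\<And>r i. inj r \<Longrightarrow> retraction b r ?\<alpha> i = c r - ?p $ i" by metis
  have order: "\<exists>r :: 'n \<Rightarrow> nat. inj r \<and> (\<forall>l. r i \<le> r l) \<and> (\<forall>l. r l \<le> r j)" if "i \<noteq> j" for i j
  proof -
    obtain r0 :: "'n \<Rightarrow> nat" where r0: "inj r0" using ex_inj_nat by auto
    define M where "M = Max (range r0)"
    have M: "r0 l \<le> M" for l unfolding M_def by (rule Max_ge) auto
    define r where "r = (\<lambda>l. if l = i then 0 else if l = j then Suc (Suc M) else Suc (r0 l))"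
    have "r l \<le> r j" for l using that M[of l] by (simp add: r_def)
    moreover have "inj r"
    proof (rule injI)
      fix l l' assume eq: "r l = r l'"
      have "r0 l \<noteq> Suc M" "r0 l' \<noteq> Suc M" using M[of l] M[of l'] by auto
      then have "l = l' \<or> r0 l = r0 l'" using eq by (simp add: r_def split: if_splits)
      then show "l = l'" using injD[OF r0] by blast
    qed
    ultimately show ?thesis by (intro exI[of _ r]) (auto simp: r_def)
  qed
  have first: "?\<alpha> (b i) = c r - ?p $ i" if r: "inj r" and i: "\<And>l. r i \<le> r l" for r i
  proof -
    have "u = b i" if "u \<in> slice b r i" for u
    proof -
      have "coord b u l = coord b (b i) l" for l
      proof (cases "l = i")
        case False
        then have "r i < r l" using i[of l] injD[OF r, of i l] by (metis le_neq_implies_less)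
        then show ?thesis using that False by (simp add: slice_def coord_basis[OF b])
      qed (use that in \<open>simp add: slice_def coord_basis[OF b]\<close>)
      then show ?thesis using coord_eq_iff[OF b] by blast
    qed
    then show ?thesis using max[OF r, of i] c[OF r, of i] by metis
  qed
  have last: "?\<alpha> u \<le> c r - ?p $ j" if r: "inj r" and j: "\<And>l. r l \<le> r j" and u: "coord b u j = 1" for r j u
  proof -
    have "u \<in> slice b r j" using u j by (auto simp: slice_def not_less[symmetric])
    then show ?thesis using max[OF r, of j] c[OF r, of j] by metis
  qed
  \<comment> \<open>With \<open>i\<close> lowest its slice is \<open>b i\<close> alone and gives an
    equality; with \<open>j\<close> highest \<open>b j\<close> is a member of its slice and gives an
    inequality. Exchanging \<open>i\<close> and \<open>j\<close> shows that the sum is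
    constant.\<close>
  have le: "?\<alpha> (b j) + ?p $ j \<le> ?\<alpha> (b i) + ?p $ i" if ij: "i \<noteq> j" for i j
  proof -
    obtain r :: "'n \<Rightarrow> nat" where r: "inj r" "\<And>l. r i \<le> r l" "\<And>l. r l \<le> r j" using order[OF ij] by blast
    show ?thesis using first[OF r(1,2)] last[OF r(1,3), of "b j"] by (simp add: coord_basis[OF b])
  qed
  define i0 :: 'n where "i0 = undefined"
  define d where "d = ?\<alpha> (b i0) + ?p $ i0"
  have basis: "?\<alpha> (b i) = d - ?p $ i" for i
    using le[of i i0] le[of i0 i] by (cases "i = i0") (auto simp: d_def)
  have top: "?\<alpha> u \<le> d - ?p $ j" if u: "coord b u j = 1" for u j
  proof -
    \<comment> \<open>A second index is needed as the lowest one: it identifies the additive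
      constant \<open>c r\<close> with \<open>d\<close>.\<close>
    obtain i where "i \<noteq> j"
    proof (rule ccontr)
      assume "\<not> thesis"
      then have "UNIV = {j}" using that by auto
      then have "CARD('n) = card {j}" by (rule arg_cong)
      then show False using n by simp
    qed
    then obtain r :: "'n \<Rightarrow> nat" where r: "inj r" "\<And>l. r i \<le> r l" "\<And>l. r l \<le> r j" using order by blast
    have "c r = d" using first[OF r(1,2)] basis[of i] by simp
    then show ?thesis using last[OF r(1,3) u] by simp
  qed
  have \<alpha>scale: "?\<alpha> (s *s u) = real_of_int (val s) + ?\<alpha> u" if "u \<noteq> 0" "s \<noteq> 0" for s u
    using that by (simp add: c1 split_norm_scale[OF e])
  have le2: "?\<alpha> u \<le> split_norm b (\<lambda>i. - ?p $ i) u + d" if u: "u \<noteq> 0" for u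
  proof -
    obtain i where i: "coord b u i \<noteq> 0"
      "split_norm b (\<lambda>i. - ?p $ i) u = real_of_int (val (coord b u i)) + - ?p $ i"
      by (rule split_norm_attained[OF b u])
    let ?w = "inverse (coord b u i) *s u"
    have "?\<alpha> ?w \<le> d - ?p $ i" using i by (intro top) (simp add: coord_scale[OF b])
    then show ?thesis using \<alpha>scale[OF u, of "inverse (coord b u i)"] i
      by (simp add: val_inverse del: inverse_eq_divide)
  qed
  obtain c2 where c2: "\<And>u. u \<noteq> 0 \<Longrightarrow> point_norm z' u = split_norm b (\<lambda>i. - ?p $ i) u + c2"
    using point_norm_apartment[OF b z'] by blast
  obtain c3 where c3: "\<And>u. u \<noteq> 0 \<Longrightarrow> point_norm z' u = split_norm e (\<lambda>i. - position e z' $ i) u + c3"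
    using point_norm_apartment[OF e z'e] by blast
  have ge: "split_norm b (\<lambda>i. - ?p $ i) u + d \<le> ?\<alpha> u" if u: "u \<noteq> 0" for u
  proof -
    let ?N = "split_norm b (\<lambda>i. - ?p $ i) u + d"
    have "?N \<le> ?\<alpha> (\<Sum>i\<in>I. coord b u i *s b i) \<or> (\<Sum>i\<in>I. coord b u i *s b i) = 0" for I
    proof (induction I rule: infinite_finite_induct)
      case (insert i I)
      let ?s = "\<Sum>i\<in>I. coord b u i *s b i" and ?t = "coord b u i *s b i"
      have sum: "(\<Sum>i\<in>insert i I. coord b u i *s b i) = ?t + ?s" using insert by simp
      show ?case
      proof (cases "coord b u i = 0")
        case False
        then have t0: "?t \<noteq> 0" using indexed_basis_nonzero[OF b] by simp
        have Nt: "?N \<le> ?\<alpha> ?t"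
          using split_norm_le[OF b False, of "\<lambda>i. - ?p $ i"] basis[of i]
            \<alpha>scale[OF indexed_basis_nonzero[OF b] False, of i] by simp
        show ?thesis
        proof (cases "?s = 0 \<or> ?t + ?s = 0")
          case False
          have "min (?\<alpha> ?t) (?\<alpha> ?s) \<le> ?\<alpha> (?t + ?s)"
            using split_norm_add[OF e t0, of ?s "\<lambda>i. - position e z $ i"] False t0 by (simp add: c1)
          then show ?thesis using Nt insert.IH False unfolding sum by linarith
        qed (use Nt in \<open>auto simp: insert.hyps\<close>)
      qed (use insert in auto)
    qed auto
    from this[of UNIV] u show ?thesis by (simp add: coord_sum[OF b])
  qed
  have "position e z $ i = position e z' $ i + (c1 - c3 - (d - c2))" for i
  proof -
    have nz: "e i \<noteq> 0" by (rule indexed_basis_nonzero[OF e])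
    have "?\<alpha> (e i) = point_norm z' (e i) + (d - c2)"
      using le2[OF nz] ge[OF nz] c2[OF nz] by simp
    then show ?thesis
      unfolding c1[OF nz] c3[OF nz] split_norm_basis[OF e] by simp
  qed
  then have "position e z = position e z' + vec (c1 - c3 - (d - c2))" by (simp add: vec_eq_iff)
  then have "apartment_chart e z = apartment_chart e z'"
    unfolding apartment_chart_eq mod_diagonal_eq_iff by blast
  then show ?thesis by (rule apartment_chart_inject[OF e ze z'e])
qed

text \<open>A retraction does not lengthen the two halves of the path, whose lengths add up to the
  distance of the fixed end points; so every retraction sends a point of the path to the same point
  of the straight segment. Agreement of all retractions then puts it into the apartment.\<close>

lemma geodesically_convex_in_apartment:
  fixes b :: "'n::finite \<Rightarrow> 'a ^ 'n"
  assumes n: "2 \<le> CARD('n)" and b: "indexed_basis b" and U: "U \<subseteq> apartment b"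
    and conv: "convex (apartment_chart b ` U)"
  shows "geodesically_convex realization building_dist U"
  unfolding geodesically_convex_def
proof (intro conjI allI impI)
  show "U \<subseteq> realization" using U apartment_subset_realization by blast
next
  fix l \<gamma> assume "geodesic_path realization building_dist l \<gamma> \<and> \<gamma> 0 \<in> U \<and> \<gamma> l \<in> U"
  then have l: "0 \<le> l" and \<gamma>: "\<And>t. 0 \<le> t \<Longrightarrow> t \<le> l \<Longrightarrow> \<gamma> t \<in> realization"
    and d: "\<And>s t. 0 \<le> s \<Longrightarrow> s \<le> l \<Longrightarrow> 0 \<le> t \<Longrightarrow> t \<le> l \<Longrightarrow> building_dist (\<gamma> s) (\<gamma> t) = \<bar>s - t\<bar>"
    and xU: "\<gamma> 0 \<in> U" and yU: "\<gamma> l \<in> U"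
    by (auto simp: geodesic_path_def)
  have xA: "\<gamma> 0 \<in> apartment b" and yA: "\<gamma> l \<in> apartment b" using xU yU U by auto
  show "\<gamma> ` {0..l} \<subseteq> U"
  proof
    fix z assume "z \<in> \<gamma> ` {0..l}"
    then obtain t where t: "0 \<le> t" "t \<le> l" "z = \<gamma> t" by auto
    show "z \<in> U"
    proof (cases "l = 0")
      case True
      then show ?thesis using t xU by simp
    next
      case False
      with l have l0: "0 < l" by simp
      define s where "s = t / l"
      have s: "0 \<le> s" "s \<le> 1" using t l0 by (auto simp: s_def)
      let ?w = "(1 - s) *\<^sub>R apartment_chart b (\<gamma> 0) + s *\<^sub>R apartment_chart b (\<gamma> l)"
      have "?w \<in> apartment_chart b ` U"
        using conv s xU yU by (intro convexD) auto
      then obtain z' where z': "z' \<in> U" "apartment_chart b z' = ?w" by auto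
      have "z = z'"
      proof (rule eq_if_horoball_retractions_eq[OF n b])
        show "z \<in> realization" using \<gamma> t by simp
        show "z' \<in> apartment b" using z' U by auto
        fix r :: "'n \<Rightarrow> nat" assume r: "inj r"
        have "dist (apartment_chart b (\<gamma> 0)) (horoball_retraction b r z) \<le> t"
          using building_dist_horoball_retraction[OF b r \<gamma>[of 0] \<gamma>[of t]] d[of 0 t] t l
          by (simp add: horoball_retraction_apartment[OF b r xA])
        moreover have "dist (horoball_retraction b r z) (apartment_chart b (\<gamma> l)) \<le> l - t"
          using building_dist_horoball_retraction[OF b r \<gamma>[of t] \<gamma>[of l]] d[of t l] t l
          by (simp add: horoball_retraction_apartment[OF b r yA])
        moreover have "dist (apartment_chart b (\<gamma> 0)) (apartment_chart b (\<gamma> l)) = l"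
          using building_dist_eq[OF b xA yA] d[of 0 l] l by simp
        moreover have "t = s * l" "l - t = (1 - s) * l" using l0 by (auto simp: s_def field_simps)
        ultimately have "horoball_retraction b r z = ?w"
          using s by (intro convex_combination_dist_eq[where d = l]) auto
        then show "horoball_retraction b r z = apartment_chart b z'" using z'(2) by simp
      qed
      then show ?thesis using z' by simp
    qed
  qed
qed

text \<open>Lifting a straight segment from the chart to the apartment gives a geodesic path, which
  a convex set has to contain.\<close>

lemma convex_chart_geodesically_convex:
  fixes b :: "'n::finite \<Rightarrow> 'a ^ 'n"
  assumes b: "indexed_basis b" and K: "geodesically_convex realization building_dist K"
  shows "convex (apartment_chart b ` (K \<inter> apartment b))"
  unfolding convex_alt
proof (intro ballI allI impI)
  fix p q s assume "p \<in> apartment_chart b ` (K \<inter> apartment b)" "q \<in> apartment_chart b ` (K \<inter> apartment b)"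
    and s: "0 \<le> s \<and> s \<le> (1::real)"
  then obtain x y where x: "x \<in> K" "x \<in> apartment b" "p = apartment_chart b x"
    and y: "y \<in> K" "y \<in> apartment b" "q = apartment_chart b y" by auto
  let ?l = "dist p q"
  show "(1 - s) *\<^sub>R p + s *\<^sub>R q \<in> apartment_chart b ` (K \<inter> apartment b)"
  proof (cases "p = q")
    case True
    then show ?thesis using x by (auto simp: algebra_simps)
  next
    case False
    define pt where "pt r = (SOME z. z \<in> apartment b \<and> apartment_chart b z = (1 - r) *\<^sub>R p + r *\<^sub>R q)" for r
    have pt: "pt r \<in> apartment b \<and> apartment_chart b (pt r) = (1 - r) *\<^sub>R p + r *\<^sub>R q" for r
    proof -
      have "\<exists>z. z \<in> apartment b \<and> apartment_chart b z = (1 - r) *\<^sub>R p + r *\<^sub>R q"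
        using apartment_chart_surj[OF b, of "(1 - r) *\<^sub>R position b x + r *\<^sub>R position b y"]
        unfolding x(3) y(3) apartment_chart_eq mod_diagonal_convex_comb by blast
      then show ?thesis unfolding pt_def by (rule someI_ex)
    qed
    have l: "0 < ?l" using False by simp
    let ?\<gamma> = "\<lambda>t. pt (t / ?l)"
    have "geodesic_path realization building_dist ?l ?\<gamma>"
      unfolding geodesic_path_def
    proof (intro conjI ballI)
      show "?\<gamma> ` {0..?l} \<subseteq> realization" using pt apartment_subset_realization by blast
      fix t t' assume "t \<in> {0..?l}" "t' \<in> {0..?l}"
      have "apartment_chart b (?\<gamma> t) - apartment_chart b (?\<gamma> t') = ((t' - t) / ?l) *\<^sub>R (p - q)"
        using pt[of "t / ?l"] pt[of "t' / ?l"] by (simp add: algebra_simps diff_divide_distrib)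
      then have "norm (apartment_chart b (?\<gamma> t) - apartment_chart b (?\<gamma> t')) = \<bar>(t' - t) / ?l\<bar> * ?l"
        by (simp only: norm_scaleR dist_norm)
      also have "\<dots> = \<bar>t - t'\<bar>" using l by (simp add: abs_minus_commute)
      finally show "building_dist (?\<gamma> t) (?\<gamma> t') = \<bar>t - t'\<bar>"
        using building_dist_eq[OF b] pt by (simp add: dist_norm)
    qed simp
    moreover have "?\<gamma> 0 = x" using pt[of 0] x by (intro apartment_chart_inject[OF b]) auto
    moreover have "?\<gamma> ?l = y" using pt[of 1] y l by (intro apartment_chart_inject[OF b]) auto
    ultimately have "?\<gamma> ` {0..?l} \<subseteq> K" using K x(1) y(1) unfolding geodesically_convex_def by metis
    moreover have "s * ?l \<in> {0..?l}" using s l by (auto simp: mult_left_le_one_le)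
    ultimately have "?\<gamma> (s * ?l) \<in> K" by blast
    then have "pt s \<in> K" using l by simp
    then show ?thesis using pt[of s] by (intro image_eqI[of _ _ "pt s"]) auto
  qed
qed

lemma geodesic_convex_hull_in_apartment:
  fixes b :: "'n::finite \<Rightarrow> 'a ^ 'n"
  assumes n: "2 \<le> CARD('n)" and b: "indexed_basis b" and U: "U \<subseteq> apartment b" and S: "S \<subseteq> U"
    and hull: "apartment_chart b ` U = convex hull (apartment_chart b ` S)"
  shows "geodesic_convex_hull realization building_dist S = U"
proof (rule subset_antisym)
  have "convex (apartment_chart b ` U)" unfolding hull by (rule convex_convex_hull)
  then have "geodesically_convex realization building_dist U"
    by (rule geodesically_convex_in_apartment[OF n b U])
  then show "geodesic_convex_hull realization building_dist S \<subseteq> U"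
    using S unfolding geodesic_convex_hull_def by blast
  show "U \<subseteq> geodesic_convex_hull realization building_dist S"
    unfolding geodesic_convex_hull_def
  proof (intro subsetI InterI)
    fix z K assume z: "z \<in> U" and "K \<in> {K. geodesically_convex realization building_dist K \<and> S \<subseteq> K}"
    then have K: "geodesically_convex realization building_dist K" "S \<subseteq> K" by auto
    have "convex hull (apartment_chart b ` S) \<subseteq> apartment_chart b ` (K \<inter> apartment b)"
      using S U K(2) by (intro hull_minimal convex_chart_geodesically_convex[OF b K(1)]) auto
    then have "apartment_chart b z \<in> apartment_chart b ` (K \<inter> apartment b)" using z hull by blast
    then obtain z' where "z' \<in> K" "z' \<in> apartment b" "apartment_chart b z = apartment_chart b z'" by auto
    moreover from this have "z = z'" using z U by (intro apartment_chart_inject[OF b]) auto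
    ultimately show "z \<in> K" by simp
  qed
qed

text \<open>The apartment is itself convex, hence contains the hull. In this way the facets between
  two given ones are brought into any apartment containing these two.\<close>

lemma geodesic_convex_hull_convex_chart:
  fixes b :: "'n::finite \<Rightarrow> 'a ^ 'n"
  assumes n: "2 \<le> CARD('n)" and b: "indexed_basis b" and S: "S \<subseteq> apartment b"
  defines "H \<equiv> geodesic_convex_hull realization building_dist S"
  shows "H \<subseteq> apartment b" "convex (apartment_chart b ` H)"
proof -
  have A: "geodesically_convex realization building_dist (apartment b)"
    by (rule geodesically_convex_in_apartment[OF n b order_refl convex_apartment_chart[OF b]])
  then show HA: "H \<subseteq> apartment b" using S unfolding H_def geodesic_convex_hull_def by blast
  have "geodesically_convex realization building_dist H"
    unfolding geodesically_convex_def
  proof (intro conjI allI impI)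
    show "H \<subseteq> realization" using HA apartment_subset_realization by blast
    fix l \<gamma> assume path: "geodesic_path realization building_dist l \<gamma> \<and> \<gamma> 0 \<in> H \<and> \<gamma> l \<in> H"
    show "\<gamma> ` {0..l} \<subseteq> H"
      unfolding H_def geodesic_convex_hull_def
    proof (rule Inter_greatest)
      fix K assume "K \<in> {K. geodesically_convex realization building_dist K \<and> S \<subseteq> K}"
      then have K: "geodesically_convex realization building_dist K" and "H \<subseteq> K"
        by (auto simp: H_def geodesic_convex_hull_def)
      with path show "\<gamma> ` {0..l} \<subseteq> K" unfolding geodesically_convex_def by (meson subsetD)
    qed
  qed
  from convex_chart_geodesically_convex[OF b this] HA show "convex (apartment_chart b ` H)"
    by (simp add: Int_absorb2)
qed

end

section \<open>Combinatorial geodesics are geometric geodesics\<close>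

text \<open>Abel summation: the increments weighted by \<open>z\<close> become the points weighted
  by the successive drops of \<open>z\<close>.\<close>

lemma convex_hull_decreasing_weights:
  fixes P :: "nat \<Rightarrow> 'v::real_vector" and z :: "nat \<Rightarrow> real"
  assumes z0: "z 0 = 1" and dec: "\<And>j. j < k \<Longrightarrow> z (Suc j) \<le> z j" and zk: "0 \<le> z k"
  shows "P 0 + (\<Sum>j<k. z (Suc j) *\<^sub>R (P (Suc j) - P j)) \<in> convex hull (P ` {0..k})"
proof -
  have eq: "P 0 + (\<Sum>j<n. z (Suc j) *\<^sub>R (P (Suc j) - P j)) = (\<Sum>j<n. (z j - z (Suc j)) *\<^sub>R P j) + z n *\<^sub>R P n" for n
    by (induction n) (auto simp: z0 algebra_simps)
  define wt where "wt j = (if j < k then z j - z (Suc j) else z k)" for j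
  have "(\<Sum>j\<le>n. wt j *\<^sub>R P j) = (\<Sum>j<n. wt j *\<^sub>R P j) + wt n *\<^sub>R P n" for n
    by (simp add: lessThan_Suc_atMost[symmetric])
  moreover have "(\<Sum>j<k. wt j *\<^sub>R P j) = (\<Sum>j<k. (z j - z (Suc j)) *\<^sub>R P j)"
    by (rule sum.cong) (auto simp: wt_def)
  ultimately have "P 0 + (\<Sum>j<k. z (Suc j) *\<^sub>R (P (Suc j) - P j)) = (\<Sum>j\<le>k. wt j *\<^sub>R P j)"
    unfolding eq by (simp add: wt_def)
  moreover have "(\<Sum>j\<le>k. wt j *\<^sub>R P j) \<in> convex hull (P ` {0..k})"
  proof (rule convex_sum)
    have "(\<Sum>j<n. z j - z (Suc j)) = 1 - z n" for n by (induction n) (auto simp: z0)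
    then show "(\<Sum>j\<le>k. wt j) = 1"
      by (simp add: lessThan_Suc_atMost[symmetric] wt_def)
    show "0 \<le> wt j" if "j \<in> {..k}" for j using dec zk by (simp add: wt_def)
    show "P j \<in> convex hull (P ` {0..k})" if "j \<in> {..k}" for j using that by (auto intro: hull_inc)
  qed auto
  ultimately show ?thesis by simp
qed

text \<open>
  The points \<open>P l\<close> run along a tube of direction \<open>w\<close>. In the coordinates \<open>z\<close>, which are made
  quasi-periodic so that no simplex is special, the tube is the set of decreasing \<open>z\<close> and the
  simplices \<open>P l, \<dots>, P (l + k)\<close> are the slices \<open>z l \<le> 1\<close>, \<open>0 \<le> z (l + k - 1)\<close>.
\<close>

locale periodic_path =
  fixes P :: "nat \<Rightarrow> 'v::real_vector" and w :: 'v and k :: nat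
  assumes k: "0 < k" and period: "P (l + k) = P l + w"
begin

definition tube :: "(nat \<Rightarrow> real) set" where
  "tube = {z. (\<forall>s. z (Suc s) \<le> z s) \<and> (\<forall>s. z (s + k) = z s - 1)}"

definition tube_point :: "(nat \<Rightarrow> real) \<Rightarrow> 'v" where
  "tube_point z = P 0 + (\<Sum>s<k. z s *\<^sub>R (P (Suc s) - P s))"

lemma tube_decreasing: "z \<in> tube \<Longrightarrow> s \<le> s' \<Longrightarrow> z s' \<le> z s"
  by (rule lift_Suc_antimono_le[of z]) (auto simp: tube_def)

text \<open>Moving the window by one drops the term at \<open>l\<close> and adds the one at
  \<open>l + k\<close>; quasi-periodicity of \<open>z\<close> makes the difference exactly
  \<open>P (Suc l) - P l\<close>.\<close>

lemma tube_point_shift: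
  assumes z: "z \<in> tube"
  shows "tube_point z = P l + (\<Sum>s<k. z (l + s) *\<^sub>R (P (Suc (l + s)) - P (l + s)))"
proof (induction l)
  case (Suc l)
  let ?f = "\<lambda>s. z s *\<^sub>R (P (Suc s) - P s)"
  have "(\<Sum>s<k. ?f (Suc l + s)) + ?f l = (\<Sum>s<Suc k. ?f (l + s))"
    by (simp only: sum.lessThan_Suc_shift) (simp add: add.commute)
  also have "\<dots> = (\<Sum>s<k. ?f (l + s)) + ?f (l + k)" by simp
  also have "?f (l + k) = ?f l - (P (Suc l) - P l)"
  proof -
    have "P (Suc (l + k)) - P (l + k) = P (Suc l) - P l"
      using period[of "Suc l"] period[of l] by simp
    moreover have "z (l + k) = z l - 1" using z by (simp add: tube_def)
    ultimately show ?thesis by (simp add: scaleR_left_diff_distrib)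
  qed
  finally have "(\<Sum>s<k. ?f (Suc l + s)) = (\<Sum>s<k. ?f (l + s)) - (P (Suc l) - P l)" by simp
  with Suc.IH show ?case by simp
qed (simp add: tube_point_def)

text \<open>A step function that falls by 1 every \<open>k\<close> indices and is 0 on the
  \<open>k\<close> indices starting at \<open>t\<close>; these are the coordinates of
  \<open>P t\<close>.\<close>

definition tube_vertex :: "nat \<Rightarrow> nat \<Rightarrow> real" where
  "tube_vertex t s = - real_of_int ((int s - int t) div int k)"

lemma tube_vertex_mem: "tube_vertex t \<in> tube"
  unfolding tube_def
proof (intro CollectI conjI allI)
  fix s
  show "tube_vertex t (Suc s) \<le> tube_vertex t s"
    using k by (auto simp: tube_vertex_def intro!: zdiv_mono1)
  have "(int s - int t + int k) div int k = (int s - int t) div int k + 1"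
    using k by simp
  then show "tube_vertex t (s + k) = tube_vertex t s - 1"
    by (simp add: tube_vertex_def algebra_simps)
qed

lemma tube_point_vertex: "tube_point (tube_vertex t) = P t"
proof -
  have "tube_vertex t (t + s) = 0" if "s < k" for s
    using that by (simp add: tube_vertex_def)
  then show ?thesis by (simp add: tube_point_shift[OF tube_vertex_mem, of t t])
qed

text \<open>For \<open>i = j\<close> the two bounds enclose the \<open>k\<close> decreasing values
  \<open>z i\<close>, ..., \<open>z (i + k - 1)\<close> between 1 and 0: the coordinates of a
  simplex with \<open>k + 1\<close> vertices.\<close>

definition tube_slice :: "nat \<Rightarrow> nat \<Rightarrow> (nat \<Rightarrow> real) set" where
  "tube_slice i j = {z \<in> tube. z j \<le> 1 \<and> 0 \<le> z (i + k - 1)}"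

lemma tube_vertex_slice:
  assumes "i \<le> t" "t \<le> i + k"
  shows "tube_vertex t \<in> tube_slice i i"
proof -
  have "- 1 \<le> (int i - int t) div int k"
  proof -
    have "((- 1) * int k) div int k \<le> (int i - int t) div int k" using assms k by (intro zdiv_mono1) auto
    moreover have "((- 1) * int k) div int k = - 1" using k by (subst nonzero_mult_div_cancel_right) auto
    ultimately show ?thesis by simp
  qed
  moreover have "(int (i + k - 1) - int t) div int k \<le> 0"
  proof -
    have "(int (i + k - 1) - int t) div int k \<le> (int k - 1) div int k"
      using assms k by (intro zdiv_mono1) auto
    then show ?thesis using k by (simp add: div_pos_pos_trivial)
  qed
  ultimately show ?thesis using tube_vertex_mem by (simp add: tube_slice_def tube_vertex_def)
qed

lemma convex_tube_slice: "convex (tube_point ` tube_slice i j)"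
proof (rule convexI)
  fix p q :: 'v and u v :: real
  assume "p \<in> tube_point ` tube_slice i j" "q \<in> tube_point ` tube_slice i j"
    and uv: "0 \<le> u" "0 \<le> v" "u + v = 1"
  then obtain y z where y: "y \<in> tube_slice i j" "p = tube_point y"
    and z: "z \<in> tube_slice i j" "q = tube_point z" by auto
  let ?x = "\<lambda>s. u * y s + v * z s"
  have "?x (Suc s) \<le> ?x s" for s
    using y z uv by (intro add_mono mult_left_mono) (auto simp: tube_slice_def tube_def)
  moreover have "?x (s + k) = ?x s - 1" for s
  proof -
    have "y (s + k) = y s - 1" "z (s + k) = z s - 1"
      using y z by (auto simp: tube_slice_def tube_def)
    then have "?x (s + k) = u * (y s - 1) + v * (z s - 1)" by (simp only:)
    also have "\<dots> = ?x s - (u + v)" by (simp add: right_diff_distrib)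
    finally show ?thesis unfolding uv(3) .
  qed
  moreover have "?x j \<le> 1"
    using y z uv by (intro convex_bound_le) (auto simp: tube_slice_def)
  moreover have "0 \<le> ?x (i + k - 1)"
    using y z uv by (auto simp: tube_slice_def)
  ultimately have "?x \<in> tube_slice i j" by (simp add: tube_slice_def tube_def)
  moreover have "u *\<^sub>R p + v *\<^sub>R q = tube_point ?x"
  proof -
    have "u *\<^sub>R P 0 + v *\<^sub>R P 0 = P 0" using uv(3) by (simp flip: scaleR_add_left)
    then show ?thesis
      unfolding y(2) z(2) tube_point_def
      by (simp add: scaleR_add_right scaleR_add_left sum.distrib scaleR_sum_right del: scaleR_scaleR
          flip: scaleR_scaleR)
  qed
  ultimately show "u *\<^sub>R p + v *\<^sub>R q \<in> tube_point ` tube_slice i j" by blast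
qed

lemma simplex_eq_slice: "convex hull (P ` {l..l + k}) = tube_point ` tube_slice l l"
proof (rule subset_antisym)
  show "convex hull (P ` {l..l + k}) \<subseteq> tube_point ` tube_slice l l"
  proof (rule hull_minimal)
    show "convex (tube_point ` tube_slice l l)" by (rule convex_tube_slice)
    show "P ` {l..l + k} \<subseteq> tube_point ` tube_slice l l"
    proof
    fix p assume "p \<in> P ` {l..l + k}"
    then obtain t where "p = P t" "l \<le> t" "t \<le> l + k" by auto
    then show "p \<in> tube_point ` tube_slice l l"
      using tube_vertex_slice tube_point_vertex by (metis imageI)
    qed
  qed
  show "tube_point ` tube_slice l l \<subseteq> convex hull (P ` {l..l + k})"
  proof
    fix p assume "p \<in> tube_point ` tube_slice l l"
    then obtain z where z: "z \<in> tube" "z l \<le> 1" "0 \<le> z (l + k - 1)" and p: "p = tube_point z"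
      by (auto simp: tube_slice_def)
    define y where "y j = (if j = 0 then 1 else z (l + j - 1))" for j
    have "P (l + 0) + (\<Sum>j<k. y (Suc j) *\<^sub>R (P (l + Suc j) - P (l + j))) \<in> convex hull ((\<lambda>j. P (l + j)) ` {0..k})"
    proof (rule convex_hull_decreasing_weights)
      fix j assume "j < k"
      show "y (Suc j) \<le> y j"
        using z tube_decreasing[OF z(1), of "l + j - 1" "l + j"] by (auto simp: y_def)
    qed (use z k in \<open>auto simp: y_def\<close>)
    moreover have "(\<lambda>j. P (l + j)) ` {0..k} = P ` {l..l + k}"
    proof -
      have "{l..l + k} = (\<lambda>j. l + j) ` {0..k}" by (simp add: add.commute)
      then show ?thesis by (simp only: image_image)
    qed
    moreover have "p = P (l + 0) + (\<Sum>j<k. y (Suc j) *\<^sub>R (P (l + Suc j) - P (l + j)))"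
      unfolding p tube_point_shift[OF z(1), of l] by (simp add: y_def)
    ultimately show "p \<in> convex hull (P ` {l..l + k})" by simp
  qed
qed

text \<open>Given \<open>z\<close>, take the least \<open>l \<ge> i\<close> with
  \<open>z l \<le> 1\<close>. Unless \<open>l = i\<close>, its predecessor exceeds 1, so one period
  later the value \<open>z (l + k - 1)\<close> is still positive.\<close>

lemma union_slices:
  assumes "i \<le> j"
  shows "(\<Union>l\<in>{i..j}. tube_slice l l) = tube_slice i j"
proof (intro subset_antisym subsetI)
  fix z assume "z \<in> (\<Union>l\<in>{i..j}. tube_slice l l)"
  then obtain l where l: "i \<le> l" "l \<le> j" and z: "z \<in> tube" "z l \<le> 1" "0 \<le> z (l + k - 1)"
    by (auto simp: tube_slice_def)
  have "z j \<le> z l" "z (l + k - 1) \<le> z (i + k - 1)"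
    using l by (auto intro!: tube_decreasing[OF z(1)])
  with z show "z \<in> tube_slice i j" by (simp add: tube_slice_def)
next
  fix z assume "z \<in> tube_slice i j"
  then have z: "z \<in> tube" "z j \<le> 1" "0 \<le> z (i + k - 1)" by (auto simp: tube_slice_def)
  define l where "l = (LEAST l. i \<le> l \<and> z l \<le> 1)"
  have l: "i \<le> l \<and> z l \<le> 1" unfolding l_def 
    by (rule LeastI[of "\<lambda>l. i \<le> l \<and> z l \<le> 1" j]) (use assms z in simp)
  have lj: "l \<le> j" unfolding l_def 
    by (rule Least_le[of "\<lambda>l. i \<le> l \<and> z l \<le> 1"]) (use assms z in simp)
  have "0 \<le> z (l + k - 1)"
  proof (cases "l = i")
    case False
    with l obtain l' where l': "l = Suc l'" "i \<le> l'" by (cases l) auto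
    then have "\<not> z l' \<le> 1" using not_less_Least[of l' "\<lambda>l. i \<le> l \<and> z l \<le> 1"] unfolding l_def[symmetric] by auto
    moreover have "z (l' + k) = z l' - 1" using z(1) by (simp add: tube_def)
    ultimately show ?thesis using l' by simp
  qed (use z in simp)
  with l lj z show "z \<in> (\<Union>l\<in>{i..j}. tube_slice l l)" by (auto simp: tube_slice_def)
qed

lemma period_mult: "P (l + c * k) = P l + real c *\<^sub>R w"
proof (induction c)
  case (Suc c)
  have "P (l + Suc c * k) = P ((l + c * k) + k)" by (simp add: algebra_simps)
  then show ?case unfolding period Suc.IH by (simp add: algebra_simps)
qed simp

lemma union_simplices_eq_hull:
  assumes ij: "i \<le> j"
  shows "(\<Union>l\<in>{i..j}. convex hull (P ` {l..l + k})) =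
    convex hull (convex hull (P ` {i..i + k}) \<union> convex hull (P ` {j..j + k}))"
    (is "?U = convex hull (?Ci \<union> ?Cj)")
proof (rule subset_antisym)
  have "?U = tube_point ` tube_slice i j"
    unfolding simplex_eq_slice union_slices[OF ij, symmetric] by (rule image_UN[symmetric])
  then have "convex ?U" using convex_tube_slice by simp
  then show "convex hull (?Ci \<union> ?Cj) \<subseteq> ?U"
    using ij by (intro hull_minimal) auto
  have mem: "P t \<in> convex hull (?Ci \<union> ?Cj)" if t: "i \<le> t" "t \<le> j + k" for t
  proof -
    \<comment> \<open>\<open>t0\<close> is an index of the first simplex congruent to
      \<open>t\<close> modulo \<open>k\<close>, and \<open>t0 + c' * k\<close> is one of the last
      simplex; \<open>P t\<close> lies on the straight segment between the two points.\<close>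
    define t0 where "t0 = i + (t - i) mod k"
    define c where "c = (t - i) div k"
    have tt: "t = t0 + c * k" 
    proof -
      have "(t - i) mod k + (t - i) div k * k = t - i" by simp
      then show ?thesis using t unfolding t0_def c_def by linarith
    qed
    have t0: "i \<le> t0" "t0 < i + k" using k by (auto simp: t0_def)
    define c' where "c' = (j + k - t0) div k"
    have t0j: "t0 \<le> j + k" using tt t(2) by simp
    have "c' * k \<le> j + k - t0" by (simp add: c'_def)
    moreover have "j + k - t0 < c' * k + k"
      using dividend_less_times_div[OF k, of "j + k - t0"] by (simp add: c'_def mult.commute)
    ultimately have t1: "j \<le> t0 + c' * k" "t0 + c' * k \<le> j + k" using t0j by auto
    have "c * k \<le> j + k - t0" using tt t(2) by simp
    then have cc: "c \<le> c'" unfolding c'_def using k by (simp add: less_eq_div_iff_mult_less_eq)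
    have "P t0 \<in> ?Ci" using t0 by (intro hull_inc) auto
    then have P0: "P t0 \<in> convex hull (?Ci \<union> ?Cj)" by (intro hull_inc) auto
    have "P (t0 + c' * k) \<in> ?Cj" using t1 by (intro hull_inc) auto
    then have P1: "P (t0 + c' * k) \<in> convex hull (?Ci \<union> ?Cj)" by (intro hull_inc) auto
    show ?thesis
    proof (cases "c' = 0")
      case True
      then show ?thesis using P0 cc tt by simp
    next
      case False
      define s where "s = real c / real c'"
      have s: "0 \<le> s" "s \<le> 1" using cc False by (auto simp: s_def)
      have "(1 - s) *\<^sub>R P t0 + s *\<^sub>R P (t0 + c' * k) \<in> convex hull (?Ci \<union> ?Cj)"
        using P0 P1 s by (intro convexD[OF convex_convex_hull]) auto
      moreover have "s * real c' = real c" using False by (simp add: s_def)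
      then have "(1 - s) *\<^sub>R P t0 + s *\<^sub>R P (t0 + c' * k) = P t"
        unfolding tt period_mult by (simp add: algebra_simps)
      ultimately show ?thesis by simp
    qed
  qed
  show "?U \<subseteq> convex hull (?Ci \<union> ?Cj)"
    using mem by (intro UN_least hull_minimal convex_convex_hull) auto
qed

end

text \<open>The recursion says that \<open>P (l + k) - P l\<close> does not depend on
  \<open>l\<close>; so the finite path agrees with the periodic extension \<open>Q\<close> of its
  first \<open>k\<close> points along \<open>w\<close>.\<close>

lemma straight_path_hull:
  fixes P :: "nat \<Rightarrow> 'v::real_vector"
  assumes k: "0 < k" and rec: "\<And>l. l < m \<Longrightarrow> P (l + k + 1) = P (l + k) + P (l + 1) - P l"
    and ij: "i \<le> j" "j \<le> m"
  shows "(\<Union>l\<in>{i..j}. convex hull (P ` {l..l + k})) =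
    convex hull (convex hull (P ` {i..i + k}) \<union> convex hull (P ` {j..j + k}))"
proof -
  define w where "w = P k - P 0"
  define Q where "Q l = P (l mod k) + real (l div k) *\<^sub>R w" for l
  interpret periodic_path Q w k
    by unfold_locales (use k in \<open>auto simp: Q_def algebra_simps\<close>)
  have per: "P (l + k) = P l + w" if "l \<le> m" for l
    using that
  proof (induction l)
    case (Suc l)
    then show ?case using rec[of l] by simp
  qed (simp add: w_def)
  have eq: "Q l = P l" if "l \<le> m + k" for l
    using that
  proof (induction l rule: less_induct)
    case (less l)
    show ?case
    proof (cases "l < k")
      case False
      then have "Q l = Q ((l - k) + k)" by simp
      also have "\<dots> = Q (l - k) + w" by (rule period)
      also have "Q (l - k) = P (l - k)" using less False k by (intro less.IH) auto
      also have "P (l - k) + w = P ((l - k) + k)" using less.prems False by (intro per[symmetric]) simp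
      finally show ?thesis using False by simp
    qed (simp add: Q_def)
  qed
  have img: "Q ` {l..l + k} = P ` {l..l + k}" if "l \<le> m" for l
    using that by (intro image_cong) (auto simp: eq)
  have "(\<Union>l\<in>{i..j}. convex hull (P ` {l..l + k})) = (\<Union>l\<in>{i..j}. convex hull (Q ` {l..l + k}))"
    using ij by (intro SUP_cong) (auto simp: img)
  then show ?thesis using union_simplices_eq_hull[OF ij(1)] ij by (simp add: img)
qed

context nonarch_local_field
begin

lemma sorted_wrt_psubset_unique:
  fixes xs ys :: "'b set list"
  assumes "sorted_wrt (\<supset>) xs" "sorted_wrt (\<supset>) ys" "set xs = set ys"
  shows "xs = ys"
  using assms
proof (induction xs arbitrary: ys)
  case (Cons x xs)
  then obtain y ys' where ys: "ys = y # ys'" by (cases ys) auto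
  have "x = y"
  proof (rule ccontr)
    assume ne: "x \<noteq> y"
    then have "y \<in> set xs" "x \<in> set ys'" using Cons.prems(3) ys by auto
    then have "y \<subset> x" "x \<subset> y" using Cons.prems(1,2) ys by auto
    then show False by auto
  qed
  moreover have "x \<notin> set xs" "y \<notin> set ys'" using Cons.prems(1,2) ys by auto
  ultimately have "set xs = set ys'" using Cons.prems(3) ys by auto
  then have "xs = ys'" using Cons ys by auto
  with \<open>x = y\<close> ys show ?case by simp
qed simp

lemma lattice_chain_scale:
  assumes ch: "lattice_chain Ls" and c: "c \<noteq> 0"
  shows "lattice_chain (map (scale c) Ls)"
proof -
  have ne: "Ls \<noteq> []" and srt: "sorted_wrt (\<supset>) Ls" and sub: "scale \<pi> (hd Ls) \<subset> last Ls"
    and lat: "\<And>L. L \<in> set Ls \<Longrightarrow> lattice L"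
    using ch by (auto simp: lattice_chain_def)
  have "scale \<pi> (scale c (hd Ls)) = scale c (scale \<pi> (hd Ls))"
    by (simp add: scale_scale mult.commute)
  then have "scale \<pi> (hd (map (scale c) Ls)) \<subset> last (map (scale c) Ls)"
    using ne sub c by (simp add: hd_map last_map scale_psubset_iff)
  moreover have "sorted_wrt (\<supset>) (map (scale c) Ls)"
    using srt c by (simp add: sorted_wrt_map scale_psubset_iff)
  ultimately show ?thesis using ne lat c by (auto simp: lattice_chain_def lattice_scale)
qed

lemma pointed_facet_of_scale:
  assumes "Ls \<noteq> []" "c \<noteq> 0"
  shows "pointed_facet_of (map (scale c) Ls) = pointed_facet_of Ls"
  using assms by (simp add: pointed_facet_of_def hd_map homothety_class_scale image_image)

text \<open>After matching the heads, all members of both chains lie between \<open>hd Ms\<close>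
  and \<open>scale \<pi> (hd Ms)\<close>, the latter excluded, and there a homothety class has at
  most one lattice.\<close>

lemma pointed_facet_of_eqD:
  assumes Ls: "lattice_chain Ls" and Ms: "lattice_chain Ms"
    and eq: "pointed_facet_of Ls = pointed_facet_of Ms"
  shows "\<exists>c. c \<noteq> 0 \<and> Ms = map (scale c) Ls"
proof -
  have cls: "homothety_class ` set Ls = homothety_class ` set Ms"
    and hds: "homothety_class (hd Ls) = homothety_class (hd Ms)"
    using eq by (auto simp: pointed_facet_of_def)
  obtain c where c: "c \<noteq> 0" "hd Ms = scale c (hd Ls)"
    using homothety_class_eq_iff[THEN iffD1, OF hds] by blast
  let ?Ns = "map (scale c) Ls"
  have Ns: "lattice_chain ?Ns" by (rule lattice_chain_scale[OF Ls c(1)])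
  have ne: "Ls \<noteq> []" "Ms \<noteq> []" using Ls Ms by (auto simp: lattice_chain_def)
  have hdN: "hd ?Ns = hd Ms" using ne c by (simp add: hd_map)
  have below: "L \<subseteq> hd Ms \<and> scale \<pi> (hd Ms) \<subset> L" if "L \<in> set ?Ns \<or> L \<in> set Ms" for L
  proof -
    have *: "K \<subseteq> hd Ks \<and> scale \<pi> (hd Ks) \<subset> K" if "lattice_chain Ks" "K \<in> set Ks" for K Ks
    proof -
      have "Ks \<noteq> []" "sorted_wrt (\<supset>) Ks" using that by (auto simp: lattice_chain_def)
      then have "K \<subseteq> hd Ks" using that(2) by (cases Ks) auto
      moreover have "scale \<pi> (hd Ks) \<subset> K"
        using that \<open>Ks \<noteq> []\<close> by (intro lattice_chain_bounds[OF that(1)]) auto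
      ultimately show ?thesis by simp
    qed
    show ?thesis using that *[OF Ns] *[OF Ms] hdN by metis
  qed
  have same: "K = L" if K: "K \<in> set ?Ns \<or> K \<in> set Ms" and L: "L \<in> set ?Ns \<or> L \<in> set Ms"
    and KL: "homothety_class K = homothety_class L" for K L
  proof -
    have lat: "lattice K" using K Ns Ms by (auto simp: lattice_chain_def)
    obtain d where d: "d \<noteq> 0" "L = scale d K" using homothety_class_eq_iff[THEN iffD1, OF KL] by blast
    have Ld: "L = scale (\<pi> powi val d) K" using d(2) scale_eq_scale_val[OF lat d(1)] by simp
    note bK = below[OF K] and bL = below[OF L]
    consider "1 \<le> val d" | "val d \<le> - 1" | "val d = 0" by linarith
    then show ?thesis
    proof cases
      case 1
      have "L \<subseteq> scale \<pi> K" using scale_powi_mono[OF lat 1] unfolding Ld by simp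
      also have "\<dots> \<subseteq> scale \<pi> (hd Ms)" using bK by (simp add: scale_subset_iff)
      finally show ?thesis using bL by blast
    next
      case 2
      have "scale (\<pi> powi 0) K \<subseteq> scale (\<pi> powi (val d + 1)) K" using 2 by (intro scale_powi_mono[OF lat]) simp
      then have "K \<subseteq> scale \<pi> L"
        unfolding Ld scale_scale by (simp add: power_int_add mult.commute)
      also have "\<dots> \<subseteq> scale \<pi> (hd Ms)" using bL by (simp add: scale_subset_iff)
      finally show ?thesis using bK by blast
    next
      case 3
      then show ?thesis unfolding Ld by simp
    qed
  qed
  have cls': "homothety_class ` set ?Ns = homothety_class ` set Ms"
    using cls c(1) by (simp add: image_image homothety_class_scale)
  have "set ?Ns = set Ms"
  proof (intro subset_antisym subsetI)
    fix L assume L: "L \<in> set ?Ns"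
    then obtain K where K: "K \<in> set Ms" "homothety_class L = homothety_class K" using cls' by blast
    with same[of L K] L show "L \<in> set Ms" by auto
  next
    fix L assume L: "L \<in> set Ms"
    then obtain K where K: "K \<in> set ?Ns" "homothety_class L = homothety_class K" using cls' by blast
    with same[of L K] L show "L \<in> set ?Ns" by blast
  qed
  then have "?Ns = Ms"
    using Ns Ms by (intro sorted_wrt_psubset_unique) (auto simp: lattice_chain_def)
  with c(1) show ?thesis by blast
qed

text \<open>A combinatorial geodesic unrolled into one sequence of lattices, free of the homothety
  ambiguity: facet \<open>i\<close> is the window of length \<open>k + 1\<close> at
  \<open>i\<close>, and the lattice \<open>L'\<close> of its successor is
  \<open>scale (inverse \<pi>) (M (i + k + 1))\<close>.\<close>

definition lattice_path :: "nat \<Rightarrow> nat \<Rightarrow> (nat \<Rightarrow> ('a, 'n::finite) lattice) \<Rightarrow> bool" where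
  "lattice_path k m M \<longleftrightarrow>
     (\<forall>i\<le>m. lattice_chain (map M [i..<i + k + 1])) \<and>
     (\<forall>i<m. M i \<inter> scale (inverse \<pi>) (M (i + k + 1)) = M (i + 1) \<and>
        {x + y | x y. x \<in> M i \<and> y \<in> scale (inverse \<pi>) (M (i + k + 1))} = scale (inverse \<pi>) (M (i + k)))"

text \<open>The definition of \<open>successor\<close> brings its own representatives; they differ
  from \<open>Ls\<close> by a common homothety, which is transported to the new lattice.\<close>

lemma successorE:
  assumes suc: "successor k (pointed_facet_of Ls) P'" and Ls: "lattice_chain Ls"
  obtains N where "length Ls = k + 1" "1 \<le> k" "lattice_chain (tl Ls @ [N])" "P' = pointed_facet_of (tl Ls @ [N])"
    "hd Ls \<inter> scale (inverse \<pi>) N = Ls ! 1"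
    "{x + y | x y. x \<in> hd Ls \<and> y \<in> scale (inverse \<pi>) N} = scale (inverse \<pi>) (last Ls)"
proof -
  obtain Ks L' where k: "1 \<le> k" and len: "length Ks = k + 1" and Ks: "lattice_chain Ks"
    and eq: "pointed_facet_of Ls = pointed_facet_of Ks" and L': "lattice L'"
    and int: "hd Ks \<inter> L' = Ks ! 1"
    and sum: "{x + y | x y. x \<in> hd Ks \<and> y \<in> L'} = scale (inverse \<pi>) (last Ks)"
    and ch: "lattice_chain (tl Ks @ [scale \<pi> L'])" and P': "P' = pointed_facet_of (tl Ks @ [scale \<pi> L'])"
    using suc unfolding successor_def by blast
  obtain c where c: "c \<noteq> 0" "Ls = map (scale c) Ks"
    using pointed_facet_of_eqD[OF Ks Ls eq[symmetric]] by blast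
  have ne: "Ks \<noteq> []" using len by auto
  let ?N = "scale c (scale \<pi> L')"
  have tl: "tl Ls @ [?N] = map (scale c) (tl Ks @ [scale \<pi> L'])" by (simp add: c(2) map_tl)
  have "inverse \<pi> * (c * \<pi>) = c" by (simp add: field_simps)
  then have invN: "scale (inverse \<pi>) ?N = scale c L'" by (simp only: scale_scale)
  have "hd Ls \<inter> scale c L' = scale c (hd Ks \<inter> L')"
    using c(1) ne by (auto simp: c(2) hd_map mem_scale_iff set_eq_iff)
  then have int': "hd Ls \<inter> scale (inverse \<pi>) ?N = Ls ! 1"
    unfolding invN int using len k by (simp add: c(2))
  have "{x + y | x y. x \<in> hd Ls \<and> y \<in> scale c L'} = scale c {x + y | x y. x \<in> hd Ks \<and> y \<in> L'}"
  proof (intro subset_antisym subsetI)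
    fix u assume "u \<in> {x + y | x y. x \<in> hd Ls \<and> y \<in> scale c L'}"
    then obtain x y where "x \<in> hd Ks" "y \<in> L'" "u = c *s x + c *s y"
      using ne by (auto simp: c(2) hd_map scale_def)
    then show "u \<in> scale c {x + y | x y. x \<in> hd Ks \<and> y \<in> L'}"
      unfolding scale_def by (intro image_eqI[of _ _ "x + y"]) (auto simp: vec.scale_right_distrib)
  next
    fix u assume "u \<in> scale c {x + y | x y. x \<in> hd Ks \<and> y \<in> L'}"
    then obtain x y where "x \<in> hd Ks" "y \<in> L'" "u = c *s x + c *s y"
      by (auto simp: scale_def vec.scale_right_distrib)
    then show "u \<in> {x + y | x y. x \<in> hd Ls \<and> y \<in> scale c L'}"
      using ne by (auto simp: c(2) hd_map scale_def)
  qed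
  also have "\<dots> = scale (inverse \<pi>) (last Ls)"
    unfolding sum using ne by (simp add: c(2) last_map scale_scale mult.commute)
  finally have sum': "{x + y | x y. x \<in> hd Ls \<and> y \<in> scale (inverse \<pi>) ?N} = scale (inverse \<pi>) (last Ls)"
    unfolding invN .
  have ch': "lattice_chain (tl Ls @ [?N])" unfolding tl by (rule lattice_chain_scale[OF ch c(1)])
  have P'': "P' = pointed_facet_of (tl Ls @ [?N])"
    unfolding tl P' using c(1) by (intro pointed_facet_of_scale[symmetric]) auto
  have "length Ls = k + 1" using len by (simp add: c(2))
  from that[OF this k ch' P'' int' sum'] show ?thesis .
qed

lemma combinatorial_geodesic_lattice_path:
  fixes Ps :: "(('a, 'n::finite) facet \<times> ('a, 'n) vertex) list"
  assumes geo: "combinatorial_geodesic k Ps" and len: "length Ps = m + 1" and m: "1 \<le> m"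
  obtains M where "lattice_path k m M" "\<And>i. i \<le> m \<Longrightarrow> Ps ! i = pointed_facet_of (map M [i..<i + k + 1])"
proof -
  have suc: "successor k (Ps ! i) (Ps ! Suc i)" if "i < m" for i
    using geo len that by (simp add: combinatorial_geodesic_def)
  have "\<exists>M :: nat \<Rightarrow> ('a, 'n) lattice. lattice_path k n M \<and> (\<forall>i\<le>n. Ps ! i = pointed_facet_of (map M [i..<i + k + 1]))"
    if "n \<le> m" for n
    using that
  proof (induction n)
    case 0
    have "successor k (Ps ! 0) (Ps ! 1)" using suc[of 0] m by simp
    then obtain Ls where "length Ls = k + 1" "lattice_chain Ls" "Ps ! 0 = pointed_facet_of Ls"
      unfolding successor_def by blast
    moreover from this have "map ((!) Ls) [0..<0 + k + 1] = Ls"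
      using map_nth[of Ls] by (simp del: upt_Suc)
    ultimately show ?case by (intro exI[of _ "(!) Ls"]) (simp add: lattice_path_def del: upt_Suc)
  next
    case (Suc n)
    then obtain M where M: "lattice_path k n M"
      and PM: "\<And>i. i \<le> n \<Longrightarrow> Ps ! i = pointed_facet_of (map M [i..<i + k + 1])" by auto
    let ?Ls = "map M [n..<n + k + 1]"
    have "successor k (pointed_facet_of ?Ls) (Ps ! Suc n)"
      using suc[of n] Suc.prems PM[of n] by simp
    moreover have "lattice_chain ?Ls" using M by (simp add: lattice_path_def del: upt_Suc)
    ultimately obtain N where k: "1 \<le> k" and ch: "lattice_chain (tl ?Ls @ [N])"
      and P: "Ps ! Suc n = pointed_facet_of (tl ?Ls @ [N])"
      and int: "hd ?Ls \<inter> scale (inverse \<pi>) N = ?Ls ! 1"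
      and sum: "{x + y | x y. x \<in> hd ?Ls \<and> y \<in> scale (inverse \<pi>) N} = scale (inverse \<pi>) (last ?Ls)"
      by (rule successorE)
    define M' where "M' = M(n + k + 1 := N)"
    have old: "map M' [i..<i + k + 1] = map M [i..<i + k + 1]" if "i \<le> n" for i
      using that by (auto simp: M'_def simp del: upt_Suc)
    have "[n..<n + k + 1] = n # [Suc n..<n + k + 1]" by (simp add: upt_conv_Cons del: upt_Suc)
    then have tl: "tl ?Ls = map M [Suc n..<n + k + 1]" and hd: "hd ?Ls = M n" by (auto simp del: upt_Suc)
    have "[Suc n..<Suc n + k + 1] = [Suc n..<n + k + 1] @ [n + k + 1]" by simp
    then have new: "map M' [Suc n..<Suc n + k + 1] = tl ?Ls @ [N]"
      unfolding tl by (auto simp: M'_def simp del: upt_Suc)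
    have nth: "?Ls ! 1 = M (n + 1)" using k by (simp del: upt_Suc)
    have last: "last ?Ls = M (n + k)" by simp
    have "lattice_path k (Suc n) M'"
      unfolding lattice_path_def
    proof (intro conjI allI impI)
      fix i assume i: "i \<le> Suc n"
      show "lattice_chain (map M' [i..<i + k + 1])"
      proof (cases "i = Suc n")
        case True
        show ?thesis unfolding True new by (rule ch)
      next
        case False
        with i have "i \<le> n" by simp
        with M show ?thesis unfolding old[OF \<open>i \<le> n\<close>] by (simp add: lattice_path_def del: upt_Suc)
      qed
    next
      fix i assume i: "i < Suc n"
      show "M' i \<inter> scale (inverse \<pi>) (M' (i + k + 1)) = M' (i + 1)"
        using int M i k unfolding hd nth by (cases "i = n") (auto simp: M'_def lattice_path_def)
      show "{x + y | x y. x \<in> M' i \<and> y \<in> scale (inverse \<pi>) (M' (i + k + 1))} = scale (inverse \<pi>) (M' (i + k))"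
      proof (cases "i = n")
        case True
        then show ?thesis using sum k unfolding hd last by (simp add: M'_def)
      next
        case False
        with i have "i < n" by simp
        then have "{x + y | x y. x \<in> M i \<and> y \<in> scale (inverse \<pi>) (M (i + k + 1))} = scale (inverse \<pi>) (M (i + k))"
          using M unfolding lattice_path_def by blast
        then show ?thesis using \<open>i < n\<close> by (simp add: M'_def)
      qed
    qed
    moreover have "Ps ! i = pointed_facet_of (map M' [i..<i + k + 1])" if i: "i \<le> Suc n" for i
    proof (cases "i = Suc n")
      case True
      show ?thesis unfolding True new by (rule P)
    next
      case False
      with i have "i \<le> n" by simp
      then show ?thesis unfolding old[OF \<open>i \<le> n\<close>] by (rule PM)
    qed
    ultimately show ?case by blast
  qed
  from this[of m] that show ?thesis by auto
qed

context
  fixes k m :: nat and M :: "nat \<Rightarrow> ('a, 'n::finite) lattice"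
  assumes M: "lattice_path k m M" and k: "1 \<le> k"
begin

lemma lattice_path_psubset_Suc: "j < m + k \<Longrightarrow> M (Suc j) \<subset> M j"
proof -
  assume j: "j < m + k"
  define i where "i = min j m"
  have "sorted_wrt (\<supset>) (map M [i..<i + k + 1])"
    using M by (simp add: lattice_path_def lattice_chain_def i_def del: upt_Suc)
  moreover have "i \<le> j" "Suc j - i < k + 1" using j k by (auto simp: i_def)
  ultimately show "M (Suc j) \<subset> M j"
    using sorted_wrt_nth_less[of "(\<supset>)" "map M [i..<i + k + 1]" "j - i" "Suc j - i"]
    by (simp del: upt_Suc)
qed

lemma lattice_path_antimono:
  assumes "i \<le> j" "j \<le> m + k"
  shows "M j \<subseteq> M i"
  using assms
proof (induction j rule: dec_induct)
  case (step n)
  then show ?case using lattice_path_psubset_Suc[of n] by auto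
qed simp

lemma lattice_path_scale: "i \<le> m \<Longrightarrow> scale \<pi> (M i) \<subset> M (i + k)"
proof -
  assume "i \<le> m"
  then have "lattice_chain (map M [i..<i + k + 1])" using M by (simp add: lattice_path_def del: upt_Suc)
  then have "scale \<pi> (hd (map M [i..<i + k + 1])) \<subset> last (map M [i..<i + k + 1])"
    by (simp add: lattice_chain_def del: upt_Suc)
  moreover have "hd (map M [i..<i + k + 1]) = M i" by (simp add: hd_map del: upt_Suc)
  moreover have "last (map M [i..<i + k + 1]) = M (i + k)" by simp
  ultimately show "scale \<pi> (M i) \<subset> M (i + k)" by simp
qed

lemma lattice_path_step:
  assumes "i < m" "x \<in> M i" "\<pi> *s x \<in> M (i + k + 1)"
  shows "x \<in> M (i + 1)"
proof -
  have "x \<in> scale (inverse \<pi>) (M (i + k + 1))" using assms(3) by (simp add: mem_scale_iff)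
  with assms M show ?thesis unfolding lattice_path_def by blast
qed

text \<open>Injectivity of multiplication by \<pi> on the quotients, over \<open>t\<close> periods:
  it is applied first to \<open>\<pi> *s x\<close>, one period further on, and then to
  \<open>x\<close>.\<close>

lemma lattice_path_power_step:
  "x \<in> M l \<Longrightarrow> (\<pi> ^ t) *s x \<in> M (l + 1 + t * k) \<Longrightarrow> l + 1 + t * k \<le> m + k \<Longrightarrow> x \<in> M (l + 1)"
proof (induction t arbitrary: l x)
  case (Suc t)
  have lm: "l < m" using Suc.prems(3) k by (simp add: algebra_simps)
  then have "\<pi> *s x \<in> M (l + k)"
    using lattice_path_scale[of l] Suc.prems(1) by (auto simp: scale_def)
  moreover have "(\<pi> ^ t) *s (\<pi> *s x) \<in> M ((l + k) + 1 + t * k)"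
    using Suc.prems(2) by (simp add: algebra_simps)
  ultimately have "\<pi> *s x \<in> M ((l + k) + 1)" using Suc.prems(3) by (intro Suc.IH) (auto simp: algebra_simps)
  then show ?case using lattice_path_step[OF lm Suc.prems(1)] by (simp add: algebra_simps)
qed simp

text \<open>
  Multiplication by \<open>\<pi>\<close> induces injections \<open>M i / M (i + 1) \<rightarrow> M (i + k) / M (i + k + 1)\<close>, so the
  intermediate lattices are determined by the first and the last facet.
\<close>

lemma lattice_path_eq_inter:
  assumes j: "j + t * k \<le> m + k"
  shows "M j = M 0 \<inter> scale (inverse (\<pi> ^ t)) (M (j + t * k))"
proof (intro subset_antisym subsetI)
  fix x assume x: "x \<in> M j"
  have "(\<pi> ^ s) *s x \<in> M (j + s * k)" if "s \<le> t" for s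
    using that
  proof (induction s)
    case (Suc s)
    have "s * k + k \<le> t * k" using mult_le_mono1[OF Suc.prems, of k] by simp
    then have "j + s * k \<le> m" using j by simp
    moreover have "(\<pi> ^ s) *s x \<in> M (j + s * k)" using Suc by simp
    ultimately have "\<pi> *s ((\<pi> ^ s) *s x) \<in> M (j + s * k + k)"
      using lattice_path_scale[of "j + s * k"] by (auto simp: scale_def)
    then show ?case by (simp add: algebra_simps)
  qed (use x in simp)
  then have "(\<pi> ^ t) *s x \<in> M (j + t * k)" by simp
  moreover have "x \<in> M 0" using x lattice_path_antimono[of 0 j] j by auto
  ultimately show "x \<in> M 0 \<inter> scale (inverse (\<pi> ^ t)) (M (j + t * k))" by (simp add: mem_scale_iff)
next
  fix x assume "x \<in> M 0 \<inter> scale (inverse (\<pi> ^ t)) (M (j + t * k))"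
  then have x0: "x \<in> M 0" and xt: "(\<pi> ^ t) *s x \<in> M (j + t * k)" by (auto simp: mem_scale_iff)
  have "x \<in> M l" if "l \<le> j" for l
    using that
  proof (induction l)
    case (Suc l)
    have "M (j + t * k) \<subseteq> M (l + 1 + t * k)" using Suc.prems j by (intro lattice_path_antimono) auto
    then show ?case using lattice_path_power_step[of x l t] Suc xt j by auto
  qed (rule x0)
  then show "x \<in> M j" by simp
qed

text \<open>The lattices of the first and the last facet have a common basis, and each
  \<open>M j\<close> is the intersection of \<open>M 0\<close> with a multiple of the lattice in the
  last window that is reached from \<open>j\<close> by steps of \<open>k\<close>.\<close>

lemma lattice_path_apartment:
  obtains b a where "indexed_basis b" "\<And>j. j \<le> m + k \<Longrightarrow> M j = apartment_lattice b (a j)"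
proof -
  let ?F = "set (map M [0..<0 + k + 1])" and ?G = "set (map M [m..<m + k + 1])"
  have "comparable_lattices ?F" "comparable_lattices ?G"
    using M unfolding lattice_path_def by (blast intro: comparable_lattice_chain)+
  then obtain b where b: "indexed_basis b" and diag: "\<And>L. L \<in> ?F \<union> ?G \<Longrightarrow> \<exists>a. L = apartment_lattice b a"
    using comparable_lattices_common_basis by metis
  have "\<exists>a. M j = apartment_lattice b a" if j: "j \<le> m + k" for j
  proof -
    define t where "t = (m + k - j) div k"
    have jt: "j + t * k \<le> m + k" 
      using j div_times_less_eq_dividend[of "m + k - j" k] unfolding t_def by linarith
    have "m + k - j < t * k + k" 
      using dividend_less_times_div[of k "m + k - j"] k by (simp add: t_def mult.commute)
    then have "j + t * k \<in> {m..<m + k + 1}" using jt by auto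
    then have "M (j + t * k) \<in> ?G" by (simp del: upt_Suc)
    then obtain a where a: "M (j + t * k) = apartment_lattice b a" using diag by blast
    have "M 0 \<in> ?F" by (simp del: upt_Suc)
    then obtain a0 where a0: "M 0 = apartment_lattice b a0" using diag by blast
    show ?thesis
      unfolding lattice_path_eq_inter[OF jt] a a0
      by (subst scale_apartment_lattice[OF b]) (auto simp: apartment_lattice_inter[OF b])
  qed
  then obtain a where "\<And>j. j \<le> m + k \<Longrightarrow> M j = apartment_lattice b (a j)" by metis
  with b that show ?thesis by blast
qed

end

theorem combinatorial_imp_geometric_geodesic:
  fixes Ps :: "(('a, 'n::finite) facet \<times> ('a, 'n) vertex) list"
  assumes n: "2 \<le> CARD('n)" and k: "1 \<le> k" and m: "1 \<le> m" and len: "length Ps = m + 1"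
    and geo: "combinatorial_geodesic k Ps"
  shows "geometric_geodesic k (map fst Ps)"
proof -
  obtain M where M: "lattice_path k m M"
    and PM: "\<And>i. i \<le> m \<Longrightarrow> Ps ! i = pointed_facet_of (map M [i..<i + k + 1])"
    using combinatorial_geodesic_lattice_path[OF geo len m] by blast
  obtain b a where b: "indexed_basis b" and a: "\<And>j. j \<le> m + k \<Longrightarrow> M j = apartment_lattice b (a j)"
    using lattice_path_apartment[OF M k] by blast
  have a_less: "a i < a j" if "i < j" "j \<le> m + k" for i j
  proof -
    have "M j \<subseteq> M (Suc i)" using that by (intro lattice_path_antimono[OF M k]) auto
    also have "\<dots> \<subset> M i" using that by (intro lattice_path_psubset_Suc[OF M k]) auto
    finally show ?thesis using that by (simp add: a apartment_lattice_psubset_iff[OF b])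
  qed
  \<comment> \<open>In exponents the intersection is a maximum and the sum of lattices a minimum;
    maximum plus minimum is the sum of the two arguments.\<close>
  have rec: "a (i + k + 1) = (\<lambda>l. a (i + k) l + a (i + 1) l - a i l)" if i: "i < m" for i
  proof -
    have inv: "scale (inverse \<pi>) (apartment_lattice b e) = apartment_lattice b (\<lambda>l. e l - 1)" for e
      using val_inverse[of \<pi>] by (subst scale_apartment_lattice[OF b]) auto
    have "M i \<inter> scale (inverse \<pi>) (M (i + k + 1)) = M (i + 1)"
      "{x + y | x y. x \<in> M i \<and> y \<in> scale (inverse \<pi>) (M (i + k + 1))} = scale (inverse \<pi>) (M (i + k))"
      using M i unfolding lattice_path_def by blast+
    then have "(\<lambda>l. max (a i l) (a (i + k + 1) l - 1)) = a (i + 1)"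
      "(\<lambda>l. min (a i l) (a (i + k + 1) l - 1)) = (\<lambda>l. a (i + k) l - 1)"
      using i by (simp_all add: a inv apartment_lattice_inter[OF b] apartment_lattice_plus[OF b]
          apartment_lattice_eq_iff[OF b] del: add_Suc_right)
    then have "max (a i l) (a (i + k + 1) l - 1) = a (i + 1) l"
      "min (a i l) (a (i + k + 1) l - 1) = a (i + k) l - 1" for l by (auto dest: fun_cong)
    then have "a (i + k + 1) l = a (i + k) l + a (i + 1) l - a i l" for l
      by (smt (verit, best))
    then show ?thesis by blast
  qed
  have fst: "fst (Ps ! i) = (\<lambda>l. apartment_vertex b (a l)) ` {i..i + k}" if "i \<le> m" for i
  proof -
    have "{i..<i + k + 1} = {i..i + k}" by auto
    then show ?thesis
      unfolding PM[OF that] pointed_facet_of_def using that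
      by (auto simp: a image_image simp del: upt_Suc intro!: image_cong)
  qed
  have facet: "facet k (fst (Ps ! i))" if "i \<le> m" for i
    using geo len that unfolding combinatorial_geodesic_def pointed_facet_def by auto
  have sub: "fst (Ps ! i) \<subseteq> apartment_vertices b" if "i \<le> m" for i
    using fst[OF that] by (auto simp: apartment_vertices_def)
  define P where "P l = vertex_coords b (apartment_vertex b (a l))" for l
  have chart: "apartment_chart b ` closed_simplex (fst (Ps ! i)) = convex hull (P ` {i..i + k})" if "i \<le> m" for i
  proof -
    have "vertex_coords b ` fst (Ps ! i) = P ` {i..i + k}"
      unfolding fst[OF that] P_def by (rule image_image)
    then show ?thesis by (simp only: apartment_chart_closed_simplex[OF facet[OF that]])
  qed
  have recP: "P (l + k + 1) = P (l + k) + P (l + 1) - P l" if "l < m" for l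
  proof -
    have "(\<chi> i. real_of_int (a (l + k + 1) i)) =
        (\<chi> i. real_of_int (a (l + k) i)) + (\<chi> i. real_of_int (a (l + 1) i)) - (\<chi> i. real_of_int (a l i))"
      unfolding rec[OF that] by (simp add: vec_eq_iff)
    then show ?thesis
      unfolding P_def vertex_coords_apartment_vertex[OF b] by (simp only: mod_diagonal_add mod_diagonal_diff)
  qed
  \<comment> \<open>Some coordinate \<open>d\<close> has the same exponent at \<open>0\<close> and
    \<open>k\<close>, hence, by the recursion, along the whole path. Compared there, homothetic
    lattices of the path have equal exponents, while the path is strictly decreasing.\<close>
  have distinct: "distinct (map fst Ps)"
  proof -
    have "scale \<pi> (M 0) \<subset> M k" using lattice_path_scale[OF M k, of 0] by simp
    then have "a k < (\<lambda>i. a 0 i + 1)"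
      by (simp add: a scale_apartment_lattice[OF b] apartment_lattice_psubset_iff[OF b])
    then obtain d where "a k d < a 0 d + 1" by (auto simp: less_fun_def le_fun_def not_le)
    then have d: "a k d \<le> a 0 d" by simp
    have ad: "a l d = a 0 d" if "l \<le> m + k" for l
      using that
    proof (induction l rule: less_induct)
      case (less l)
      show ?case
      proof (cases "l \<le> k")
        case True
        have "a 0 d \<le> a l d"
          using less.prems a_less[of 0 l] by (cases "l = 0") (auto simp: less_fun_def le_fun_def)
        moreover have "a l d \<le> a k d"
          using a_less[of l k] True by (cases "l = k") (auto simp: less_fun_def le_fun_def)
        ultimately show ?thesis using d by simp
      next
        case False
        define i where "i = l - k - 1"
        with False have i: "l = i + k + 1" by simp
        then have "i < m" using less.prems by simp
        then have "a l d = a (i + k) d + a (i + 1) d - a i d" unfolding i by (simp only: rec)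
        then show ?thesis using less.IH[of "i + k"] less.IH[of "i + 1"] less.IH[of i] i less.prems k
          by simp
      qed
    qed
    have "fst (Ps ! i) \<noteq> fst (Ps ! j)" if ij: "i < j" "j \<le> m" for i j
    proof
      assume eq: "fst (Ps ! i) = fst (Ps ! j)"
      have "i \<le> m" using ij by simp
      have "apartment_vertex b (a i) \<in> fst (Ps ! i)" unfolding fst[OF \<open>i \<le> m\<close>] by (rule imageI) simp
      then have "apartment_vertex b (a i) \<in> (\<lambda>l. apartment_vertex b (a l)) ` {j..j + k}"
        unfolding eq fst[OF ij(2)] .
      then obtain l where l: "j \<le> l" "l \<le> j + k" "apartment_vertex b (a i) = apartment_vertex b (a l)" by auto
      then obtain c where c: "\<And>x. a l x = a i x + c" unfolding apartment_vertex_eq_iff[OF b] by blast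
      have "c = 0" using c[of d] ad[of l] ad[of i] l ij by simp
      then have "a l = a i" using c by (simp add: fun_eq_iff)
      moreover have "a i < a l" using l ij by (intro a_less) auto
      ultimately show False by simp
    qed
    then show ?thesis
      using len by (auto simp: distinct_conv_nth) (metis less_Suc_eq_le linorder_neqE_nat)
  qed
  show ?thesis
    unfolding geometric_geodesic_def
  proof (intro conjI allI impI)
    show "map fst Ps \<noteq> []" using len by auto
    show "distinct (map fst Ps)" by (rule distinct)
    show "\<forall>C\<in>set (map fst Ps). facet k C"
      using geo by (auto simp: combinatorial_geodesic_def pointed_facet_def)
    fix i j assume ij: "i \<le> j \<and> j < length (map fst Ps)"
    then have nth: "map fst Ps ! l = fst (Ps ! l)" if "l \<le> j" for l using that by simp
    have jm: "j \<le> m" using ij len by simp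
    let ?U = "\<Union>l\<in>{i..j}. closed_simplex (fst (Ps ! l))"
    let ?S = "closed_simplex (fst (Ps ! i)) \<union> closed_simplex (fst (Ps ! j))"
    have "geodesic_convex_hull realization building_dist ?S = ?U"
    proof (rule geodesic_convex_hull_in_apartment[OF n b])
      show "?U \<subseteq> apartment b"
      proof (rule UN_least)
        fix l assume "l \<in> {i..j}"
        then have l: "l \<le> m" using jm by simp
        show "closed_simplex (fst (Ps ! l)) \<subseteq> apartment b"
          by (rule closed_simplex_subset_apartment[OF facet[OF l] sub[OF l]])
      qed
      show "?S \<subseteq> ?U" using ij by auto
      have "apartment_chart b ` ?U = (\<Union>l\<in>{i..j}. convex hull (P ` {l..l + k}))"
        unfolding image_UN using chart jm by (intro SUP_cong) auto
      also have "\<dots> = convex hull (convex hull (P ` {i..i + k}) \<union> convex hull (P ` {j..j + k}))"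
        using k ij jm recP by (intro straight_path_hull[where m = m]) auto
      also have "\<dots> = convex hull (apartment_chart b ` ?S)"
        using chart[of i] chart[of j] ij jm by (simp add: image_Un)
      finally show "apartment_chart b ` ?U = convex hull (apartment_chart b ` ?S)" .
    qed
    moreover have "?U = (\<Union>l\<in>{i..j}. closed_simplex (map fst Ps ! l))"
    proof (rule SUP_cong)
      fix l assume "l \<in> {i..j}"
      then have "l \<le> j" by simp
      then show "closed_simplex (fst (Ps ! l)) = closed_simplex (map fst Ps ! l)" by (simp only: nth)
    qed simp
    moreover have "i \<le> j" using ij by simp
    ultimately show "geodesic_convex_hull realization building_dist
        (closed_simplex (map fst Ps ! i) \<union> closed_simplex (map fst Ps ! j)) =
        (\<Union>l\<in>{i..j}. closed_simplex (map fst Ps ! l))"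
      by (simp only: nth[OF \<open>i \<le> j\<close>] nth[OF order_refl])
  qed
qed

end

section \<open>Geometric geodesics are combinatorial geodesics\<close>

definition affine_function :: "('v::real_vector \<Rightarrow> real) \<Rightarrow> bool" where
  "affine_function f \<longleftrightarrow> (\<forall>s t x y. s + t = 1 \<longrightarrow> f (s *\<^sub>R x + t *\<^sub>R y) = s * f x + t * f y)"

lemma affine_functionD:
  "affine_function f \<Longrightarrow> s + t = 1 \<Longrightarrow> f (s *\<^sub>R x + t *\<^sub>R y) = s * f x + t * f y"
  by (simp add: affine_function_def)

lemma affine_function_add:
  "affine_function f \<Longrightarrow> affine_function g \<Longrightarrow> affine_function (\<lambda>x. f x + g x)"
  by (simp add: affine_function_def algebra_simps)

lemma affine_function_reflect:
  assumes f: "affine_function f"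
  shows "f (x + y - z) = f x + f y - f z"
proof -
  have "x + y - z = 2 *\<^sub>R ((1/2) *\<^sub>R x + (1/2) *\<^sub>R y) + (- 1) *\<^sub>R z"
    by (simp add: algebra_simps)
  also have "f \<dots> = 2 * f ((1/2) *\<^sub>R x + (1/2) *\<^sub>R y) + (- 1) * f z"
    by (rule affine_functionD[OF f]) simp
  also have "f ((1/2) *\<^sub>R x + (1/2) *\<^sub>R y) = (1/2) * f x + (1/2) * f y"
    by (rule affine_functionD[OF f]) simp
  finally show ?thesis by (simp add: algebra_simps)
qed

lemma affine_function_hull_nonneg:
  assumes f: "affine_function f" and S: "\<And>x. x \<in> S \<Longrightarrow> 0 \<le> f x" and x: "x \<in> convex hull S"
  shows "0 \<le> f x"
proof -
  have "convex {x. 0 \<le> f x}"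
    by (rule convexI) (simp add: affine_functionD[OF f])
  then have "convex hull S \<subseteq> {x. 0 \<le> f x}" using S by (intro hull_minimal) auto
  with x show ?thesis by blast
qed

text \<open>
  Passing to the other facet that is opposite in the link: the vertex \<open>a i\<close> is replaced by its
  mirror image with respect to the midpoint of its two neighbours in the cyclic order.
\<close>

definition mutate :: "int \<Rightarrow> int \<Rightarrow> (int \<Rightarrow> 'n \<Rightarrow> int) \<Rightarrow> int \<Rightarrow> 'n \<Rightarrow> int" where
  "mutate p i a j = (if p dvd j - i then (\<lambda>x. a (j + 1) x + a (j - 1) x - a j x) else a j)"

lemma mutate_cong: "p dvd i - i' \<Longrightarrow> mutate p i a = mutate p i' a"
proof -
  assume "p dvd i - i'"
  then have "p dvd j - i \<longleftrightarrow> p dvd j - i'" for j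
    using dvd_add_right_iff[of p "i - i'" "j - i"] by simp
  then show ?thesis by (simp add: mutate_def fun_eq_iff)
qed

lemma not_dvd_neighbours:
  fixes p j i :: int
  assumes p: "2 \<le> p" and d: "p dvd j - i"
  shows "\<not> p dvd j + 1 - i" "\<not> p dvd j - 1 - i"
proof -
  have "\<not> p dvd 1" using p zdvd_imp_le[of p 1] by auto
  then show "\<not> p dvd j + 1 - i"
    using dvd_add_right_iff[OF d, of 1] by (simp add: algebra_simps)
  have "\<not> p dvd - 1" using \<open>\<not> p dvd 1\<close> by simp
  then show "\<not> p dvd j - 1 - i"
    using dvd_add_right_iff[OF d, of "- 1"] by (simp add: algebra_simps)
qed

lemma mutate_mutate:
  assumes "2 \<le> p"
  shows "mutate p i (mutate p i a) = a"
proof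
  fix j
  show "mutate p i (mutate p i a) j = a j"
  proof (cases "p dvd j - i")
    case True
    with not_dvd_neighbours[OF assms True] show ?thesis by (simp add: mutate_def)
  qed (simp add: mutate_def)
qed

text \<open>Mutation exchanges the increments before and after the index \<open>i\<close>, so
  strictness is inherited; \<open>2 \<le> p\<close> keeps the neighbours of \<open>i\<close>
  fixed.\<close>

lemma alcove_chain_mutate:
  assumes a: "alcove_chain p a" and p: "2 \<le> p"
  shows "alcove_chain p (mutate p i a)"
  unfolding alcove_chain_def
proof (intro conjI allI)
  show "0 < p" using p by simp
next
  fix j
  note strict = alcove_chain_strict[OF a]
  have le: "a l x \<le> a (l + 1) x" for l x by (rule alcove_chain_le[OF a]) simp
  have ex: "\<exists>x. a l x < a (l + 1) x" for l
    using strict[of l "l + 1"] by (auto simp: less_fun_def le_fun_def not_le)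
  show "mutate p i a j < mutate p i a (j + 1)"
  proof (cases "p dvd j - i")
    case True
    then have "mutate p i a j = (\<lambda>x. a (j + 1) x + a (j - 1) x - a j x)" "mutate p i a (j + 1) = a (j + 1)"
      using not_dvd_neighbours[OF p True] by (simp_all add: mutate_def)
    moreover obtain x where "a (j - 1) x < a j x" using ex[of "j - 1"] by auto
    moreover have "a (j - 1) x \<le> a j x" for x using le[of "j - 1"] by simp
    ultimately show ?thesis by (auto simp: less_fun_def le_fun_def not_le intro!: exI[of _ x])
  next
    case F: False
    show ?thesis
    proof (cases "p dvd j + 1 - i")
      case True
      then have "mutate p i a (j + 1) = (\<lambda>x. a (2 + j) x + a j x - a (j + 1) x)" "mutate p i a j = a j"
        using F by (simp_all add: mutate_def)
      moreover obtain x where "a (j + 1) x < a (2 + j) x" using ex[of "j + 1"] by auto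
      moreover have "a (j + 1) x \<le> a (2 + j) x" for x using le[of "j + 1"] by simp
      ultimately show ?thesis by (auto simp: less_fun_def le_fun_def not_le intro!: exI[of _ x])
    next
      case False
      with F strict show ?thesis by (simp add: mutate_def)
    qed
  qed
next
  fix j x
  have per: "a (l + p) x = a l x + 1" for l using a by (simp add: alcove_chain_def)
  have d: "p dvd j + p - i \<longleftrightarrow> p dvd j - i"
    using dvd_add_right_iff[of p p "j - i"] by (simp add: algebra_simps)
  have "a (j + p + 1) x = a (j + 1) x + 1" "a (j + p - 1) x = a (j - 1) x + 1"
    using per[of "j + 1"] per[of "j - 1"] by (simp_all add: algebra_simps)
  then show "mutate p i a (j + p) x = mutate p i a j x + 1"
    by (simp add: mutate_def d per)
qed

section \<open>Barycentric coordinates as affine functions, and convexity of unions of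
  simplices\<close>

context nonarch_local_field
begin

text \<open>
  The \<open>j\<close>-th barycentric coordinate with respect to an alcove chain, as an affine function on the
  whole chart; the two coordinate indices are places where \<open>a (j - 1)\<close>, \<open>a j\<close> and
  \<open>a j\<close>, \<open>a (j + 1)\<close> differ.
\<close>

definition weight_at :: "(int \<Rightarrow> 'n::finite \<Rightarrow> int) \<Rightarrow> int \<Rightarrow> 'n \<Rightarrow> 'n \<Rightarrow> real ^ 'n \<Rightarrow> real" where
  "weight_at a j y z q = 1 + (q $ y - q $ z) - real_of_int (a j y - a j z)"

definition weight :: "(int \<Rightarrow> 'n::finite \<Rightarrow> int) \<Rightarrow> int \<Rightarrow> real ^ 'n \<Rightarrow> real" where
  "weight a j = weight_at a j (SOME y. a j y = a (j - 1) y + 1) (SOME z. a (j + 1) z = a j z + 1)"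

lemma affine_weight_at: "affine_function (weight_at a j y z)"
  unfolding affine_function_def
proof (intro allI impI)
  fix s t :: real and q q' assume st: "s + t = 1"
  let ?c = "1 - real_of_int (a j y - a j z)"
  have "weight_at a j y z (s *\<^sub>R q + t *\<^sub>R q') = (s + t) * ?c + s * (q $ y - q $ z) + t * (q' $ y - q' $ z)"
    unfolding st by (simp add: weight_at_def algebra_simps)
  then show "weight_at a j y z (s *\<^sub>R q + t *\<^sub>R q') = s * weight_at a j y z q + t * weight_at a j y z q'"
    by (simp add: weight_at_def algebra_simps)
qed

lemma affine_weight: "affine_function (weight a j)"
  unfolding weight_def by (rule affine_weight_at)

definition chart_vertex ::
    "('n::finite \<Rightarrow> 'a ^ 'n) \<Rightarrow> (int \<Rightarrow> 'n \<Rightarrow> int) \<Rightarrow> int \<Rightarrow> real ^ 'n" where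
  "chart_vertex b c j = vertex_coords b (apartment_vertex b (c j))"

lemma vertex_point_closed_simplex:
  "finite C \<Longrightarrow> v \<in> C \<Longrightarrow> (\<lambda>w. if w = v then 1 else 0) \<in> closed_simplex C"
  by (auto simp: closed_simplex_def)

lemma apartment_chart_vertex_point:
  "apartment_chart b (\<lambda>w. if w = v then 1 else 0) = vertex_coords b v"
proof -
  have "{w. (if w = v then 1 else 0 :: real) \<noteq> 0} = {v}" by auto
  then show ?thesis by (simp add: apartment_chart_def)
qed

context
  fixes b :: "'n::finite \<Rightarrow> 'a ^ 'n" and a :: "int \<Rightarrow> 'n \<Rightarrow> int" and k :: nat
  assumes b: "indexed_basis b" and a: "alcove_chain (int k + 1) a"
begin

lemma weight_at_closed_simplex:
  assumes x: "x \<in> closed_simplex (chain_facet b a)"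
    and y: "a j y = a (j - 1) y + 1" and z: "a (j + 1) z = a j z + 1"
  shows "weight_at a j y z (apartment_chart b x) = x (apartment_vertex b (a j))"
  unfolding weight_eq[OF b a x y z] weight_at_def apartment_chart_eq mod_diagonal_component_diff
  by simp

lemma weight_closed_simplex:
  assumes x: "x \<in> closed_simplex (chain_facet b a)"
  shows "weight a j (apartment_chart b x) = x (apartment_vertex b (a j))"
  unfolding weight_def
proof (rule weight_at_closed_simplex[OF x])
  have "\<exists>y. a j y = a (j - 1) y + 1" using alcove_chain_step_up[OF a, of "j - 1"] by simp
  then show "a j (SOME y. a j y = a (j - 1) y + 1) = a (j - 1) (SOME y. a j y = a (j - 1) y + 1) + 1"
    by (rule someI_ex)
  show "a (j + 1) (SOME z. a (j + 1) z = a j z + 1) = a j (SOME z. a (j + 1) z = a j z + 1) + 1"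
    using alcove_chain_step_up[OF a, of j] by (rule someI_ex)
qed

lemma chain_facet_finite: "finite (chain_facet b a)"
  by (rule facet_finite[OF facet_chain_facet[OF b a]])

lemma weight_chart_vertex:
  "weight a j (chart_vertex b a s) = (if int k + 1 dvd s - j then 1 else 0)"
proof -
  let ?x = "\<lambda>w. if w = apartment_vertex b (a s) then 1 else 0 :: real"
  have x: "?x \<in> closed_simplex (chain_facet b a)"
    using chain_facet_finite by (intro vertex_point_closed_simplex) auto
  have "weight a j (chart_vertex b a s) = ?x (apartment_vertex b (a j))"
    using weight_closed_simplex[OF x, of j] by (simp only: chart_vertex_def apartment_chart_vertex_point)
  then show ?thesis using chain_vertex_eq_iff[OF b a, of j s] by simp
qed

end

lemma chart_vertex_eq:
  assumes b: "indexed_basis b"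
  shows "chart_vertex b c j = mod_diagonal (\<chi> i. real_of_int (c j i))"
  by (simp add: chart_vertex_def vertex_coords_apartment_vertex[OF b])

lemma chart_vertex_reflect:
  assumes b: "indexed_basis b" and d: "d l = (\<lambda>x. a i x + a' i' x - a'' i'' x)"
  shows "chart_vertex b d l = chart_vertex b a i + chart_vertex b a' i' - chart_vertex b a'' i''"
proof -
  have "(\<chi> x. real_of_int (d l x)) =
      (\<chi> x. real_of_int (a i x)) + (\<chi> x. real_of_int (a' i' x)) - (\<chi> x. real_of_int (a'' i'' x))"
    unfolding d by (simp add: vec_eq_iff)
  then show ?thesis
    unfolding chart_vertex_eq[OF b] by (simp only: mod_diagonal_add mod_diagonal_diff)
qed

abbreviation chart_simplex :: "('n::finite \<Rightarrow> 'a ^ 'n) \<Rightarrow> (int \<Rightarrow> 'n \<Rightarrow> int) \<Rightarrow> (real ^ 'n) set" where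
  "chart_simplex b a \<equiv> convex hull (range (chart_vertex b a))"

lemma apartment_chart_chain_facet:
  assumes b: "indexed_basis b" and a: "alcove_chain (int k + 1) a"
  shows "apartment_chart b ` closed_simplex (chain_facet b a) = chart_simplex b a"
  unfolding apartment_chart_closed_simplex[OF facet_chain_facet[OF b a]]
  by (simp add: image_image chart_vertex_def[abs_def])

lemma affine_function_simplex_nonneg:
  assumes "affine_function f" "\<And>s. 0 \<le> f (chart_vertex b a s)" "q \<in> chart_simplex b a"
  shows "0 \<le> f q"
  by (rule affine_function_hull_nonneg[OF assms(1) _ assms(3)]) (use assms(2) in auto)

lemma chain_facet_mutate:
  assumes b: "indexed_basis b" and a: "alcove_chain (int k + 1) a" and k: "1 \<le> k"
  shows "chain_facet b (mutate (int k + 1) i a) =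
    insert (apartment_vertex b (\<lambda>x. a (i + 1) x + a (i - 1) x - a i x)) (chain_facet b a - {apartment_vertex b (a i)})"
    (is "_ = insert ?r _")
proof -
  let ?p = "int k + 1"
  have r: "apartment_vertex b (mutate ?p i a j) = ?r" if d: "?p dvd j - i" for j
  proof -
    obtain n where n: "j = i + ?p * n" using d by (metis dvdE diff_add_cancel add.commute)
    have "a (i + 1 + ?p * n) x = a (i + 1) x + n" "a (i - 1 + ?p * n) x = a (i - 1) x + n"
      "a (i + ?p * n) x = a i x + n" for x
      by (rule alcove_chain_period[OF a])+
    then have "a (j + 1) x + a (j - 1) x - a j x = a (i + 1) x + a (i - 1) x - a i x + n" for x
      unfolding n by (simp add: algebra_simps)
    then show ?thesis
      using d unfolding apartment_vertex_eq_iff[OF b] by (intro exI[of _ "- n"]) (simp add: mutate_def)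
  qed
  have other: "apartment_vertex b (mutate ?p i a j) = apartment_vertex b (a j)" if "\<not> ?p dvd j - i" for j
    using that by (simp add: mutate_def)
  have eq: "apartment_vertex b (a j) = apartment_vertex b (a i) \<longleftrightarrow> ?p dvd j - i" for j
    using chain_vertex_eq_iff[OF b a, of i j] by metis
  show ?thesis
  proof (intro subset_antisym subsetI)
    fix v assume "v \<in> chain_facet b (mutate ?p i a)"
    then obtain j where v: "v = apartment_vertex b (mutate ?p i a j)" by auto
    show "v \<in> insert ?r (chain_facet b a - {apartment_vertex b (a i)})"
    proof (cases "?p dvd j - i")
      case True
      then show ?thesis unfolding v r[OF True] by simp
    next
      case False
      then show ?thesis unfolding v other[OF False] using eq[of j] by simp
    qed
  next
    fix v assume v: "v \<in> insert ?r (chain_facet b a - {apartment_vertex b (a i)})"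
    show "v \<in> chain_facet b (mutate ?p i a)"
    proof (cases "v = ?r")
      case True
      then have "v = apartment_vertex b (mutate ?p i a i)" using r[of i] by simp
      then show ?thesis by (rule range_eqI)
    next
      case False
      with v obtain j where j: "v = apartment_vertex b (a j)" "v \<noteq> apartment_vertex b (a i)" by auto
      then have nd: "\<not> ?p dvd j - i" using eq[of j] by simp
      have "v = apartment_vertex b (mutate ?p i a j)" by (simp only: j(1) other[OF nd])
      then show ?thesis by (rule range_eqI)
    qed
  qed
qed

lemma neighbour_differences:
  assumes a: "alcove_chain (int k + 1) a" and k: "1 \<le> k"
  shows "a (i - 1) x \<le> a i x" "a i x \<le> a (i + 1) x" "a (i + 1) x \<le> a (i - 1) x + 1"
  using alcove_chain_le[OF a, of "i - 1" i x] alcove_chain_le[OF a, of i "i + 1" x]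
    alcove_chain_window(2)[OF a, of "i - 1" "i + 1" x] k by simp_all

lemma vertex_notin_mutate:
  assumes b: "indexed_basis b" and a: "alcove_chain (int k + 1) a" and k: "1 \<le> k"
  shows "apartment_vertex b (a i) \<notin> chain_facet b (mutate (int k + 1) i a)"
proof -
  have "apartment_vertex b (a i) \<noteq> apartment_vertex b (\<lambda>x. a (i + 1) x + a (i - 1) x - a i x)"
  proof
    assume "apartment_vertex b (a i) = apartment_vertex b (\<lambda>x. a (i + 1) x + a (i - 1) x - a i x)"
    then obtain c where c: "\<And>x. a (i + 1) x + a (i - 1) x - a i x = a i x + c"
      unfolding apartment_vertex_eq_iff[OF b] by blast
    obtain y where "a (i + 1) y = a i y + 1" using alcove_chain_step_up[OF a, of i] by auto
    moreover obtain z where "a i z = a (i - 1) z + 1" using alcove_chain_step_up[OF a, of "i - 1"] by auto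
    ultimately show False
      using c[of y] c[of z] neighbour_differences[OF a k, of i y] neighbour_differences[OF a k, of i z] by linarith
  qed
  then show ?thesis unfolding chain_facet_mutate[OF b a k] by simp
qed

text \<open>A segment between vertices \<open>v\<close> and \<open>w\<close>, each in only one of
  the facets, crosses the intersection of the simplices. There the weight of \<open>v\<close>
  vanishes, so at \<open>w\<close> it is negative. Hence only one vertex is exchanged, and the
  bounded oscillation of exponents in a facet leaves only the mirror image for
  \<open>w\<close>.\<close>

lemma adjacent_facets_mutate:
  fixes b :: "'n::finite \<Rightarrow> 'a ^ 'n"
  assumes b: "indexed_basis b" and k: "1 \<le> k"
    and a: "alcove_chain (int k + 1) a" and a': "alcove_chain (int k + 1) a'"
    and ne: "chain_facet b a \<noteq> chain_facet b a'" and conv: "convex (chart_simplex b a \<union> chart_simplex b a')"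
  shows "\<exists>i. chain_facet b a' = chain_facet b (mutate (int k + 1) i a)"
proof -
  let ?p = "int k + 1" and ?C = "chain_facet b a" and ?C' = "chain_facet b a'"
  have C: "facet k ?C" and C': "facet k ?C'" using facet_chain_facet[OF b] a a' by auto
  have fin: "finite ?C" "finite ?C'" using C C' facet_finite by auto
  have card: "card ?C = card ?C'" using facet_card[OF C] facet_card[OF C'] by simp
  have sub: "closed_simplex ?C \<subseteq> apartment b" "closed_simplex ?C' \<subseteq> apartment b"
    by (rule closed_simplex_subset_apartment[OF C], auto simp: apartment_vertices_def)
      (rule subsetD[OF closed_simplex_subset_apartment[OF C']], auto simp: apartment_vertices_def)
  \<comment> \<open>The segment is connected and covered by two closed simplices, so some point of
    it lies in both; the parameter is neither 0 nor 1, since otherwise \<open>v\<close> or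
    \<open>w\<close> would belong to both facets.\<close>
  have crossing: "\<exists>x t. x \<in> closed_simplex ?C \<and> x \<in> closed_simplex ?C' \<and> 0 < t \<and> t < 1 \<and>
      apartment_chart b x = (1 - t) *\<^sub>R vertex_coords b v + t *\<^sub>R vertex_coords b w"
    if v: "v \<in> ?C" "v \<notin> ?C'" and w: "w \<in> ?C'" "w \<notin> ?C" for v w
  proof -
    let ?p = "vertex_coords b v" and ?q = "vertex_coords b w"
    let ?\<delta> = "\<lambda>v u. if u = v then 1 else 0 :: real"
    have \<delta>: "?\<delta> v \<in> closed_simplex ?C" "?\<delta> w \<in> closed_simplex ?C'"
      using v(1) w(1) fin by (auto intro: vertex_point_closed_simplex)
    have pC: "?p \<in> chart_simplex b a" and qC: "?q \<in> chart_simplex b a'"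
      using v(1) w(1) by (auto simp: chart_vertex_def intro!: hull_inc)
    have "closed (chart_simplex b a)" "closed (chart_simplex b a')"
    proof -
      have "range (chart_vertex b c) = vertex_coords b ` chain_facet b c" for c
        by (simp add: image_image chart_vertex_def)
      then have "finite (range (chart_vertex b a))" "finite (range (chart_vertex b a'))" using fin by simp_all
      then show "closed (chart_simplex b a)" "closed (chart_simplex b a')"
        by (simp_all add: finite_imp_compact_convex_hull compact_imp_closed)
    qed
    moreover have "closed_segment ?p ?q \<subseteq> chart_simplex b a \<union> chart_simplex b a'"
      using conv pC qC by (intro closed_segment_subset) auto
    moreover have "chart_simplex b a \<inter> closed_segment ?p ?q \<noteq> {}" "chart_simplex b a' \<inter> closed_segment ?p ?q \<noteq> {}"
      using pC qC by auto
    ultimately have "chart_simplex b a \<inter> chart_simplex b a' \<inter> closed_segment ?p ?q \<noteq> {}"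
      using connected_closedD[OF connected_segment(1)[of ?p ?q], of "chart_simplex b a" "chart_simplex b a'"]
      by metis
    then obtain q where q: "q \<in> chart_simplex b a" "q \<in> chart_simplex b a'" "q \<in> closed_segment ?p ?q" by blast
    obtain t where t: "0 \<le> t" "t \<le> 1" "q = (1 - t) *\<^sub>R ?p + t *\<^sub>R ?q"
      using q(3) unfolding in_segment by blast
    obtain x where x: "x \<in> closed_simplex ?C" "apartment_chart b x = q"
      using q(1) unfolding apartment_chart_chain_facet[OF b a, symmetric] by (elim imageE) simp
    obtain x' where x': "x' \<in> closed_simplex ?C'" "apartment_chart b x' = q"
      using q(2) unfolding apartment_chart_chain_facet[OF b a', symmetric] by (elim imageE) simp
    have "x = x'" using x x' sub by (intro apartment_chart_inject[OF b]) auto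
    have "t \<noteq> 0"
    proof
      assume "t = 0"
      then have "apartment_chart b x' = apartment_chart b (?\<delta> v)"
        unfolding x'(2) t(3) apartment_chart_vertex_point by simp
      then have "x' = ?\<delta> v" using x'(1) \<delta>(1) sub by (intro apartment_chart_inject[OF b]) auto
      then have "x' v \<noteq> 0" by simp
      with x'(1) v(2) show False by (simp add: closed_simplex_def)
    qed
    moreover have "t \<noteq> 1"
    proof
      assume "t = 1"
      then have "apartment_chart b x = apartment_chart b (?\<delta> w)"
        unfolding x(2) t(3) apartment_chart_vertex_point by simp
      then have "x = ?\<delta> w" using x(1) \<delta>(2) sub by (intro apartment_chart_inject[OF b]) auto
      then have "x w \<noteq> 0" by simp
      with x(1) w(2) show False by (simp add: closed_simplex_def)
    qed
    ultimately have "0 < t" "t < 1" using t(1,2) by auto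
    moreover have "x \<in> closed_simplex ?C'" using x'(1) \<open>x = x'\<close> by simp
    moreover have "apartment_chart b x = (1 - t) *\<^sub>R ?p + t *\<^sub>R ?q" using x(2) t(3) by simp
    ultimately show ?thesis using x(1) by (intro exI[of _ x] exI[of _ t] conjI)
  qed
  have zero: "x v = 0" if "x \<in> closed_simplex D" "v \<notin> D" for x :: "('a, 'n) point" and v D
    using that by (simp add: closed_simplex_def)
  have "\<not> ?C \<subseteq> ?C'"
  proof
    assume "?C \<subseteq> ?C'"
    from card_subset_eq[OF fin(2) this card] ne show False by (rule notE[rotated])
  qed
  then obtain v where v: "v \<in> ?C" "v \<notin> ?C'" by auto
  have "\<not> ?C' \<subseteq> ?C"
  proof
    assume "?C' \<subseteq> ?C"
    from card_subset_eq[OF fin(1) this card[symmetric]] ne[symmetric] show False by (rule notE[rotated])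
  qed
  then obtain w where w: "w \<in> ?C'" "w \<notin> ?C" by auto
  obtain i where i: "v = apartment_vertex b (a i)" using v(1) by auto
  have neg: "weight_at a i y z (vertex_coords b w) < 0"
    if y: "a i y = a (i - 1) y + 1" and z: "a (i + 1) z = a i z + 1" for y z
  proof -
    let ?f = "weight_at a i y z"
    obtain x t where x: "x \<in> closed_simplex ?C" "x \<in> closed_simplex ?C'" and t: "0 < t" "t < 1"
      and eq: "apartment_chart b x = (1 - t) *\<^sub>R vertex_coords b v + t *\<^sub>R vertex_coords b w"
      using crossing[OF v w] by blast
    have "x v = 0" by (rule zero[OF x(2) v(2)])
    then have "0 = ?f (apartment_chart b x)" using weight_at_closed_simplex[OF b a x(1) y z] i by simp
    also have "\<dots> = (1 - t) * ?f (vertex_coords b v) + t * ?f (vertex_coords b w)"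
      unfolding eq by (rule affine_functionD[OF affine_weight_at]) simp
    also have "?f (vertex_coords b v) = 1"
      using weight_at_closed_simplex[OF b a vertex_point_closed_simplex[OF fin(1) v(1)] y z] i
      by (simp add: apartment_chart_vertex_point)
    finally have "t * ?f (vertex_coords b w) < 0" using t by simp
    then show ?thesis using t by (simp add: mult_less_0_iff)
  qed
  \<comment> \<open>With a second vertex \<open>v'\<close> missing in the other facet, the weight of
    \<open>v\<close> would run from 0 at \<open>v'\<close> to a negative value at \<open>w\<close>
    and could not vanish at the crossing.\<close>
  have uniq: "v' = v" if v': "v' \<in> ?C" "v' \<notin> ?C'" for v'
  proof (rule ccontr)
    assume ne: "v' \<noteq> v"
    obtain y where y: "a i y = a (i - 1) y + 1" using alcove_chain_step_up[OF a, of "i - 1"] by auto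
    obtain z where z: "a (i + 1) z = a i z + 1" using alcove_chain_step_up[OF a, of i] by auto
    let ?f = "weight_at a i y z"
    obtain x t where x: "x \<in> closed_simplex ?C" "x \<in> closed_simplex ?C'" and t: "0 < t" "t < 1"
      and eq: "apartment_chart b x = (1 - t) *\<^sub>R vertex_coords b v' + t *\<^sub>R vertex_coords b w"
      using crossing[OF v' w] by blast
    have "x v = 0" by (rule zero[OF x(2) v(2)])
    then have "0 = ?f (apartment_chart b x)" using weight_at_closed_simplex[OF b a x(1) y z] i by simp
    also have "\<dots> = (1 - t) * ?f (vertex_coords b v') + t * ?f (vertex_coords b w)"
      unfolding eq by (rule affine_functionD[OF affine_weight_at]) simp
    also have "?f (vertex_coords b v') = 0"
      using weight_at_closed_simplex[OF b a vertex_point_closed_simplex[OF fin(1) v'(1)] y z] i ne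
      by (simp add: apartment_chart_vertex_point)
    finally show False using t neg[OF y z] by simp
  qed
  have C'eq: "?C' = insert w (?C - {v})"
  proof (rule card_subset_eq[OF fin(2), symmetric])
    show "insert w (?C - {v}) \<subseteq> ?C'" using w uniq by auto
    have "card (insert w (?C - {v})) = Suc (card (?C - {v}))" using fin w by simp
    also have "\<dots> = card ?C" by (rule card.remove[OF fin(1) v(1), symmetric])
    finally show "card (insert w (?C - {v})) = card ?C'" using card by simp
  qed
  obtain \<beta> where \<beta>: "w = apartment_vertex b \<beta>" using w(1) by auto
  have nb: "apartment_vertex b (a l) \<in> ?C'" if "l = i + 1 \<or> l = i - 1" for l
  proof -
    have p2: "2 \<le> ?p" using k by simp
    have "\<not> ?p dvd l - i" using that not_dvd_neighbours[OF p2, of i i] by fastforce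
    then have "apartment_vertex b (a l) \<noteq> v" using chain_vertex_eq_iff[OF b a, of i l] i by metis
    then show ?thesis unfolding C'eq by simp
  qed
  define D where "D x = \<beta> x - a (i + 1) x" for x
  have Dosc: "D x - D x' \<le> 1" for x x'
    unfolding D_def using facet_oscillation[OF C' b, of \<beta> "a (i + 1)"] w(1) nb \<beta> by simp
  have Eosc: "(\<beta> x - a (i - 1) x) - (\<beta> x' - a (i - 1) x') \<le> 1" for x x'
    using facet_oscillation[OF C' b, of \<beta> "a (i - 1)"] w(1) nb \<beta> by simp
  note nd = neighbour_differences[OF a k, of i]
  have step: "D z = D y + 1" if y: "a i y = a (i - 1) y + 1" and z: "a (i + 1) z = a i z + 1" for y z
  proof -
    have "weight_at a i y z (vertex_coords b w) = 1 + real_of_int (\<beta> y - \<beta> z) - real_of_int (a i y - a i z)"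
      unfolding weight_at_def \<beta> vertex_coords_apartment_vertex[OF b] mod_diagonal_component_diff by simp
    then have "1 + (\<beta> y - \<beta> z) - (a i y - a i z) < 0" using neg[OF y z] by linarith
    moreover have "a (i + 1) y = a i y" using y nd[of y] by simp
    ultimately have "D y < D z" using z by (simp add: D_def)
    then show ?thesis using Dosc[of z y] by simp
  qed
  obtain y0 where y0: "a i y0 = a (i - 1) y0 + 1" using alcove_chain_step_up[OF a, of "i - 1"] by auto
  obtain z0 where z0: "a (i + 1) z0 = a i z0 + 1" using alcove_chain_step_up[OF a, of i] by auto
  \<comment> \<open>Each coordinate jumps before \<open>i\<close>, after \<open>i\<close> or not at
    all. The comparison of \<open>y0\<close> with \<open>z0\<close> fixes the constant, and for
    coordinates without a jump the two oscillation bounds meet.\<close>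
  have "a (i + 1) x + a (i - 1) x - a i x = \<beta> x + (- (D y0 + 1))" for x
  proof -
    consider (low) "a i x = a (i - 1) x + 1" | (high) "a (i + 1) x = a i x + 1"
      | (none) "a i x = a (i - 1) x" "a (i + 1) x = a i x" using nd[of x] by linarith
    then show ?thesis
    proof cases
      case low
      then show ?thesis using step[OF low z0] step[OF y0 z0] by (simp add: D_def)
    next
      case high
      then show ?thesis using step[OF y0 high] nd[of x] by (simp add: D_def)
    next
      case none
      have "D x \<le> D y0 + 1" using Dosc[of x y0] by simp
      moreover have "D y0 + 1 \<le> D x"
        using Eosc[of z0 x] step[OF y0 z0] none z0 nd[of z0] by (simp add: D_def)
      ultimately show ?thesis using none by (simp add: D_def)
    qed
  qed
  then have "w = apartment_vertex b (\<lambda>x. a (i + 1) x + a (i - 1) x - a i x)"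
    unfolding \<beta> apartment_vertex_eq_iff[OF b] by blast
  then have "?C' = chain_facet b (mutate ?p i a)"
    unfolding chain_facet_mutate[OF b a k] C'eq i by simp
  then show ?thesis by (rule exI)
qed

context
  fixes b :: "'n::finite \<Rightarrow> 'a ^ 'n" and a :: "int \<Rightarrow> 'n \<Rightarrow> int" and k :: nat
  assumes b: "indexed_basis b" and k: "1 \<le> k" and a: "alcove_chain (int k + 1) a"
begin

abbreviation "mut \<equiv> mutate (int k + 1)"

lemma chart_vertex_mutate:
  "chart_vertex b (mut i a) s =
    (if int k + 1 dvd s - i then chart_vertex b a (s + 1) + chart_vertex b a (s - 1) - chart_vertex b a s
     else chart_vertex b a s)"
proof (cases "int k + 1 dvd s - i")
  case True
  then show ?thesis using chart_vertex_reflect[OF b, of "mut i a" s a "s + 1" a "s - 1" a s]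
    by (simp add: mutate_def)
qed (simp add: mutate_def chart_vertex_def)

lemma weight_mutate:
  "weight a j (chart_vertex b (mut i a) s) =
    (if int k + 1 dvd s - i then
      (if int k + 1 dvd s + 1 - j then 1 else 0) + (if int k + 1 dvd s - 1 - j then 1 else 0)
        - (if int k + 1 dvd s - j then 1 else 0)
     else (if int k + 1 dvd s - j then 1 else 0))"
  unfolding chart_vertex_mutate
  by (simp add: affine_function_reflect[OF affine_weight] weight_chart_vertex[OF b a])

lemma dvd_trans_diff: "int k + 1 dvd s - i \<Longrightarrow> int k + 1 dvd s + c - j \<longleftrightarrow> int k + 1 dvd i + c - j"
proof -
  assume "int k + 1 dvd s - i"
  from dvd_add_right_iff[OF this, of "i + c - j"] show ?thesis by (simp add: algebra_simps)
qed

lemma weight_mutate_nonneg: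
  assumes "\<not> int k + 1 dvd i - j"
  shows "0 \<le> weight a j (chart_vertex b (mut i a) s)"
  using dvd_trans_diff[of s i 0 j] assms by (auto simp: weight_mutate)

lemma weight_nonneg: "0 \<le> weight a j (chart_vertex b a s)"
  by (simp add: weight_chart_vertex[OF b a])

lemma weight_mutated_vertex: "weight a i (chart_vertex b (mut i a) i) = - 1"
  using not_dvd_neighbours[of "int k + 1" i i] k by (simp add: weight_mutate)

text \<open>
  The midpoint of the two new vertices has two negative coordinates, but each of the three simplices
  only contains points with one of them nonnegative.
\<close>

lemma consecutive_mutations_adjacent:
  assumes conv: "convex (chart_simplex b (mut i a) \<union> chart_simplex b a \<union> chart_simplex b (mut j a))"
    and ij: "\<not> int k + 1 dvd j - i"
  shows "int k + 1 dvd j - (i + 1) \<or> int k + 1 dvd j - (i - 1)"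
proof (rule ccontr)
  assume far: "\<not> ?thesis"
  let ?p = "int k + 1"
  let ?ri = "chart_vertex b (mut i a) i" and ?rj = "chart_vertex b (mut j a) j"
  let ?X = "(1/2) *\<^sub>R ?ri + (1/2) *\<^sub>R ?rj"
  have ji: "\<not> ?p dvd i - j" using ij by (simp add: dvd_diff_commute)
  have "?ri \<in> chart_simplex b (mut i a)" "?rj \<in> chart_simplex b (mut j a)" by (auto intro: hull_inc)
  then have "?X \<in> chart_simplex b (mut i a) \<union> chart_simplex b a \<union> chart_simplex b (mut j a)"
    using conv by (intro convexD) auto
  moreover have X: "weight a l ?X = (1/2) * weight a l ?ri + (1/2) * weight a l ?rj" for l
    by (rule affine_functionD[OF affine_weight]) simp
  have far': "\<not> ?p dvd j + 1 - i" "\<not> ?p dvd j - 1 - i" "\<not> ?p dvd i + 1 - j" "\<not> ?p dvd i - 1 - j"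
    using far by (auto simp: dvd_diff_commute[of _ i] algebra_simps) (metis dvd_diff_commute diff_diff_eq diff_diff_eq2 add.commute add_diff_eq)+
  have "weight a i ?X = - (1/2)" "weight a j ?X = - (1/2)"
    unfolding X weight_mutated_vertex using far' ij ji by (simp_all add: weight_mutate)
  then have neg: "\<not> 0 \<le> weight a i ?X" "\<not> 0 \<le> weight a j ?X" by simp_all
  have "?X \<notin> chart_simplex b (mut i a)"
    using affine_function_simplex_nonneg[OF affine_weight weight_mutate_nonneg[OF ji]] neg(2) by blast
  moreover have "?X \<notin> chart_simplex b a"
    using affine_function_simplex_nonneg[OF affine_weight weight_nonneg] neg(1) by blast
  moreover have "?X \<notin> chart_simplex b (mut j a)"
    using affine_function_simplex_nonneg[OF affine_weight weight_mutate_nonneg[OF ij]] neg(1) by blast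
  ultimately show False by blast
qed

text \<open>The midpoint of the new vertices of the first and the last simplex lies in none of the
  four. Its weight at \<open>i\<close> is negative, which excludes all but the first simplex; there
  the sum of the weights at \<open>i\<close> and \<open>i + e\<close> decides. For
  \<open>k \<ge> 2\<close> the differences 1 and 2 are nonzero modulo \<open>k + 1\<close>.\<close>

lemma no_returning_mutation:
  assumes k2: "2 \<le> k" and e: "e = 1 \<or> e = - 1"
    and conv: "convex (chart_simplex b (mut i a) \<union> chart_simplex b a \<union> chart_simplex b (mut (i + e) a) \<union>
      chart_simplex b (mut i (mut (i + e) a)))"
  shows False
proof -
  let ?p = "int k + 1" and ?j = "i + e"
  let ?a2 = "mut ?j a"
  let ?a3 = "mut i ?a2"
  have small: "\<not> ?p dvd c" if "c \<noteq> 0" "\<bar>c\<bar> \<le> 2" for c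
    using that k2 dvd_imp_le_int[of c ?p] by auto
  have a3i: "?a3 i = (\<lambda>x. (\<lambda>x. a (i + 2 * e) x + a (i - e) x - a (i + e) x) x + a i x - a i x)"
  proof -
    have "\<not> ?p dvd - e" by (rule small) (use e in auto)
    then have "?a2 i x = a i x" for x by (simp add: mutate_def)
    moreover have "?a2 (i + e) x = a (i + 2 * e) x + a i x - a (i + e) x" for x
    proof -
      have "?a2 (i + e) x = a (i + e + 1) x + a (i + e - 1) x - a (i + e) x" by (simp add: mutate_def)
      then show ?thesis using e by (auto simp: algebra_simps)
    qed
    moreover have "?a2 (i - e) x = a (i - e) x" for x
    proof -
      have "\<not> ?p dvd - 2 * e" by (rule small) (use e in auto)
      then show ?thesis by (simp add: mutate_def algebra_simps)
    qed
    moreover have "?a3 i x = ?a2 (i + e) x + ?a2 (i - e) x - ?a2 i x" for x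
    proof -
      have "?a3 i x = ?a2 (i + 1) x + ?a2 (i - 1) x - ?a2 i x" by (simp add: mutate_def[of ?p i ?a2])
      then show ?thesis using e by auto
    qed
    ultimately have "?a3 i x = a (i + 2 * e) x + a (i - e) x - a (i + e) x + a i x - a i x" for x
      by simp
    then show ?thesis by blast
  qed
  let ?r = "chart_vertex b (mut i a) i" and ?w = "chart_vertex b ?a3 i"
  let ?X = "(1/2) *\<^sub>R ?r + (1/2) *\<^sub>R ?w"
  have w: "?w = chart_vertex b a (i + 2 * e) + chart_vertex b a (i - e) - chart_vertex b a (i + e)"
    using a3i by (intro chart_vertex_reflect[OF b]) (simp add: fun_eq_iff)
  have rv: "?r = chart_vertex b a (i + e) + chart_vertex b a (i - e) - chart_vertex b a i"
  proof -
    have "?r = chart_vertex b a (i + 1) + chart_vertex b a (i - 1) - chart_vertex b a i"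
      by (simp add: chart_vertex_mutate)
    then show ?thesis using e by auto
  qed
  let ?f = "weight a i" and ?g = "weight a ?j"
  note [simp] = weight_chart_vertex[OF b a] affine_function_reflect[OF affine_weight]
  have "\<not> ?p dvd e" by (rule small) (use e in auto)
  moreover have "\<not> ?p dvd 2 * e" by (rule small) (use e in auto)
  ultimately have fr: "?f ?r = - 1" and fw: "?f ?w = 0" and gr: "?g ?r = 1" and gw: "?g ?w = - 1"
    unfolding rv w by simp_all
  have "?r \<in> chart_simplex b (mut i a)" "?w \<in> chart_simplex b ?a3" by (auto intro: hull_inc)
  then have "?X \<in> chart_simplex b (mut i a) \<union> chart_simplex b a \<union> chart_simplex b ?a2 \<union> chart_simplex b ?a3"
    using conv by (intro convexD) auto
  moreover have X: "h ?X = (1/2) * h ?r + (1/2) * h ?w" if "affine_function h" for h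
    by (rule affine_functionD[OF that]) simp
  have fX: "?f ?X = - (1/2)" unfolding X[OF affine_weight] fr fw by simp
  then have negf: "\<not> 0 \<le> ?f ?X" by simp
  have gX: "?g ?X = 0" unfolding X[OF affine_weight] gr gw by simp
  have periodic: "chart_vertex b c s = chart_vertex b c t" if "alcove_chain ?p c" "?p dvd s - t" for c s t
    using that chain_vertex_eq_iff[OF b that(1), of t s] by (simp add: chart_vertex_def)
  have ac2: "alcove_chain ?p ?a2" and ac3: "alcove_chain ?p ?a3" and ac1: "alcove_chain ?p (mut i a)"
    using a k by (auto intro!: alcove_chain_mutate)
  have ij: "\<not> ?p dvd ?j - i" using \<open>\<not> ?p dvd e\<close> by simp
  have "?X \<notin> chart_simplex b (mut i a)"
  proof
    assume "?X \<in> chart_simplex b (mut i a)"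
    \<comment> \<open>At the mutated vertex the two weights are -1 and 1; all other vertices are
      those of \<open>a\<close>.\<close>
    moreover have "0 \<le> ?f (chart_vertex b (mut i a) s) + ?g (chart_vertex b (mut i a) s)" for s
    proof (cases "?p dvd s - i")
      case True
      then show ?thesis using periodic[OF ac1 True] fr gr by simp
    qed (simp add: chart_vertex_mutate)
    ultimately have "0 \<le> ?f ?X + ?g ?X"
      using affine_function_simplex_nonneg[OF affine_function_add[OF affine_weight affine_weight]] by blast
    then show False using fX gX by simp
  qed
  moreover have "?X \<notin> chart_simplex b a"
    using affine_function_simplex_nonneg[OF affine_weight weight_nonneg] negf by blast
  moreover have "?X \<notin> chart_simplex b ?a2"
    using affine_function_simplex_nonneg[OF affine_weight weight_mutate_nonneg[OF ij]] negf by blast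
  moreover have "?X \<notin> chart_simplex b ?a3"
  proof
    assume X3: "?X \<in> chart_simplex b ?a3"
    have "0 \<le> ?f (chart_vertex b ?a3 s)" for s
    proof (cases "?p dvd s - i")
      case True
      then show ?thesis using periodic[OF ac3 True] fw by simp
    next
      case False
      then have "chart_vertex b ?a3 s = chart_vertex b ?a2 s" by (simp add: chart_vertex_def mutate_def)
      then show ?thesis using weight_mutate_nonneg[OF ij] by simp
    qed
    from affine_function_simplex_nonneg[OF affine_weight this X3] fX show False by simp
  qed
  ultimately show False by blast
qed

text \<open>In each coordinate at most one of the two increments around \<open>i\<close> is nonzero,
  so \<open>a i\<close> and its mirror image are the values of \<open>a (i - 1)\<close> and
  \<open>a (i + 1)\<close> in some order; intersection and sum of the two lattices are then the
  neighbours.\<close>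

lemma successor_mutate:
  "successor k (chain_facet b a, apartment_vertex b (a i)) (chain_facet b (mut i a), apartment_vertex b (a (i + 1)))"
  unfolding successor_def
proof (intro conjI exI)
  let ?p = "int k + 1"
  let ?Ls = "map (\<lambda>j. apartment_lattice b (a (i + int j))) [0..<k + 1]"
  let ?L' = "apartment_lattice b (mut i a i)"
  have up: "[0..<k + 1] = 0 # map Suc [0..<k]" by (simp add: upt_conv_Cons map_Suc_upt del: upt_Suc)
  have hd: "hd ?Ls = apartment_lattice b (a i)" unfolding up by simp
  have last: "last ?Ls = apartment_lattice b (a (i + int k))" by simp
  have mp: "alcove_chain ?p (mut i a)" using a k by (intro alcove_chain_mutate) auto
  have "a (i + int k) x = a (i - 1) x + 1" for x using alcove_chain_period[OF a, of "i - 1" 1 x] by simp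
  then have ik: "apartment_lattice b (a (i + int k)) = scale \<pi> (apartment_lattice b (a (i - 1)))"
    by (simp add: scale_apartment_lattice[OF b]) metis
  have mi: "mut i a i = (\<lambda>x. a (i + 1) x + a (i - 1) x - a i x)" by (simp add: mutate_def)
  have scaleL': "scale \<pi> ?L' = apartment_lattice b (mut i a (i + 1 + int k))"
    using alcove_chain_period[OF mp, of i 1] by (simp add: scale_apartment_lattice[OF b] algebra_simps) metis
  \<comment> \<open>Among the indices from \<open>i + 1\<close> to \<open>i + 1 + int k\<close> only
    the last is congruent to \<open>i\<close>, so mutation changes just the last lattice.\<close>
  have tl: "tl ?Ls @ [scale \<pi> ?L'] = map (\<lambda>j. apartment_lattice b (mut i a (i + 1 + int j))) [0..<k + 1]"
  proof -
    have "mut i a (i + 1 + int j) = a (i + 1 + int j)" if "j < k" for j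
    proof -
      have "\<not> ?p dvd 1 + int j" using that zdvd_imp_le[of ?p "1 + int j"] by auto
      then show ?thesis by (simp add: mutate_def algebra_simps)
    qed
    then have "tl ?Ls = map (\<lambda>j. apartment_lattice b (mut i a (i + 1 + int j))) [0..<k]"
      unfolding up by (auto simp: algebra_simps)
    then show ?thesis unfolding scaleL' by simp
  qed
  show "1 \<le> k" by (rule k)
  show "length ?Ls = k + 1" by simp
  show "lattice_chain ?Ls" by (rule lattice_chain_alcove_chain[OF b a])
  show "lattice ?L'" by (rule lattice_apartment_lattice[OF b])
  show "(chain_facet b a, apartment_vertex b (a i)) = pointed_facet_of ?Ls"
    unfolding pointed_facet_of_def hd lattice_chain_alcove_chain(2)[OF b a] ..
  note nd = neighbour_differences[OF a k, of i]
  have "max (a i x) (mut i a i x) = a (i + 1) x" "min (a i x) (mut i a i x) = a (i - 1) x" for x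
    using nd[of x] unfolding mi by (auto simp: max_def min_def)
  then have mm: "(\<lambda>x. max (a i x) (mut i a i x)) = a (i + 1)" "(\<lambda>x. min (a i x) (mut i a i x)) = a (i - 1)"
    by auto
  have "?Ls ! 1 = apartment_lattice b (a (i + 1))" using k by (simp del: upt_Suc)
  then show "hd ?Ls \<inter> ?L' = ?Ls ! 1" unfolding hd apartment_lattice_inter[OF b] mm by simp
  show "{x + y | x y. x \<in> hd ?Ls \<and> y \<in> ?L'} = scale (inverse \<pi>) (last ?Ls)"
    unfolding hd last apartment_lattice_plus[OF b] mm ik scale_scale by simp
  show "lattice_chain (tl ?Ls @ [scale \<pi> ?L'])" unfolding tl by (rule lattice_chain_alcove_chain[OF b mp])
  have "mut i a (i + 1) = a (i + 1)" using not_dvd_neighbours(1)[of ?p i i] k by (simp add: mutate_def)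
  moreover have "hd (map (\<lambda>j. apartment_lattice b (mut i a (i + 1 + int j))) [0..<k + 1]) = apartment_lattice b (mut i a (i + 1))"
    unfolding up by simp
  ultimately show "(chain_facet b (mut i a), apartment_vertex b (a (i + 1))) = pointed_facet_of (tl ?Ls @ [scale \<pi> ?L'])"
    unfolding tl pointed_facet_of_def lattice_chain_alcove_chain(2)[OF b mp] by simp
qed

text \<open>The tail of the chain survives in the next facet, so the vertex of \<open>a i\<close>,
  which disappears, can only be the head; then the chain, and with it the next marked vertex, is
  determined.\<close>

lemma successor_mutateD:
  assumes suc: "successor k (chain_facet b a, v) (chain_facet b (mut i a), v')"
  shows "v = apartment_vertex b (a i)" "v' = apartment_vertex b (a (i + 1))"
proof -
  obtain Ls N where len: "length Ls = k + 1" and ch: "lattice_chain Ls"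
    and P: "(chain_facet b a, v) = pointed_facet_of Ls"
    and P': "(chain_facet b (mut i a), v') = pointed_facet_of (tl Ls @ [N])"
    using suc unfolding successor_def by blast
  have ne: "Ls \<noteq> []" using len by auto
  have C: "chain_facet b a = homothety_class ` set Ls" and v: "v = homothety_class (hd Ls)"
    and C': "chain_facet b (mut i a) = homothety_class ` set (tl Ls @ [N])"
    and v': "v' = homothety_class (hd (tl Ls @ [N]))"
    using P P' by (simp_all add: pointed_facet_of_def)
  have "apartment_vertex b (a i) \<in> homothety_class ` set Ls" unfolding C[symmetric] by simp
  then obtain L where L: "L \<in> set Ls" "apartment_vertex b (a i) = homothety_class L" by auto
  have "L \<notin> set (tl Ls)"
    using vertex_notin_mutate[OF b a k, of i] unfolding C' L(2) by auto
  then have "L = hd Ls" using L(1) ne by (cases Ls) auto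
  then show vi: "v = apartment_vertex b (a i)" using L(2) v by simp
  let ?Ks = "map (\<lambda>j. apartment_lattice b (a (i + int j))) [0..<k + 1]"
  have up: "[0..<k + 1] = 0 # map Suc [0..<k]" by (simp add: upt_conv_Cons map_Suc_upt del: upt_Suc)
  have hdK: "hd ?Ks = apartment_lattice b (a i)" unfolding up by simp
  have "pointed_facet_of ?Ks = (chain_facet b a, v)"
    unfolding vi pointed_facet_of_def lattice_chain_alcove_chain(2)[OF b a] hdK ..
  then have "pointed_facet_of ?Ks = pointed_facet_of Ls" by (simp only: P)
  then obtain c where c: "c \<noteq> 0" "Ls = map (scale c) ?Ks"
    using pointed_facet_of_eqD[OF lattice_chain_alcove_chain(1)[OF b a] ch] by blast
  obtain L0 L1 Lr where "Ls = L0 # L1 # Lr" using len k by (cases Ls; cases "tl Ls") auto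
  then have "hd (tl Ls @ [N]) = Ls ! 1" by simp
  also have "Ls ! 1 = scale c (apartment_lattice b (a (i + 1)))"
    unfolding c(2) using k by (simp del: upt_Suc)
  finally show "v' = apartment_vertex b (a (i + 1))"
    unfolding v' by (simp add: homothety_class_scale c(1))
qed

end

end

section \<open>Sequences of mutations and their pointings\<close>

context nonarch_local_field
begin

definition mutation_path ::
    "('n::finite \<Rightarrow> 'a ^ 'n) \<Rightarrow> nat \<Rightarrow> nat \<Rightarrow> (nat \<Rightarrow> int \<Rightarrow> 'n \<Rightarrow> int) \<Rightarrow> (nat \<Rightarrow> int) \<Rightarrow> bool" where
  "mutation_path b k m A d \<longleftrightarrow> indexed_basis b \<and> 1 \<le> k \<and> (\<forall>l\<le>m. alcove_chain (int k + 1) (A l)) \<and>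
     (\<forall>l<m. A (l + 1) = mutate (int k + 1) (d l) (A l))"

text \<open>Mutation is an involution, so the reversed sequence uses the same indices in reverse
  order.\<close>

lemma mutation_path_rev:
  assumes "mutation_path b k m A d"
  shows "mutation_path b k m (\<lambda>l. A (m - l)) (\<lambda>l. d (m - 1 - l))"
  unfolding mutation_path_def
proof (intro conjI allI impI)
  fix l assume l: "l < m"
  have k: "1 \<le> k" and step: "\<forall>l<m. A (l + 1) = mutate (int k + 1) (d l) (A l)"
    using assms by (simp_all add: mutation_path_def)
  have index: "m - 1 - l < m" "m - 1 - l + 1 = m - l" "m - (l + 1) = m - 1 - l" using l by simp_all
  have "A (m - l) = mutate (int k + 1) (d (m - 1 - l)) (A (m - 1 - l))"
    using step[rule_format, OF index(1)] unfolding index(2) .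
  then show "A (m - (l + 1)) = mutate (int k + 1) (d (m - 1 - l)) (A (m - l))"
    unfolding index(3) using k by (simp only: mutate_mutate)
qed (use assms in \<open>auto simp: mutation_path_def\<close>)

text \<open>Each facet is marked at the vertex about to be mutated. The last facet has no mutation
  of its own and takes the index following the one mutated before it.\<close>

definition mutation_pointing ::
    "('n::finite \<Rightarrow> 'a ^ 'n) \<Rightarrow> nat \<Rightarrow> (nat \<Rightarrow> int \<Rightarrow> 'n \<Rightarrow> int) \<Rightarrow> (nat \<Rightarrow> int) \<Rightarrow> ('a, 'n) vertex list" where
  "mutation_pointing b m A d =
     map (\<lambda>l. apartment_vertex b (A l (if l < m then d l else d (m - 1) + 1))) [0..<m + 1]"

context
  fixes b :: "'n::finite \<Rightarrow> 'a ^ 'n" and k m :: nat and A :: "nat \<Rightarrow> int \<Rightarrow> 'n \<Rightarrow> int"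
    and d :: "nat \<Rightarrow> int" and Cs :: "('a, 'n) facet list"
  assumes path: "mutation_path b k m A d" and m: "1 \<le> m" and len: "length Cs = m + 1"
    and Cs: "\<And>l. l \<le> m \<Longrightarrow> Cs ! l = chain_facet b (A l)"
begin

lemma mutation_pathD:
  "indexed_basis b" "1 \<le> k" "l \<le> m \<Longrightarrow> alcove_chain (int k + 1) (A l)"
  "l < m \<Longrightarrow> A (l + 1) = mutate (int k + 1) (d l) (A l)"
  using path by (auto simp: mutation_path_def)

lemma unmutated_successor: "l < m \<Longrightarrow> A (l + 1) (d l + 1) = A l (d l + 1)"
  using not_dvd_neighbours(1)[of "int k + 1" "d l" "d l"] mutation_pathD(2)
  by (simp add: mutation_pathD(4)[simplified] mutate_def)

text \<open>Every step forces the marked vertices of both its facets; at an inner facet the two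
  prescriptions must agree, which is the congruence.\<close>

lemma geodesic_pointing_unique:
  assumes vs: "geodesic_pointing k Cs vs"
  shows "vs = mutation_pointing b m A d"
    and "\<And>l. l + 1 < m \<Longrightarrow> int k + 1 dvd d (l + 1) - (d l + 1)"
proof -
  have lenvs: "length vs = m + 1" using vs len by (simp add: geodesic_pointing_def)
  have suc: "successor k (Cs ! l, vs ! l) (Cs ! (l + 1), vs ! (l + 1))" if "l < m" for l
    using vs that len lenvs by (simp add: geodesic_pointing_def combinatorial_geodesic_def)
  have pt: "vs ! l = apartment_vertex b (A l (d l))" "vs ! (l + 1) = apartment_vertex b (A (l + 1) (d l + 1))"
    if l: "l < m" for l
  proof -
    have "successor k (chain_facet b (A l), vs ! l) (chain_facet b (mutate (int k + 1) (d l) (A l)), vs ! (l + 1))"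
      using suc[OF l] Cs[of l] Cs[of "l + 1"] mutation_pathD(4)[OF l] l by simp
    from successor_mutateD[OF mutation_pathD(1,2,3) this] l
    show "vs ! l = apartment_vertex b (A l (d l))" "vs ! (l + 1) = apartment_vertex b (A (l + 1) (d l + 1))"
      unfolding unmutated_successor[OF l] by simp_all
  qed
  show "vs = mutation_pointing b m A d"
  proof (rule nth_equalityI)
    show "length vs = length (mutation_pointing b m A d)" by (simp add: mutation_pointing_def lenvs)
    fix l assume "l < length vs"
    then have l: "l \<le> m" using lenvs by simp
    show "vs ! l = mutation_pointing b m A d ! l"
    proof (cases "l < m")
      case True
      then show ?thesis using pt(1)[OF True] by (simp add: mutation_pointing_def del: upt_Suc)
    next
      case False
      then have lm: "l = m" "m - 1 < m" "m - 1 + 1 = m" using l m by auto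
      show ?thesis using pt(2)[OF lm(2)] unfolding lm(1) lm(3)
        by (simp add: mutation_pointing_def del: upt_Suc)
    qed
  qed
  fix l assume l: "l + 1 < m"
  have "apartment_vertex b (A (l + 1) (d l + 1)) = apartment_vertex b (A (l + 1) (d (l + 1)))"
    using pt(2)[of l] pt(1)[of "l + 1"] l by simp
  then show "int k + 1 dvd d (l + 1) - (d l + 1)"
    using l chain_vertex_eq_iff[OF mutation_pathD(1) mutation_pathD(3)[of "l + 1"]] by simp
qed

lemma geodesic_pointing_exists:
  assumes d: "\<And>l. l + 1 < m \<Longrightarrow> int k + 1 dvd d (l + 1) - (d l + 1)"
  shows "geodesic_pointing k Cs (mutation_pointing b m A d)"
proof -
  let ?vs = "mutation_pointing b m A d"
  have lenvs: "length ?vs = m + 1" by (simp add: mutation_pointing_def)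
  have nth: "?vs ! l = apartment_vertex b (A l (if l < m then d l else d (m - 1) + 1))" if "l \<le> m" for l
    using that by (simp add: mutation_pointing_def del: upt_Suc)
  have mem: "?vs ! l \<in> Cs ! l" if "l \<le> m" for l
    unfolding nth[OF that] Cs[OF that] by simp
  have facet: "facet k (Cs ! l)" if "l \<le> m" for l
    unfolding Cs[OF that] using facet_chain_facet[OF mutation_pathD(1,3)] that by simp
  have suc: "successor k (Cs ! l, ?vs ! l) (Cs ! (l + 1), ?vs ! (l + 1))" if l: "l < m" for l
  proof -
    have nxt: "?vs ! (l + 1) = apartment_vertex b (A l (d l + 1))"
    proof (cases "l + 1 < m")
      case True
      then have "?vs ! (l + 1) = apartment_vertex b (A (l + 1) (d (l + 1)))" using nth[of "l + 1"] by simp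
      also have "\<dots> = apartment_vertex b (A (l + 1) (d l + 1))"
        using chain_vertex_eq_iff[OF mutation_pathD(1) mutation_pathD(3)[of "l + 1"], of "d l + 1" "d (l + 1)"]
          d[OF True] True by simp
      finally show ?thesis unfolding unmutated_successor[OF l] .
    next
      case False
      then have last: "l + 1 = m" "m - 1 = l" using l by simp_all
      show ?thesis
        using nth[OF order_refl] unfolding unmutated_successor[OF l, symmetric] last
        by (simp only: less_irrefl if_False)
    qed
    have lm: "l \<le> m" "l + 1 \<le> m" using l by simp_all
    have here: "?vs ! l = apartment_vertex b (A l (d l))" using nth[OF lm(1)] l by (simp only: if_True)
    show ?thesis
      unfolding Cs[OF lm(1)] Cs[OF lm(2)] nxt here mutation_pathD(4)[OF l]
      by (rule successor_mutate[OF mutation_pathD(1,2,3)]) (rule lm(1))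
  qed
  show ?thesis
    unfolding geodesic_pointing_def combinatorial_geodesic_def
  proof (intro conjI allI impI ballI)
    show "length ?vs = length Cs" by (simp add: lenvs len)
    show "?vs ! i \<in> Cs ! i" if "i < length Cs" for i using mem that len by simp
    show "zip Cs ?vs \<noteq> []" using len lenvs by (cases Cs; cases ?vs) auto
    show "pointed_facet k P" if P: "P \<in> set (zip Cs ?vs)" for P
    proof -
      obtain i where "i < m + 1" "P = (Cs ! i, ?vs ! i)" using P len lenvs by (auto simp: set_zip)
      then show ?thesis using mem facet by (simp add: pointed_facet_def)
    qed
    show "successor k (zip Cs ?vs ! i) (zip Cs ?vs ! Suc i)" if "Suc i < length (zip Cs ?vs)" for i
      using suc[of i] that len lenvs by simp
  qed
qed

end

text \<open>The convex hull of the two end simplices lies in an apartment through both, and it is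
  the union of all simplices in between. Adjacent facets, being distinct with convex union, then
  differ by a mutation.\<close>

lemma geometric_geodesic_mutation_path:
  fixes Cs :: "('a, 'n::finite) facet list"
  assumes n: "2 \<le> CARD('n)" and k: "1 \<le> k" and m: "1 \<le> m"
    and len: "length Cs = m + 1" and geo: "geometric_geodesic k Cs"
  obtains b A d where "mutation_path b k m A d" "\<And>l. l \<le> m \<Longrightarrow> Cs ! l = chain_facet b (A l)"
    "\<And>i j. i \<le> j \<Longrightarrow> j \<le> m \<Longrightarrow> convex (\<Union>l\<in>{i..j}. chart_simplex b (A l))"
proof -
  let ?p = "int k + 1"
  have facet: "facet k (Cs ! l)" if "l \<le> m" for l
    using geo len that by (simp add: geometric_geodesic_def)
  have dist: "distinct Cs" using geo by (simp add: geometric_geodesic_def)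
  have hull: "geodesic_convex_hull realization building_dist (closed_simplex (Cs ! i) \<union> closed_simplex (Cs ! j)) =
      (\<Union>l\<in>{i..j}. closed_simplex (Cs ! l))" if "i \<le> j" "j \<le> m" for i j
    using geo len that by (simp add: geometric_geodesic_def)
  obtain b where b: "indexed_basis b" and ends: "Cs ! 0 \<union> Cs ! m \<subseteq> apartment_vertices b"
    using facets_in_common_apartment[OF facet[of 0] facet[of m]] by auto
  have "closed_simplex (Cs ! 0) \<union> closed_simplex (Cs ! m) \<subseteq> apartment b"
    using closed_simplex_subset_apartment[OF facet[of 0]] closed_simplex_subset_apartment[OF facet[of m]] ends by simp
  from geodesic_convex_hull_convex_chart(1)[OF n b this]
  have inA: "(\<Union>l\<in>{0..m}. closed_simplex (Cs ! l)) \<subseteq> apartment b" unfolding hull[OF le0 order_refl] .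
  have sub: "closed_simplex (Cs ! l) \<subseteq> apartment b" if "l \<le> m" for l
    by (rule order_trans[OF UN_upper inA]) (simp add: that)
  have verts: "Cs ! l \<subseteq> apartment_vertices b" if l: "l \<le> m" for l
  proof
    fix v assume "v \<in> Cs ! l"
    then have "(\<lambda>w. if w = v then 1 else 0) \<in> closed_simplex (Cs ! l)"
      using facet_finite[OF facet[OF l]] by (rule vertex_point_closed_simplex[rotated])
    from subsetD[OF sub[OF l] this] show "v \<in> apartment_vertices b"
      unfolding apartment_def mem_Collect_eq by (elim conjE) (drule spec[of _ v] bspec[of _ _ v], simp)
  qed
  have conv: "convex (\<Union>l\<in>{i..j}. apartment_chart b ` closed_simplex (Cs ! l))" if ij: "i \<le> j" "j \<le> m" for i j
  proof -
    have "closed_simplex (Cs ! i) \<union> closed_simplex (Cs ! j) \<subseteq> apartment b" using sub ij by simp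
    from geodesic_convex_hull_convex_chart(2)[OF n b this]
    show ?thesis unfolding hull[OF ij] image_UN .
  qed
  have simplex: "apartment_chart b ` closed_simplex (Cs ! l) = chart_simplex b c"
    if "Cs ! l = chain_facet b c" "alcove_chain ?p c" for l c
    unfolding that(1) by (rule apartment_chart_chain_facet[OF b that(2)])
  have "\<exists>A d. (\<forall>l\<le>q. alcove_chain ?p (A l) \<and> Cs ! l = chain_facet b (A l)) \<and>
      (\<forall>l<q. A (l + 1) = mutate ?p (d l) (A l))" if "q \<le> m" for q
    using that
  proof (induction q)
    case 0
    obtain a where "alcove_chain ?p a" "Cs ! 0 = chain_facet b a"
      using facet_imp_chain_facet[OF b facet[of 0] verts[of 0]] by auto
    then show ?case by (intro exI[of _ "\<lambda>_. a"]) simp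
  next
    case (Suc q)
    from Suc.IH[OF Suc_leD[OF Suc.prems]] obtain A d
      where all: "\<forall>l\<le>q. alcove_chain ?p (A l) \<and> Cs ! l = chain_facet b (A l)"
      and d: "\<forall>l<q. A (l + 1) = mutate ?p (d l) (A l)" by (elim exE conjE)
    have A: "alcove_chain ?p (A l)" "Cs ! l = chain_facet b (A l)" if "l \<le> q" for l
      using all[rule_format, OF that] by simp_all
    obtain a' where a': "alcove_chain ?p a'" "Cs ! Suc q = chain_facet b a'"
      using facet_imp_chain_facet[OF b facet[OF Suc.prems] verts[OF Suc.prems]] by metis
    have ne: "chain_facet b (A q) \<noteq> chain_facet b a'"
      using dist len Suc.prems nth_eq_iff_index_eq[OF dist, of q "Suc q"] A(2)[of q] a'(2) by simp
    have "{q..Suc q} = {q, Suc q}" by auto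
    then have "convex (chart_simplex b (A q) \<union> chart_simplex b a')"
      using conv[of q "Suc q"] Suc.prems simplex[OF A(2)[of q] A(1)[of q]] simplex[OF a'(2,1)] by simp
    from adjacent_facets_mutate[OF b k A(1)[OF order_refl] a'(1) ne this]
    obtain i where i: "chain_facet b a' = chain_facet b (mutate ?p i (A q))" by blast
    \<comment> \<open>The mutated chain is taken instead of \<open>a'\<close>: both describe the
      same facet, but this one has its indices aligned with \<open>A q\<close>.\<close>
    define A' where "A' = A(Suc q := mutate ?p i (A q))"
    define d' where "d' = d(q := i)"
    have "alcove_chain ?p (mutate ?p i (A q))" using A(1)[of q] k by (intro alcove_chain_mutate) auto
    then have "\<forall>l\<le>Suc q. alcove_chain ?p (A' l) \<and> Cs ! l = chain_facet b (A' l)"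
      using A a'(2) i by (auto simp: A'_def le_Suc_eq)
    moreover have "\<forall>l<Suc q. A' (l + 1) = mutate ?p (d' l) (A' l)"
      using d by (auto simp: A'_def d'_def less_Suc_eq)
    ultimately show ?case by (intro exI[of _ A'] exI[of _ d'] conjI)
  qed
  from this[OF order_refl] obtain A d
    where all: "\<forall>l\<le>m. alcove_chain ?p (A l) \<and> Cs ! l = chain_facet b (A l)"
    and d: "\<forall>l<m. A (l + 1) = mutate ?p (d l) (A l)" by (elim exE conjE)
  have A: "alcove_chain ?p (A l)" "Cs ! l = chain_facet b (A l)" if "l \<le> m" for l
    using all[rule_format, OF that] by simp_all
  have "convex (\<Union>l\<in>{i..j}. chart_simplex b (A l))" if ij: "i \<le> j" "j \<le> m" for i j
  proof -
    have "(\<Union>l\<in>{i..j}. chart_simplex b (A l)) = (\<Union>l\<in>{i..j}. apartment_chart b ` closed_simplex (Cs ! l))"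
    proof (rule SUP_cong)
      fix l assume "l \<in> {i..j}"
      then have "l \<le> m" using ij by simp
      then show "chart_simplex b (A l) = apartment_chart b ` closed_simplex (Cs ! l)"
        using simplex[OF A(2,1)] by simp
    qed simp
    then show ?thesis using conv[OF ij] by simp
  qed
  note convex = this
  have "mutation_path b k m A d" unfolding mutation_path_def using b k all d by simp
  from that[OF this A(2) convex] show ?thesis .
qed

text \<open>
  Along a geodesic the index of the mutated vertex moves by one step in a fixed direction; this
  direction decides which orientation is combinatorial.
\<close>

lemma mutation_path_direction:
  fixes Cs :: "('a, 'n::finite) facet list"
  assumes path: "mutation_path b k m A d" and len: "length Cs = m + 1" and dist: "distinct Cs"
    and Cs: "\<And>l. l \<le> m \<Longrightarrow> Cs ! l = chain_facet b (A l)"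
    and conv: "\<And>i j. i \<le> j \<Longrightarrow> j \<le> m \<Longrightarrow> convex (\<Union>l\<in>{i..j}. chart_simplex b (A l))"
  shows "\<exists>e\<in>{1, - 1}. \<forall>l. l + 1 < m \<longrightarrow> int k + 1 dvd d (l + 1) - (d l + e)"
    and "k = 1 \<Longrightarrow> l + 1 < m \<Longrightarrow> int k + 1 dvd d (l + 1) - (d l + 1)"
proof -
  let ?p = "int k + 1"
  from path have b: "indexed_basis b" and k: "1 \<le> k" and A: "\<And>l. l \<le> m \<Longrightarrow> alcove_chain ?p (A l)"
    and d: "\<And>l. l < m \<Longrightarrow> A (Suc l) = mutate ?p (d l) (A l)" by (auto simp: mutation_path_def)
  have p2: "2 \<le> ?p" using k by simp
  have prev_eq: "A l = mutate ?p (d l) (A (Suc l))" if "l < m" for l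
    by (simp only: d[OF that] mutate_mutate[OF p2])
  \<comment> \<open>Mutating the same index twice would return to an earlier facet, against
    distinctness.\<close>
  have moves: "\<not> ?p dvd d (Suc l) - d l" if l: "Suc l < m" for l
  proof
    assume "?p dvd d (Suc l) - d l"
    then have "A (Suc (Suc l)) = mutate ?p (d l) (A (Suc l))" using d[of "Suc l"] mutate_cong l by metis
    then have "A (Suc (Suc l)) = A l" using prev_eq[of l] l by simp
    then have "Cs ! Suc (Suc l) = Cs ! l" using Cs l by simp
    then show False using nth_eq_iff_index_eq[OF dist, of "Suc (Suc l)" l] len l by simp
  qed
  have step: "?p dvd d (Suc l) - (d l + 1) \<or> ?p dvd d (Suc l) - (d l - 1)" if l: "Suc l < m" for l
  proof -
    have "{l..Suc (Suc l)} = {l, Suc l, Suc (Suc l)}" by auto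
    moreover have "convex (\<Union>i\<in>{l..Suc (Suc l)}. chart_simplex b (A i))" by (rule conv) (use l in simp_all)
    ultimately have "convex (chart_simplex b (A l) \<union> chart_simplex b (A (Suc l)) \<union> chart_simplex b (A (Suc (Suc l))))"
      by (simp only: UN_insert UN_empty Un_empty_right Un_assoc)
    then have "convex (chart_simplex b (mutate ?p (d l) (A (Suc l))) \<union> chart_simplex b (A (Suc l)) \<union>
        chart_simplex b (mutate ?p (d (Suc l)) (A (Suc l))))"
      unfolding prev_eq[OF Suc_lessD[OF l]] d[OF l] .
    from consecutive_mutations_adjacent[OF b k A this moves[OF l]] l show ?thesis by simp
  qed
  \<comment> \<open>Modulo 2, any change of the index is a step by 1.\<close>
  have alternate: "?p dvd d (l + 1) - (d l + 1)" if k1: "k = 1" and l: "l + 1 < m" for l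
  proof -
    have p: "?p = 2" using k1 by simp
    have "\<not> 2 dvd d (Suc l) - d l" using moves[of l] l unfolding p by simp
    then have "2 dvd d (Suc l) - (d l + 1)" by presburger
    then show ?thesis unfolding p by simp
  qed
  show "k = 1 \<Longrightarrow> l + 1 < m \<Longrightarrow> ?p dvd d (l + 1) - (d l + 1)" by (rule alternate)
  show "\<exists>e\<in>{1, - 1}. \<forall>l. l + 1 < m \<longrightarrow> ?p dvd d (l + 1) - (d l + e)"
  proof (cases "k = 1")
    case True
    then show ?thesis using alternate by blast
  next
    case False
    then have k2: "2 \<le> k" using k by simp
    \<comment> \<open>A change of direction would return to the index \<open>d l\<close>, and the
      four consecutive facets would have no convex union.\<close>
    have keep: "?p dvd d (Suc (Suc l)) - (d (Suc l) + e)"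
      if l: "Suc (Suc l) < m" and e: "e = 1 \<or> e = - 1" and prev: "?p dvd d (Suc l) - (d l + e)" for l e
    proof (rule ccontr)
      assume "\<not> ?p dvd d (Suc (Suc l)) - (d (Suc l) + e)"
      then have "?p dvd d (Suc (Suc l)) - (d (Suc l) - e)" using step[OF l] e by auto
      from dvd_add[OF this prev] have ret: "?p dvd d (Suc (Suc l)) - d l" by simp
      have "{l..Suc (Suc (Suc l))} = {l, Suc l, Suc (Suc l), Suc (Suc (Suc l))}" by auto
      moreover have "convex (\<Union>i\<in>{l..Suc (Suc (Suc l))}. chart_simplex b (A i))"
        by (rule conv) (use l in simp_all)
      ultimately have "convex (chart_simplex b (A l) \<union> chart_simplex b (A (Suc l)) \<union>
          chart_simplex b (A (Suc (Suc l))) \<union> chart_simplex b (A (Suc (Suc (Suc l)))))"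
        by (simp only: UN_insert UN_empty Un_empty_right Un_assoc)
      moreover have A0: "A l = mutate ?p (d l) (A (Suc l))" using l by (intro prev_eq) simp
      moreover have A2: "A (Suc (Suc l)) = mutate ?p (d l + e) (A (Suc l))"
        unfolding d[OF Suc_lessD[OF l]] by (rule mutate_cong[OF prev])
      moreover have A3: "A (Suc (Suc (Suc l))) = mutate ?p (d l) (mutate ?p (d l + e) (A (Suc l)))"
        unfolding d[OF l] A2[symmetric] by (rule mutate_cong[OF ret])
      ultimately have "convex (chart_simplex b (mutate ?p (d l) (A (Suc l))) \<union> chart_simplex b (A (Suc l)) \<union>
          chart_simplex b (mutate ?p (d l + e) (A (Suc l))) \<union>
          chart_simplex b (mutate ?p (d l) (mutate ?p (d l + e) (A (Suc l)))))"
        by (simp only:)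
      from no_returning_mutation[OF b k A k2 e this] l show False by simp
    qed
    show ?thesis
    proof (cases "Suc 0 < m")
      case True
      from step[OF this] obtain e where e: "e = 1 \<or> e = - 1" and e0: "?p dvd d (Suc 0) - (d 0 + e)" by force
      have "?p dvd d (Suc l) - (d l + e)" if "Suc l < m" for l
        using that by (induction l) (use e0 keep[OF _ e] in auto)
      then show ?thesis using e by auto
    qed auto
  qed
qed

text \<open>With \<open>e\<close> the direction of the geodesic, a pointing exists forwards iff
  \<open>e\<close> is 1, and backwards iff \<open>- e\<close> is 1, modulo \<open>k + 1\<close>. Two
  mutations, which \<open>2 \<le> m\<close> provides, are needed for the direction to exclude an
  orientation.\<close>

theorem geometric_geodesic_pointings:
  fixes Cs :: "('a, 'n::finite) facet list"
  assumes n: "2 \<le> CARD('n)" and k: "1 \<le> k" and m: "2 \<le> m"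
    and len: "length Cs = m + 1" and geo: "geometric_geodesic k Cs"
  shows "\<exists>\<^sub>\<le>\<^sub>1 vs. geodesic_pointing k Cs vs" "\<exists>\<^sub>\<le>\<^sub>1 vs. geodesic_pointing k (rev Cs) vs"
    and "2 \<le> k \<Longrightarrow> (\<exists>vs. geodesic_pointing k Cs vs) \<noteq> (\<exists>vs. geodesic_pointing k (rev Cs) vs)"
    and "k = 1 \<Longrightarrow> \<exists>vs. geodesic_pointing k Cs vs" "k = 1 \<Longrightarrow> \<exists>vs. geodesic_pointing k (rev Cs) vs"
proof -
  let ?p = "int k + 1"
  have m1: "1 \<le> m" using m by simp
  obtain b A d where path: "mutation_path b k m A d" and Cs: "\<And>l. l \<le> m \<Longrightarrow> Cs ! l = chain_facet b (A l)"
    and conv: "\<And>i j. i \<le> j \<Longrightarrow> j \<le> m \<Longrightarrow> convex (\<Union>l\<in>{i..j}. chart_simplex b (A l))"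
    using geometric_geodesic_mutation_path[OF n k m1 len geo] by metis
  have dist: "distinct Cs" using geo by (simp add: geometric_geodesic_def)
  define A' where "A' l = A (m - l)" for l
  define d' where "d' l = d (m - 1 - l)" for l
  have path': "mutation_path b k m A' d'" using mutation_path_rev[OF path] by (simp add: A'_def[abs_def] d'_def[abs_def])
  have len': "length (rev Cs) = m + 1" using len by simp
  have Cs': "rev Cs ! l = chain_facet b (A' l)" if "l \<le> m" for l
    using that len Cs[of "m - l"] by (simp add: rev_nth A'_def)
  have uniq: "vs = mutation_pointing b m A d" "l + 1 < m \<Longrightarrow> ?p dvd d (l + 1) - (d l + 1)"
    if "geodesic_pointing k Cs vs" for vs l
    by (rule geodesic_pointing_unique[OF path m1 len Cs that]; assumption)+
  have uniq': "vs = mutation_pointing b m A' d'" "l + 1 < m \<Longrightarrow> ?p dvd d' (l + 1) - (d' l + 1)"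
    if "geodesic_pointing k (rev Cs) vs" for vs l
    by (rule geodesic_pointing_unique[OF path' m1 len' Cs' that]; assumption)+
  have ex: "\<exists>vs. geodesic_pointing k Cs vs" if "\<And>l. l + 1 < m \<Longrightarrow> ?p dvd d (l + 1) - (d l + 1)"
    by (rule exI, rule geodesic_pointing_exists[OF path m1 len Cs that])
  have ex': "\<exists>vs. geodesic_pointing k (rev Cs) vs" if "\<And>l. l + 1 < m \<Longrightarrow> ?p dvd d' (l + 1) - (d' l + 1)"
    by (rule exI, rule geodesic_pointing_exists[OF path' m1 len' Cs' that])
  have dir: "\<exists>e\<in>{1, - 1}. \<forall>l. l + 1 < m \<longrightarrow> ?p dvd d (l + 1) - (d l + e)"
    by (rule mutation_path_direction(1)[OF path len dist Cs conv])
  have alt: "?p dvd d (l + 1) - (d l + 1)" if "k = 1" "l + 1 < m" for l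
    by (rule mutation_path_direction(2)[OF path len dist Cs conv that])
  have rev_index: "d' (l + 1) = d (m - 2 - l)" "d' l = d ((m - 2 - l) + 1)" "(m - 2 - l) + 1 < m" if "l + 1 < m" for l
    using that by (auto simp: d'_def intro!: arg_cong[of _ _ d])
  show "\<exists>\<^sub>\<le>\<^sub>1 vs. geodesic_pointing k Cs vs" using uniq(1) by (intro Uniq_I) metis
  show "\<exists>\<^sub>\<le>\<^sub>1 vs. geodesic_pointing k (rev Cs) vs" using uniq'(1) by (intro Uniq_I) metis
  show "\<exists>vs. geodesic_pointing k Cs vs" if "k = 1" by (rule ex) (rule alt[OF that])
  show "\<exists>vs. geodesic_pointing k (rev Cs) vs" if k1: "k = 1"
  proof (rule ex')
    fix l assume l: "l + 1 < m"
    have p: "?p = 2" using k1 by simp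
    have "2 dvd d (m - 2 - l + 1) - (d (m - 2 - l) + 1)" using alt[OF k1 rev_index(3)[OF l]] unfolding p .
    then have "2 dvd d (m - 2 - l) - (d (m - 2 - l + 1) + 1)" by presburger
    then show "?p dvd d' (l + 1) - (d' l + 1)" unfolding p rev_index(1,2)[OF l] .
  qed
  show "(\<exists>vs. geodesic_pointing k Cs vs) \<noteq> (\<exists>vs. geodesic_pointing k (rev Cs) vs)" if k2: "2 \<le> k"
  proof -
    have p2: "\<not> ?p dvd 2"
    proof
      assume "?p dvd 2"
      then have "?p \<le> 2" by (rule zdvd_imp_le) simp
      then show False using k2 by simp
    qed
    obtain e where e: "e = 1 \<or> e = - 1" and de: "\<And>l. l + 1 < m \<Longrightarrow> ?p dvd d (l + 1) - (d l + e)"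
      using dir by blast
    \<comment> \<open>Reversal exchanges the roles of two consecutive indices, hence changes the
      sign of \<open>e\<close>.\<close>
    have de': "?p dvd d' (l + 1) - (d' l - e)" if l: "l + 1 < m" for l
    proof -
      have "d' (l + 1) - (d' l - e) = - (d ((m - 2 - l) + 1) - (d (m - 2 - l) + e))"
        by (simp only: rev_index(1,2)[OF l])
      then show ?thesis using de[OF rev_index(3)[OF l]] by (simp only: dvd_minus_iff)
    qed
    have zero: "0 + 1 < m" using m by simp
    show ?thesis
    proof (cases "e = 1")
      case True
      have "\<not> geodesic_pointing k (rev Cs) vs" for vs
      proof
        assume "geodesic_pointing k (rev Cs) vs"
        \<comment> \<open>The steps -1 and 1 would agree modulo \<open>k + 1\<close>, which would
          then divide 2.\<close>
        from dvd_diff[OF de'[OF zero] uniq'(2)[OF this zero]] p2 show False unfolding True by simp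
      qed
      moreover have "\<exists>vs. geodesic_pointing k Cs vs" by (rule ex) (use de True in simp)
      ultimately show ?thesis by blast
    next
      case False
      then have e': "e = - 1" using e by simp
      have "\<not> geodesic_pointing k Cs vs" for vs
      proof
        assume "geodesic_pointing k Cs vs"
        from dvd_diff[OF de[OF zero] uniq(2)[OF this zero]] p2 show False unfolding e' by simp
      qed
      moreover have "\<exists>vs. geodesic_pointing k (rev Cs) vs" by (rule ex') (use de' e' in simp)
      ultimately show ?thesis by blast
    qed
  qed
qed

end

theorem theorem5p1:
  fixes val :: "'a::field \<Rightarrow> int" and \<pi> :: 'a and k m :: nat
  assumes "nonarch_local_field val \<pi>"
    and "2 \<le> CARD('n::finite)"
    and "1 \<le> k" and "k \<le> CARD('n) - 1"
    and "2 \<le> m"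
  shows
    "(\<forall>Cs :: ('a, 'n) facet list.
        length Cs = m + 1 \<and> nonarch_local_field.geometric_geodesic val \<pi> k Cs \<longrightarrow>
          (\<exists>\<^sub>\<le>\<^sub>1 vs. nonarch_local_field.geodesic_pointing val \<pi> k Cs vs) \<and>
          (\<exists>\<^sub>\<le>\<^sub>1 vs. nonarch_local_field.geodesic_pointing val \<pi> k (rev Cs) vs) \<and>
          (2 \<le> k \<longrightarrow>
             (\<exists>vs. nonarch_local_field.geodesic_pointing val \<pi> k Cs vs) \<noteq>
             (\<exists>vs. nonarch_local_field.geodesic_pointing val \<pi> k (rev Cs) vs)) \<and>
          (k = 1 \<longrightarrow>
             (\<exists>vs. nonarch_local_field.geodesic_pointing val \<pi> k Cs vs) \<and>
             (\<exists>vs. nonarch_local_field.geodesic_pointing val \<pi> k (rev Cs) vs))) \<and>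
     (\<forall>Ps :: (('a, 'n) facet \<times> ('a, 'n) vertex) list.
        length Ps = m + 1 \<and> nonarch_local_field.combinatorial_geodesic val \<pi> k Ps \<longrightarrow>
          nonarch_local_field.geometric_geodesic val \<pi> k (map fst Ps))"
proof -
  interpret nonarch_local_field val \<pi> by (fact assms(1))
  have m: "1 \<le> m" using assms(5) by simp
  show ?thesis
  proof (intro conjI allI impI; elim conjE)
    fix Cs :: "('a, 'n) facet list"
    assume Cs: "length Cs = m + 1" "geometric_geodesic k Cs"
    note pointings = geometric_geodesic_pointings[OF assms(2,3,5) Cs]
    show "\<exists>\<^sub>\<le>\<^sub>1 vs. geodesic_pointing k Cs vs" by (rule pointings(1))
    show "\<exists>\<^sub>\<le>\<^sub>1 vs. geodesic_pointing k (rev Cs) vs" by (rule pointings(2))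
    show "(\<exists>vs. geodesic_pointing k Cs vs) \<noteq> (\<exists>vs. geodesic_pointing k (rev Cs) vs)" if "2 \<le> k"
      by (rule pointings(3)[OF that])
    show "\<exists>vs. geodesic_pointing k Cs vs" if "k = 1" by (rule pointings(4)[OF that])
    show "\<exists>vs. geodesic_pointing k (rev Cs) vs" if "k = 1" by (rule pointings(5)[OF that])
  next
    fix Ps :: "(('a, 'n) facet \<times> ('a, 'n) vertex) list"
    assume "length Ps = m + 1" "combinatorial_geodesic k Ps"
    then show "geometric_geodesic k (map fst Ps)"
      by (rule combinatorial_imp_geometric_geodesic[OF assms(2,3) m])
  qed
qed

end
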